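(* Let $d$ be a positive integer and let $M$ be a plane map of outer degree $d$ having no face of degree less than $d$. Then $M$ admits a $d/(d-2)$-orientation if and only if $M$ has girth $d$. In this case, there exists a unique $d/(d-2)$-orientation of $M$ that is suitable.
   Context: A planar map is a connected graph (loops and multiple edges allowed) embedded without edge-crossings in the oriented sphere, considered up to continuous deformation; its faces are the connected components of the complement. Each edge consists of two half-edges, each incident to one endpoint. A corner is the angular section between two consecutive half-edges around a vertex; the degree of a vertex or face is its number of incident corners. The girth is the minimal length of a cycle. A plane map is a planar map with a distinguished face, the root-face, drawn as the unbounded (outer) face; its degree is the outer degree. Vertices, edges, half-edges incident to (lying on edges incident to) the root-face are outer, the others inner; faces other than the root-face are inner. A biorientation assigns to each half-edge a direction: ingoing (toward its vertex) or outgoing. An edge is $i$-way if exactly $i$ of its half-edges are ingoing. An edge $\{u,v\}$ can be traversed from $u$ to $v$ if it is 2-way, or 1-way with its ingoing half-edge at $v$. A biorientation is accessible from a vertex $v$ if every vertex can be reached from $v$ by a path traversing each edge in an allowed direction. A counterclockwise circuit is a simple cycle $C$ such that every edge of $C$ can be traversed in the direction that keeps the interior of $C$ on its left. A biorientation of a plane map is minimal if it has no counterclockwise circuit. A $\mathbb{Z}$-biorientation is a biorientation with an integer weight on each half-edge, positive if ingoing and non-positive if outgoing. The weight of an edge is the sum of the weights of its two half-edges; the weight of a vertex is the sum of the weights of the ingoing half-edges incident to it; the weight $w(f)$ of a face $f$ is the sum of the weights of the outgoing half-edges $h$ incident to $f$ such that $f$ lies on the right of $h$ (when $h$ is traversed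 from its vertex toward the middle of its edge). A $\mathbb{Z}$-biorientation of a plane map is admissible if the contour of the outer face is a simple cycle of 1-way edges each having weight $0$ on its outgoing half-edge and $1$ on its ingoing half-edge, and every inner half-edge incident to an outer vertex is outgoing. It is suitable if it is minimal, admissible, and accessible from every outer vertex. A $d/(d-2)$-orientation of $M$ is an admissible $\mathbb{Z}$-biorientation in which every outgoing half-edge has weight $0$, $-1$ or $-2$, and (i) each inner edge has weight $d-2$, (ii) each inner vertex has weight $d$, (iii) each inner face $f$ satisfies $\deg(f)+w(f)=d$. *)

theory Defs
  imports
    "HOL-Combinatorics.Permutations"
    "HOL-Combinatorics.Orbits"
    "HOL-Library.FuncSet"
    "HOL-Library.Extended_Nat"
begin

section \<open>Plane maps\<close>

text \<open>
  Maps embedded in the oriented sphere, up to orientation-preserving homeomorphism, are encoded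
  by their rotation systems. A half-edge is traversed from its vertex towards the middle of its
  edge; \<open>rot M h\<close> is the next half-edge after \<open>h\<close> in counterclockwise
  order around the vertex of \<open>h\<close>, and \<open>opp M h\<close> is the other half of the edge of \<open>h\<close>.
  With this convention, following an edge and then turning by \<open>rot\<close> keeps the same face on
  the right. Hence the orbits of \<open>rot M \<circ> opp M\<close> correspond to the faces, the orbit of \<open>h\<close> being
  the face lying on the right of \<open>h\<close>. Vertices, edges and faces are represented by their orbits.
\<close>

record 'h plane_map =
  halfedges :: "'h set"
  rot :: "'h \<Rightarrow> 'h"
  opp :: "'h \<Rightarrow> 'h"
  root_face :: "'h set"

definition vertex_of :: "'h plane_map \<Rightarrow> 'h \<Rightarrow> 'h set" where
  "vertex_of M h = orbit (rot M) h"

definition edge_of :: "'h plane_map \<Rightarrow> 'h \<Rightarrow> 'h set" where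
  "edge_of M h = {h, opp M h}"

definition face_of :: "'h plane_map \<Rightarrow> 'h \<Rightarrow> 'h set" where
  "face_of M h = orbit (rot M \<circ> opp M) h"

definition vertices :: "'h plane_map \<Rightarrow> 'h set set" where
  "vertices M = vertex_of M ` halfedges M"

definition edges :: "'h plane_map \<Rightarrow> 'h set set" where
  "edges M = edge_of M ` halfedges M"

definition faces :: "'h plane_map \<Rightarrow> 'h set set" where
  "faces M = face_of M ` halfedges M"

definition map_connected :: "'h plane_map \<Rightarrow> bool" where
  "map_connected M \<longleftrightarrow>
     (\<forall>h\<in>halfedges M. \<forall>k\<in>halfedges M. (h, k) \<in> {(x, y). y = rot M x \<or> y = opp M x}\<^sup>*)"

text \<open>
  Planarity is expressed by Euler's formula. The map with one vertex and no edge has no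
  half-edges and is not represented; its only face has degree 0.
\<close>

definition is_plane_map :: "'h plane_map \<Rightarrow> bool" where
  "is_plane_map M \<longleftrightarrow>
     finite (halfedges M) \<and>
     rot M permutes halfedges M \<and>
     opp M permutes halfedges M \<and>
     (\<forall>h\<in>halfedges M. opp M h \<noteq> h \<and> opp M (opp M h) = h) \<and>
     map_connected M \<and>
     card (vertices M) + card (faces M) = card (edges M) + 2 \<and>
     root_face M \<in> faces M"

text \<open>
  The face on the right of \<open>h\<close> has exactly one corner between \<open>h\<close> and its clockwise neighbour at the
  vertex of \<open>h\<close>, so the corners of a face are in bijection with the half-edges of its orbit.
\<close>

definition face_degree :: "'h set \<Rightarrow> nat" where
  "face_degree f = card f"

definition outer_degree :: "'h plane_map \<Rightarrow> nat" where
  "outer_degree M = face_degree (root_face M)"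

definition outer_vertices :: "'h plane_map \<Rightarrow> 'h set set" where
  "outer_vertices M = vertex_of M ` root_face M"

definition outer_edges :: "'h plane_map \<Rightarrow> 'h set set" where
  "outer_edges M = edge_of M ` root_face M"

definition outer_halfedges :: "'h plane_map \<Rightarrow> 'h set" where
  "outer_halfedges M = \<Union> (outer_edges M)"

definition inner_vertices :: "'h plane_map \<Rightarrow> 'h set set" where
  "inner_vertices M = vertices M - outer_vertices M"

definition inner_edges :: "'h plane_map \<Rightarrow> 'h set set" where
  "inner_edges M = edges M - outer_edges M"

definition inner_halfedges :: "'h plane_map \<Rightarrow> 'h set" where
  "inner_halfedges M = halfedges M - outer_halfedges M"

definition inner_faces :: "'h plane_map \<Rightarrow> 'h set set" where
  "inner_faces M = faces M - {root_face M}"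

text \<open>
  A cycle is given with a starting point and a direction, as the list of half-edges by which its
  edges are left. Loops are cycles of length 1 and pairs of parallel edges cycles of length 2;
  distinctness of the edges excludes going back and forth along a single edge.
\<close>

definition simple_cycle :: "'h plane_map \<Rightarrow> 'h list \<Rightarrow> bool" where
  "simple_cycle M C \<longleftrightarrow>
     C \<noteq> [] \<and> set C \<subseteq> halfedges M \<and>
     (\<forall>i<length C. vertex_of M (opp M (C ! i)) = vertex_of M (C ! (Suc i mod length C))) \<and>
     distinct (map (vertex_of M) C) \<and>
     distinct (map (edge_of M) C)"

text \<open>The girth of a map without cycles is \<open>\<infinity>\<close>.\<close>

definition girth :: "'h plane_map \<Rightarrow> enat" where
  "girth M = (INF C\<in>{C. simple_cycle M C}. enat (length C))"

text \<open>The contour of the outer face, started at a half-edge \<open>h\<close> of \<open>root_face M\<close>.\<close>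

definition outer_contour :: "'h plane_map \<Rightarrow> 'h \<Rightarrow> 'h list" where
  "outer_contour M h = map (\<lambda>i. ((rot M \<circ> opp M) ^^ i) h) [0..<outer_degree M]"

text \<open>
  The exterior of a cycle is the component of its complement that contains the root-face. Two faces
  lie in the same component iff one gets from one to the other by crossing edges not on the cycle.
\<close>

definition face_step :: "'h plane_map \<Rightarrow> 'h list \<Rightarrow> ('h set \<times> 'h set) set" where
  "face_step M C =
     {(face_of M h, face_of M (opp M h)) |h. h \<in> halfedges M \<and> edge_of M h \<notin> edge_of M ` set C}"

definition interior_faces :: "'h plane_map \<Rightarrow> 'h list \<Rightarrow> 'h set set" where
  "interior_faces M C = {f \<in> faces M. (root_face M, f) \<notin> (face_step M C)\<^sup>*}"

text \<open>The face on the left of \<open>h\<close> is the face on the right of \<open>opp M h\<close>.\<close>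

definition interior_on_left :: "'h plane_map \<Rightarrow> 'h list \<Rightarrow> bool" where
  "interior_on_left M C \<longleftrightarrow> (\<forall>h\<in>set C. face_of M (opp M h) \<in> interior_faces M C)"


section \<open>Weighted biorientations\<close>

record 'h zbiorientation =
  ingoing :: "'h set"
  weight :: "'h \<Rightarrow> int"

definition outgoing :: "'h plane_map \<Rightarrow> 'h zbiorientation \<Rightarrow> 'h set" where
  "outgoing M B = halfedges M - ingoing B"

text \<open>
  The weight function is extensional (equal to \<open>undefined\<close> off the half-edges of the map), so that
  equality of records is equality of \<open>\<int>\<close>-biorientations.
\<close>

definition is_zbiorientation :: "'h plane_map \<Rightarrow> 'h zbiorientation \<Rightarrow> bool" where
  "is_zbiorientation M B \<longleftrightarrow>
     ingoing B \<subseteq> halfedges M \<and>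
     weight B \<in> extensional (halfedges M) \<and>
     (\<forall>h\<in>ingoing B. weight B h > 0) \<and>
     (\<forall>h\<in>outgoing M B. weight B h \<le> 0)"

definition is_way :: "'h zbiorientation \<Rightarrow> nat \<Rightarrow> 'h set \<Rightarrow> bool" where
  "is_way B i e \<longleftrightarrow> card (e \<inter> ingoing B) = i"

text \<open>
  \<open>traversable M B h\<close>: the edge of \<open>h\<close> can be traversed starting with its half \<open>h\<close>. Indexing by
  half-edges rather than by end vertices distinguishes the two directions of a loop.
\<close>

definition traversable :: "'h plane_map \<Rightarrow> 'h zbiorientation \<Rightarrow> 'h \<Rightarrow> bool" where
  "traversable M B h \<longleftrightarrow>
     is_way B 2 (edge_of M h) \<or> (is_way B 1 (edge_of M h) \<and> opp M h \<in> ingoing B)"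

definition accessible_from :: "'h plane_map \<Rightarrow> 'h zbiorientation \<Rightarrow> 'h set \<Rightarrow> bool" where
  "accessible_from M B v \<longleftrightarrow>
     (\<forall>u\<in>vertices M. (v, u) \<in>
        {(vertex_of M h, vertex_of M (opp M h)) |h. h \<in> halfedges M \<and> traversable M B h}\<^sup>*)"

definition ccw_circuit :: "'h plane_map \<Rightarrow> 'h zbiorientation \<Rightarrow> 'h list \<Rightarrow> bool" where
  "ccw_circuit M B C \<longleftrightarrow>
     simple_cycle M C \<and> interior_on_left M C \<and> (\<forall>h\<in>set C. traversable M B h)"

definition minimal :: "'h plane_map \<Rightarrow> 'h zbiorientation \<Rightarrow> bool" where
  "minimal M B \<longleftrightarrow> \<not> (\<exists>C. ccw_circuit M B C)"

definition edge_weight :: "'h zbiorientation \<Rightarrow> 'h set \<Rightarrow> int" where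
  "edge_weight B e = (\<Sum>h\<in>e. weight B h)"

definition vertex_weight :: "'h zbiorientation \<Rightarrow> 'h set \<Rightarrow> int" where
  "vertex_weight B v = (\<Sum>h\<in>v \<inter> ingoing B. weight B h)"

definition face_weight :: "'h plane_map \<Rightarrow> 'h zbiorientation \<Rightarrow> 'h set \<Rightarrow> int" where
  "face_weight M B f = (\<Sum>h\<in>f \<inter> outgoing M B. weight B h)"

text \<open>
  Every outer edge is required to be 1-way; a coherent direction along the contour is not part of
  the definition.
\<close>

definition admissible :: "'h plane_map \<Rightarrow> 'h zbiorientation \<Rightarrow> bool" where
  "admissible M B \<longleftrightarrow>
     (\<forall>h\<in>root_face M. simple_cycle M (outer_contour M h)) \<and>
     (\<forall>e\<in>outer_edges M. is_way B 1 e \<and>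
        (\<forall>h\<in>e \<inter> outgoing M B. weight B h = 0) \<and> (\<forall>h\<in>e \<inter> ingoing B. weight B h = 1)) \<and>
     (\<forall>h\<in>inner_halfedges M. vertex_of M h \<in> outer_vertices M \<longrightarrow> h \<in> outgoing M B)"

definition suitable :: "'h plane_map \<Rightarrow> 'h zbiorientation \<Rightarrow> bool" where
  "suitable M B \<longleftrightarrow>
     minimal M B \<and> admissible M B \<and> (\<forall>v\<in>outer_vertices M. accessible_from M B v)"

text \<open>The \<open>d/(d-2)\<close>-orientations; note that \<open>d - 2 = -1\<close> for \<open>d = 1\<close>.\<close>

definition d_orientation :: "nat \<Rightarrow> 'h plane_map \<Rightarrow> 'h zbiorientation \<Rightarrow> bool" where
  "d_orientation d M B \<longleftrightarrow>
     is_zbiorientation M B \<and> admissible M B \<and>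
     (\<forall>h\<in>outgoing M B. weight B h \<in> {0, -1, -2}) \<and>
     (\<forall>e\<in>inner_edges M. edge_weight B e = int d - 2) \<and>
     (\<forall>v\<in>inner_vertices M. vertex_weight B v = int d) \<and>
     (\<forall>f\<in>inner_faces M. int (face_degree f) + face_weight M B f = int d)"

end

theory Submission
  imports Defs
begin

text \<open>
  Splitting the weights into positive and negative parts turns the \<open>d/(d-2)\<close>-orientations into
  integer flows from the inner faces through the inner edges to the inner vertices, in which no
  half-edge has both parts nonzero. Two flows differ by the gradient of an integer potential on
  the corners of the map, because by Euler's formula every circulation is the gradient of a
  face potential. A flow is terminal if no push along a clockwise set of corners is possible.
  A terminal flow is unique, since the maximum set of the potential difference of two flows
  allows such a push, and it exists as soon as there is a flow, by maximizing the potential.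
  The suitable orientations are exactly the terminal flows: minimality and accessibility
  exclude a push, and conversely a half-edge with two nonzero parts would allow a push around a
  single corner.
  By max-flow min-cut, a flow exists if every region not containing the root face has a boundary
  of length at least \<open>d\<close> times its Euler characteristic, which holds in girth \<open>d\<close>, since the boundary
  contains a cycle. Conversely, adding up the weights inside a cycle shows that its
  length is at least \<open>d\<close>.
\<close>

section \<open>Orbits of permutations\<close>

text \<open>Planarity enters only through Euler's formula, so the Jordan curve theorem has to be
  earned: a dual spanning tree and a spanning tree of the map disjoint from it use up all edges,
  every circulation is therefore the gradient of a face potential, and the unit circulation along a
  cycle yields its two sides. The same pair of trees, built inside a region, bounds its Euler
  characteristic.

  That one of \<open>p h\<close>, \<open>n h\<close> vanishes is not a linear condition; it is left
  out of the flow problem and recovered from extremality. The bound 2 on outgoing weights is the gap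
  in \<open>d - 2\<close>: beyond it the opposite half-edge would exceed the total \<open>d\<close>
  of its vertex.

  The delicate direction is that a terminal flow is accessible. Unreachable vertices would contain a
  strongly connected set entered by no edge from outside. On its boundary towards the root face the
  negative parts average more than one per half-edge; where one is at least 2, the edge lies on a
  directed closed walk whose winding numbers exhibit a forbidden push.\<close>

lemma orbit_subset_closed:
  assumes "x \<in> S" "\<And>y. y \<in> S \<Longrightarrow> f y \<in> S"
  shows "orbit f x \<subseteq> S"
proof
  fix y assume "y \<in> orbit f x"
  then show "y \<in> S" by induction (use assms in auto)
qed

lemma mem_orbit_iff:
  assumes "permutation f"
  shows "y \<in> orbit f x \<longleftrightarrow> orbit f y = orbit f x"
proof
  assume "y \<in> orbit f x"
  with cyclic_on_orbit'[OF assms] show "orbit f y = orbit f x" by (rule orbit_cyclic_eq3)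
next
  assume "orbit f y = orbit f x"
  then show "y \<in> orbit f x" using permutation_self_in_orbit[OF assms, of y] by simp
qed

text \<open>On an orbit of a permutation of finite support every element is a forward iterate of
  every other, so walking backwards also covers the orbit.\<close>

lemma orbit_subset_backwards_closed:
  assumes "permutation f" "x \<in> S" "\<And>y. y \<in> orbit f x \<Longrightarrow> f y \<in> S \<Longrightarrow> y \<in> S"
  shows "orbit f x \<subseteq> S"
proof
  fix y assume y: "y \<in> orbit f x"
  have "x \<in> orbit f y"
    using assms(1) y mem_orbit_iff[of f] permutation_self_in_orbit by fastforce
  then obtain n where "(f ^^ n) y = x"
    by (auto simp: orbit_altdef)
  moreover have "(f ^^ n) y \<in> S \<Longrightarrow> y \<in> S" for n
  proof (induction n)
    case (Suc n)
    have "(f ^^ n) y \<in> orbit f x" using y by (rule funpow_in_orbit)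
    then show ?case using Suc assms(3) by simp
  qed simp
  ultimately show "y \<in> S" using assms(2) by blast
qed

lemma orbit_leaves:
  assumes "permutation f" "x \<in> W" "y \<in> orbit f x" "y \<notin> W"
  obtains k where "k \<in> orbit f x" "k \<in> W" "f k \<notin> W"
proof (rule ccontr)
  assume "\<not> thesis"
  with that have *: "\<And>k. k \<in> orbit f x \<Longrightarrow> k \<in> W \<Longrightarrow> f k \<in> W" by blast
  have "orbit f x \<subseteq> orbit f x \<inter> W"
    by (rule orbit_subset_closed)
      (use assms(1,2) * in \<open>auto simp: permutation_self_in_orbit intro: orbit.intros\<close>)
  then show False using assms(3,4) by blast
qed

lemma image_orbit:
  assumes "permutation f"
  shows "f ` orbit f x = orbit f x"
proof -
  have "f ` orbit f x \<subseteq> orbit f x" by (auto intro: orbit.intros)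
  moreover have "finite (orbit f x)"
    using assms by (simp add: finite_orbit permutation_self_in_orbit)
  moreover have "inj_on f (orbit f x)"
    using assms by (meson bij_is_inj inj_on_subset permutation_bijective subset_UNIV)
  ultimately show ?thesis by (simp add: card_image card_subset_eq)
qed

lemma sum_orbit_shift:
  assumes "permutation f"
  shows "(\<Sum>h\<in>orbit f x. g (f h)) = (\<Sum>h\<in>orbit f x. g h)"
proof -
  have "inj_on f (orbit f x)"
    using assms by (meson bij_is_inj inj_on_subset permutation_bijective subset_UNIV)
  then have "(\<Sum>h\<in>f ` orbit f x. g h) = (\<Sum>h\<in>orbit f x. g (f h))"
    by (simp add: sum.reindex)
  then show ?thesis using image_orbit[OF assms] by simp
qed

lemma sum_orbits:
  assumes "permutation f" "finite X" "f ` X \<subseteq> X"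
  shows "(\<Sum>h\<in>X. g h) = (\<Sum>v\<in>orbit f ` X. \<Sum>h\<in>v. g h)"
proof -
  have "(\<Sum>h\<in>X. g h) = (\<Sum>v\<in>orbit f ` X. \<Sum>h | h \<in> X \<and> orbit f h = v. g h)"
    by (rule sum.group[symmetric]) (use assms(2) in auto)
  also have "\<dots> = (\<Sum>v\<in>orbit f ` X. \<Sum>h\<in>v. g h)"
  proof (rule sum.cong[OF refl], rule sum.cong)
    fix v assume "v \<in> orbit f ` X"
    then obtain k where k: "k \<in> X" "v = orbit f k" by blast
    have "orbit f k \<subseteq> X" by (rule orbit_subset_closed) (use k assms(3) in auto)
    then show "{h \<in> X. orbit f h = v} = v" using k mem_orbit_iff[OF assms(1)] by auto
  qed simp
  finally show ?thesis .
qed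

lemma invariant_backwards:
  assumes "finite S" "inj f" "f ` S \<subseteq> S" "f y \<in> S"
  shows "y \<in> S"
proof -
  have "f ` S = S"
    using assms(1-3) by (meson card_image card_subset_eq inj_on_subset subset_UNIV)
  then obtain z where "z \<in> S" "f y = f z" using assms(4) by auto
  then show ?thesis using assms(2) by (metis injD)
qed

text \<open>A discrete integral along each orbit, started at a chosen representative; it is
  single-valued because the sum over a full turn vanishes.\<close>

lemma orbit_primitive:
  fixes b :: "'a \<Rightarrow> int"
  assumes "permutation f" "\<And>x. (\<Sum>h\<in>orbit f x. b h) = 0"
  obtains \<beta> where "\<And>x. \<beta> (f x) - \<beta> x = b x"
proof
  define rep where "rep x = (SOME y. y \<in> orbit f x)" for x
  have rep: "rep x \<in> orbit f x" for x
    unfolding rep_def by (rule someI_ex) (use orbit_nonempty[of f x] in blast)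
  have rep_f: "rep (f x) = rep x" for x
    unfolding rep_def using assms(1) by (simp add: permutation_orbit_step)
  define \<beta> where "\<beta> x = (\<Sum>i<funpow_dist f (rep x) x. b ((f ^^ i) (rep x)))" for x
  fix x
  define y where "y = rep x"
  have x: "x \<in> orbit f y"
    using rep[of x] mem_orbit_iff[OF assms(1)] unfolding y_def by simp
  define n where "n = funpow_dist f y x"
  have n: "(f ^^ n) y = x" unfolding n_def using x by (rule funpow_dist_prop)
  show "\<beta> (f x) - \<beta> x = b x"
  proof (cases "f x = y")
    case False
    have fx: "f x \<in> orbit f y" using x by (rule orbit.step)
    have "funpow_dist f y (f x) = Suc n"
      unfolding funpow_dist_def
    proof (rule Least_equality)
      show "(f ^^ Suc n) y = f x" using n by simp
      fix m assume m: "(f ^^ m) y = f x"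
      show "Suc n \<le> m"
      proof (cases m)
        case 0 with m False show ?thesis by simp
      next
        case (Suc k)
        then have "f ((f ^^ k) y) = f x" using m by simp
        then have "(f ^^ k) y = x"
          using assms(1) by (metis bij_is_inj injD permutation_bijective)
        then have "n \<le> k" unfolding n_def funpow_dist_def by (rule Least_le)
        then show ?thesis using Suc by simp
      qed
    qed
    then show ?thesis
      unfolding \<beta>_def rep_f y_def[symmetric] using n by (simp add: n_def)
  next
    \<comment> \<open>The step that closes the orbit: \<beta> restarts at 0, and the vanishing orbit
      sum says that \<open>\<beta> x + b x\<close> is 0 as well.\<close>
    case True
    have inj: "inj_on (\<lambda>i. (f ^^ i) y) {0..n}"
      unfolding n_def using x by (rule inj_on_funpow_dist)
    have "(f ^^ Suc n) y = y" using n True by simp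
    then have "orbit f y = (\<lambda>i. (f ^^ i) y) ` {0..n}"
      by (subst orbit_altdef_bounded[where n="Suc n"]) (auto simp: less_Suc_eq_le)
    then have "0 = (\<Sum>i\<in>{0..n}. b ((f ^^ i) y))"
      using assms(2)[of y] sum.reindex[OF inj, of b] by (simp add: o_def)
    also have "\<dots> = (\<Sum>i<n. b ((f ^^ i) y)) + b x"
      using n by (simp add: atLeast0AtMost lessThan_Suc_atMost[symmetric])
    finally have "\<beta> x = - b x" unfolding \<beta>_def y_def[symmetric] n_def[symmetric] by simp
    moreover have "\<beta> (f x) = 0"
      unfolding \<beta>_def rep_f y_def[symmetric] using True by (simp add: funpow_dist_0)
    ultimately show ?thesis by simp
  qed
qed

text \<open>A closed set of least cardinality is strongly connected: what is reached inside it from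
  any of its elements is again closed, hence everything.\<close>

lemma minimal_closed_set:
  assumes "finite Y0" "Y0 \<noteq> {}" "R `` Y0 \<subseteq> Y0"
  obtains Y where "Y \<subseteq> Y0" "Y \<noteq> {}" "R `` Y \<subseteq> Y"
    "\<And>x y. x \<in> Y \<Longrightarrow> y \<in> Y \<Longrightarrow> (x, y) \<in> (R \<inter> Y \<times> Y)\<^sup>*"
proof -
  let ?P = "\<lambda>Y. Y \<subseteq> Y0 \<and> Y \<noteq> {} \<and> R `` Y \<subseteq> Y"
  obtain Y where Y: "?P Y" and min: "\<And>Y'. ?P Y' \<Longrightarrow> card Y \<le> card Y'"
    using ex_has_least_nat[of ?P Y0 card] assms by blast
  have "(x, y) \<in> (R \<inter> Y \<times> Y)\<^sup>*" if "x \<in> Y" "y \<in> Y" for x y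
  proof -
    let ?Z = "(R \<inter> Y \<times> Y)\<^sup>* `` {x}"
    have "z \<in> Y" if "(x, z) \<in> (R \<inter> Y \<times> Y)\<^sup>*" for z
      using that \<open>x \<in> Y\<close> by induction auto
    then have sub: "?Z \<subseteq> Y" by blast
    moreover have "R `` ?Z \<subseteq> ?Z"
    proof
      fix z assume "z \<in> R `` ?Z"
      then obtain w where w: "(x, w) \<in> (R \<inter> Y \<times> Y)\<^sup>*" "(w, z) \<in> R" by blast
      then have "w \<in> Y" "z \<in> Y" using sub Y by blast+
      then show "z \<in> ?Z" using w by (auto intro: rtrancl_into_rtrancl)
    qed
    moreover have "finite Y" using Y assms(1) finite_subset by blast
    moreover have "?Z \<noteq> {}" by blast
    ultimately have "?Z = Y" using min[of ?Z] Y by (intro card_seteq) auto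
    then show ?thesis using \<open>y \<in> Y\<close> by blast
  qed
  then show ?thesis using that Y by blast
qed

section \<open>Spanning trees of abstract multigraphs\<close>

text \<open>Acyclicity in homological form. An edge is a pair of half-edges exchanged by
  \<open>\<alpha>\<close>, and \<open>c\<close> gives the node of a half-edge.\<close>

definition circulation_free :: "('h \<Rightarrow> 'h) \<Rightarrow> ('h \<Rightarrow> 'c) \<Rightarrow> 'c set \<Rightarrow> 'h set \<Rightarrow> bool" where
  "circulation_free \<alpha> c W T \<longleftrightarrow> (\<forall>\<tau> :: 'h \<Rightarrow> int. (\<forall>h\<in>T. \<tau> (\<alpha> h) = - \<tau> h) \<longrightarrow>
     (\<forall>x\<in>W. (\<Sum>h | h \<in> T \<and> c h = x. \<tau> h) = 0) \<longrightarrow> (\<forall>h\<in>T. \<tau> h = 0))"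

text \<open>The dual property of a forest: antisymmetric functions on its edges integrate to node
  potentials.\<close>

definition all_gradients :: "('h \<Rightarrow> 'h) \<Rightarrow> ('h \<Rightarrow> 'c) \<Rightarrow> 'h set \<Rightarrow> bool" where
  "all_gradients \<alpha> c T \<longleftrightarrow> (\<forall>\<tau> :: 'h \<Rightarrow> int. (\<forall>h\<in>T. \<tau> (\<alpha> h) = - \<tau> h) \<longrightarrow>
     (\<exists>\<gamma>. \<forall>h\<in>T. \<gamma> (c (\<alpha> h)) - \<gamma> (c h) = \<tau> h))"

lemma circulation_freeD:
  fixes \<tau> :: "'h \<Rightarrow> int"
  assumes "circulation_free \<alpha> c W T" "\<And>h. h \<in> T \<Longrightarrow> \<tau> (\<alpha> h) = - \<tau> h"
    "\<And>x. x \<in> W \<Longrightarrow> (\<Sum>h | h \<in> T \<and> c h = x. \<tau> h) = 0" "h \<in> T"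
  shows "\<tau> h = 0"
  using assms by (simp add: circulation_free_def)

lemma all_gradientsE:
  fixes \<tau> :: "'h \<Rightarrow> int"
  assumes "all_gradients \<alpha> c T" "\<And>h. h \<in> T \<Longrightarrow> \<tau> (\<alpha> h) = - \<tau> h"
  obtains \<gamma> where "\<And>h. h \<in> T \<Longrightarrow> \<gamma> (c (\<alpha> h)) - \<gamma> (c h) = \<tau> h"
proof -
  have "\<exists>\<gamma>. \<forall>h\<in>T. \<gamma> (c (\<alpha> h)) - \<gamma> (c h) = \<tau> h"
    using assms by (simp add: all_gradients_def)
  then show thesis using that by blast
qed

text \<open>Grown by attaching leaves. At a new leaf the divergence condition forces the only edge
  to carry 0, and a potential extends by choosing its value at the leaf. Connectedness is assumed in
  cut form, and the cardinality counts half-edges, two for each of the \<open>card W - 1\<close>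
  edges.\<close>

lemma spanning_tree:
  fixes c :: "'h \<Rightarrow> 'c" and \<alpha> :: "'h \<Rightarrow> 'h"
  assumes fin: "finite W" "W \<noteq> {}"
    and inv: "\<And>h. h \<in> A \<Longrightarrow> \<alpha> h \<in> A \<and> \<alpha> (\<alpha> h) = h \<and> \<alpha> h \<noteq> h"
    and conn: "\<And>X. X \<subset> W \<Longrightarrow> X \<noteq> {} \<Longrightarrow> \<exists>h\<in>A. c h \<in> X \<and> c (\<alpha> h) \<in> W - X"
  obtains T where "T \<subseteq> A" "finite T" "\<alpha> ` T \<subseteq> T" "c ` T \<subseteq> W" "card T + 2 = 2 * card W"
    "circulation_free \<alpha> c W T" "all_gradients \<alpha> c T"
proof -
  define good where "good R T \<longleftrightarrow> T \<subseteq> A \<and> finite T \<and> \<alpha> ` T \<subseteq> T \<and> c ` T \<subseteq> R \<and>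
    card T + 2 = 2 * card R \<and> circulation_free \<alpha> c R T \<and> all_gradients \<alpha> c T" for R T
  have "\<exists>R\<subseteq>W. card R = Suc k \<and> (\<exists>T. good R T)" if "Suc k \<le> card W" for k
    using that
  proof (induction k)
    case 0
    obtain w where "w \<in> W" using fin by blast
    moreover have "good {w} {}" by (simp add: good_def circulation_free_def all_gradients_def)
    ultimately show ?case by (intro exI[of _ "{w}"]) auto
  next
    case (Suc k)
    then obtain R T where R: "R \<subseteq> W" "card R = Suc k" and T: "good R T"
      by (meson Suc_leD)
    have "R \<subset> W" using R Suc.prems by auto
    moreover have "R \<noteq> {}" using R by auto
    ultimately obtain h where h: "h \<in> A" "c h \<in> R" "c (\<alpha> h) \<in> W - R" using conn by blast
    let ?T = "insert h (insert (\<alpha> h) T)" and ?R = "insert (c (\<alpha> h)) R"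
    have finR: "finite R" using R fin finite_subset by blast
    note T' = T[unfolded good_def]
    have ah: "\<alpha> h \<in> A" "\<alpha> (\<alpha> h) = h" "\<alpha> h \<noteq> h" using inv h(1) by auto
    have nT: "h \<notin> T" "\<alpha> h \<notin> T"
      using T' h(3) ah by (metis DiffD2 image_subset_iff)+
    have leaf: "{k \<in> ?T. c k = c (\<alpha> h)} = {\<alpha> h}"
      using T' h by auto
    have "circulation_free \<alpha> c ?R ?T"
      unfolding circulation_free_def
    proof (intro allI impI)
      fix \<tau> :: "'h \<Rightarrow> int"
      assume anti: "\<forall>h\<in>?T. \<tau> (\<alpha> h) = - \<tau> h"
        and div: "\<forall>x\<in>?R. (\<Sum>k | k \<in> ?T \<and> c k = x. \<tau> k) = 0"
      from div have "(\<Sum>k | k \<in> ?T \<and> c k = c (\<alpha> h). \<tau> k) = 0" by blast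
      then have 0: "\<tau> (\<alpha> h) = 0" using leaf by simp
      then have 1: "\<tau> h = 0" using anti by auto
      have "(\<Sum>k | k \<in> T \<and> c k = x. \<tau> k) = 0" if "x \<in> R" for x
      proof -
        have "(\<Sum>k | k \<in> T \<and> c k = x. \<tau> k) = (\<Sum>k | k \<in> ?T \<and> c k = x. \<tau> k)"
          by (rule sum.mono_neutral_left) (use T' 0 1 in auto)
        then show ?thesis using div that by auto
      qed
      moreover have "circulation_free \<alpha> c R T" using T' by simp
      ultimately have "\<forall>h\<in>T. \<tau> h = 0" unfolding circulation_free_def using anti by simp
      then show "\<forall>h\<in>?T. \<tau> h = 0" using 0 1 by auto
    qed
    moreover have "all_gradients \<alpha> c ?T"
      unfolding all_gradients_def
    proof (intro allI impI)
      fix \<tau> :: "'h \<Rightarrow> int"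
      assume anti: "\<forall>h\<in>?T. \<tau> (\<alpha> h) = - \<tau> h"
      then have "\<forall>h\<in>T. \<tau> (\<alpha> h) = - \<tau> h" by simp
      moreover have "all_gradients \<alpha> c T" using T' by simp
      ultimately have "\<exists>\<gamma>. \<forall>h\<in>T. \<gamma> (c (\<alpha> h)) - \<gamma> (c h) = \<tau> h"
        unfolding all_gradients_def by simp
      then obtain \<gamma> where \<gamma>: "\<forall>h\<in>T. \<gamma> (c (\<alpha> h)) - \<gamma> (c h) = \<tau> h" ..
      let ?g = "\<gamma>(c (\<alpha> h) := \<gamma> (c h) + \<tau> h)"
      have "c k \<noteq> c (\<alpha> h)" "c (\<alpha> k) \<noteq> c (\<alpha> h)" if "k \<in> T" for k
      proof -
        have "\<alpha> k \<in> T" using that T' by auto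
        then have "c k \<in> R" "c (\<alpha> k) \<in> R" using that T' by auto
        then show "c k \<noteq> c (\<alpha> h)" "c (\<alpha> k) \<noteq> c (\<alpha> h)" using h(3) by auto
      qed
      then have "\<forall>k\<in>T. ?g (c (\<alpha> k)) - ?g (c k) = \<tau> k" using \<gamma> by simp
      moreover have ne: "c (\<alpha> h) \<noteq> c h" using h by auto
      then have "?g (c (\<alpha> h)) - ?g (c h) = \<tau> h" by simp
      moreover have "\<tau> (\<alpha> h) = - \<tau> h" using anti by simp
      then have "?g (c (\<alpha> (\<alpha> h))) - ?g (c (\<alpha> h)) = \<tau> (\<alpha> h)" using ne by (simp add: ah(2))
      ultimately show "\<exists>\<gamma>. \<forall>h\<in>?T. \<gamma> (c (\<alpha> h)) - \<gamma> (c h) = \<tau> h" by blast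
    qed
    moreover have "card ?T + 2 = 2 * card ?R"
      using T' nT ah h(3) finR by auto
    ultimately have "good ?R ?T"
      unfolding good_def using T' h ah by auto
    then show ?case
      using R h finR by (intro exI[of _ ?R]) auto
  qed
  from this[of "card W - 1"] obtain R T where "R \<subseteq> W" "card R = card W" "good R T"
    using fin by (metis Suc_pred' card_gt_0_iff order_refl)
  then have "good W T" using fin card_subset_eq by blast
  then show thesis by (intro that[of T]) (simp_all add: good_def)
qed

section \<open>Plane maps\<close>

locale plane =
  fixes M :: "'h plane_map"
  assumes plane: "is_plane_map M"
begin

abbreviation H where "H \<equiv> halfedges M"
abbreviation \<sigma> where "\<sigma> \<equiv> rot M"
abbreviation \<alpha> where "\<alpha> \<equiv> opp M"
abbreviation V where "V \<equiv> vertex_of M"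
abbreviation E where "E \<equiv> edge_of M"
abbreviation F where "F \<equiv> face_of M"
abbreviation root where "root \<equiv> root_face M"

section \<open>Orbits of the rotation system and invariant sets of half-edges\<close>

definition \<phi> where "\<phi> h = \<sigma> (\<alpha> h)"

lemma finite_H [simp]: "finite H"
  using plane by (simp add: is_plane_map_def)

lemma finite_subset_H: "X \<subseteq> H \<Longrightarrow> finite X"
  using finite_H finite_subset by blast

lemma int_card_Diff:
  assumes "X \<subseteq> H" "Y \<subseteq> X"
  shows "int (card (X - Y)) = int (card X) - int (card Y)"
proof -
  have "finite X" "finite Y" using assms by (auto intro: finite_subset_H)
  then show ?thesis using card_Diff_subset[of Y X] card_mono[of X Y] assms(2) by simp
qed

lemma permutes: "\<sigma> permutes H" "\<alpha> permutes H" "\<phi> permutes H"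
proof -
  show 1: "\<sigma> permutes H" "\<alpha> permutes H" using plane by (auto simp: is_plane_map_def)
  show "\<phi> permutes H"
    using permutes_compose[OF 1(2) 1(1)] by (simp add: \<phi>_def[abs_def] comp_def)
qed

lemma permutation: "permutation \<sigma>" "permutation \<phi>"
  using permutes finite_H permutation_permutes by blast+

lemma inj_perm: "inj \<sigma>" "inj \<phi>" "inj \<alpha>"
  using permutes permutes_inj by blast+

lemma in_H_iff [simp]: "\<sigma> h \<in> H \<longleftrightarrow> h \<in> H" "\<alpha> h \<in> H \<longleftrightarrow> h \<in> H" "\<phi> h \<in> H \<longleftrightarrow> h \<in> H"
  using permutes by (simp_all add: permutes_in_image)

lemma \<alpha>_\<alpha> [simp]: "\<alpha> (\<alpha> h) = h"
proof (cases "h \<in> H")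
  case True then show ?thesis using plane by (simp add: is_plane_map_def)
next
  case False then show ?thesis using permutes(2) by (simp add: permutes_not_in)
qed

lemma \<alpha>_neq: "h \<in> H \<Longrightarrow> \<alpha> h \<noteq> h"
  using plane by (simp add: is_plane_map_def)

lemma \<alpha>_eq_iff [simp]: "\<alpha> h = \<alpha> k \<longleftrightarrow> h = k"
  by (metis \<alpha>_\<alpha>)

lemma \<phi>_\<alpha> [simp]: "\<phi> (\<alpha> h) = \<sigma> h"
  by (simp add: \<phi>_def)

lemma F_orbit: "F h = orbit \<phi> h"
  by (simp add: face_of_def \<phi>_def[abs_def] comp_def)

lemma V_\<sigma> [simp]: "V (\<sigma> h) = V h"
  using permutation by (simp add: vertex_of_def permutation_orbit_step)

lemma F_\<phi> [simp]: "F (\<phi> h) = F h"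
  using permutation by (simp add: F_orbit permutation_orbit_step)

lemma V_\<phi>: "V (\<phi> h) = V (\<alpha> h)"
  by (simp add: \<phi>_def)

lemma mem_V_iff: "k \<in> V h \<longleftrightarrow> V k = V h"
  unfolding vertex_of_def by (rule mem_orbit_iff) (rule permutation)

lemma mem_F_iff: "k \<in> F h \<longleftrightarrow> F k = F h"
  unfolding F_orbit by (rule mem_orbit_iff) (rule permutation)

lemma self_mem [simp]: "h \<in> V h" "h \<in> F h"
  by (simp_all add: mem_V_iff mem_F_iff)

lemma orbit_sub_H: "h \<in> H \<Longrightarrow> V h \<subseteq> H" "h \<in> H \<Longrightarrow> F h \<subseteq> H"
  using permutes_orbit_subset[OF permutes(1)] permutes_orbit_subset[OF permutes(3)]
  by (simp_all add: F_orbit vertex_of_def)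

lemma V_subset: "\<sigma> ` S \<subseteq> S \<Longrightarrow> h \<in> S \<Longrightarrow> V h \<subseteq> S"
  unfolding vertex_of_def by (rule orbit_subset_closed) auto

lemma F_subset: "\<phi> ` S \<subseteq> S \<Longrightarrow> h \<in> S \<Longrightarrow> F h \<subseteq> S"
  unfolding F_orbit by (rule orbit_subset_closed) auto

lemma invariant_iff:
  assumes "S \<subseteq> H"
  shows "\<sigma> ` S \<subseteq> S \<Longrightarrow> \<sigma> h \<in> S \<longleftrightarrow> h \<in> S" "\<phi> ` S \<subseteq> S \<Longrightarrow> \<phi> h \<in> S \<longleftrightarrow> h \<in> S"
    "\<alpha> ` S \<subseteq> S \<Longrightarrow> \<alpha> h \<in> S \<longleftrightarrow> h \<in> S"
proof -
  have fin: "finite S" using assms by (rule finite_subset_H)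
  show "\<sigma> ` S \<subseteq> S \<Longrightarrow> \<sigma> h \<in> S \<longleftrightarrow> h \<in> S"
    using invariant_backwards[OF fin inj_perm(1)] by blast
  show "\<phi> ` S \<subseteq> S \<Longrightarrow> \<phi> h \<in> S \<longleftrightarrow> h \<in> S"
    using invariant_backwards[OF fin inj_perm(2)] by blast
  show "\<alpha> ` S \<subseteq> S \<Longrightarrow> \<alpha> h \<in> S \<longleftrightarrow> h \<in> S"
    using invariant_backwards[OF fin inj_perm(3)] by blast
qed

lemma const_on_face:
  assumes "\<And>h. \<gamma> (\<phi> h) = \<gamma> h" "F h = F k"
  shows "\<gamma> h = \<gamma> k"
proof -
  have "F h \<subseteq> {x. \<gamma> x = \<gamma> h}" by (rule F_subset) (use assms in auto)
  moreover have "k \<in> F h" using assms by (simp add: mem_F_iff)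
  ultimately show ?thesis by auto
qed

lemma connected:
  assumes "S \<subseteq> H" "S \<noteq> {}" "\<sigma> ` S \<subseteq> S" "\<alpha> ` S \<subseteq> S"
  shows "S = H"
proof -
  obtain h where h: "h \<in> S" using assms by blast
  have "k \<in> S" if "k \<in> H" for k
  proof -
    have "(h, k) \<in> {(x, y). y = \<sigma> x \<or> y = \<alpha> x}\<^sup>*"
      using plane h that assms(1) unfolding is_plane_map_def map_connected_def by blast
    then show ?thesis by induction (use h assms in auto)
  qed
  then show ?thesis using assms(1) by blast
qed

lemma connected_faces:
  assumes "S \<subseteq> H" "S \<noteq> {}" "\<phi> ` S \<subseteq> S" "\<alpha> ` S \<subseteq> S"
  shows "S = H"
proof (rule connected[OF assms(1,2) _ assms(4)])
  have "\<sigma> h \<in> S" if "h \<in> S" for h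
    using that assms(3,4) by (metis \<phi>_\<alpha> image_subset_iff)
  then show "\<sigma> ` S \<subseteq> S" by blast
qed

lemma connected_steps:
  assumes "S \<subseteq> H" "S \<noteq> {}" "\<sigma> ` S \<subseteq> S" "\<phi> ` S \<subseteq> S"
  shows "S = H"
proof (rule connected[OF assms(1-3)])
  have "\<alpha> h \<in> S" if "h \<in> S" for h
    using that assms(4) invariant_iff(1)[OF assms(1,3), of "\<alpha> h"] by (auto simp: \<phi>_def)
  then show "\<alpha> ` S \<subseteq> S" by blast
qed

section \<open>Sums over vertices, faces and edges\<close>

lemma sum_V_shift: "(\<Sum>k\<in>V h. g (\<sigma> k)) = (\<Sum>k\<in>V h. g k)"
  unfolding vertex_of_def by (rule sum_orbit_shift) (rule permutation)

lemma sum_F_shift: "(\<Sum>k\<in>F h. g (\<phi> k)) = (\<Sum>k\<in>F h. g k)"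
  unfolding F_orbit by (rule sum_orbit_shift) (rule permutation)

lemma face_gradient_div:
  fixes \<gamma> :: "'h \<Rightarrow> int"
  assumes "\<And>h. \<gamma> (\<phi> h) = \<gamma> h"
  shows "(\<Sum>k\<in>V h. \<gamma> (\<alpha> k) - \<gamma> k) = 0"
proof -
  have "\<gamma> (\<alpha> k) = \<gamma> (\<sigma> k)" for k using assms[of "\<alpha> k"] by simp
  then show ?thesis by (simp add: sum_subtractf sum_V_shift)
qed

lemma vertex_gradient_div:
  fixes x :: "'h \<Rightarrow> int"
  assumes "\<And>h. h \<in> H \<Longrightarrow> x (\<sigma> h) = x h" "h \<in> H"
  shows "(\<Sum>k\<in>F h. x (\<alpha> k) - x k) = 0"
proof -
  have "(\<Sum>k\<in>F h. x (\<alpha> k)) = (\<Sum>k\<in>F h. x (\<phi> k))"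
  proof (rule sum.cong[OF refl])
    fix k assume "k \<in> F h"
    then have "\<alpha> k \<in> H" using orbit_sub_H(2)[OF assms(2)] by auto
    then show "x (\<alpha> k) = x (\<phi> k)" using assms(1)[of "\<alpha> k"] by (simp add: \<phi>_def)
  qed
  then show ?thesis by (simp add: sum_subtractf sum_F_shift)
qed

lemma sum_vertices:
  assumes "X \<subseteq> H" "\<sigma> ` X \<subseteq> X"
  shows "(\<Sum>h\<in>X. g h) = (\<Sum>v\<in>V ` X. \<Sum>h\<in>v. g h)"
  using sum_orbits[OF permutation(1) finite_subset_H[OF assms(1)] assms(2), of g]
  by (simp add: vertex_of_def[abs_def])

lemma sum_faces:
  assumes "X \<subseteq> H" "\<phi> ` X \<subseteq> X"
  shows "(\<Sum>h\<in>X. g h) = (\<Sum>f\<in>F ` X. \<Sum>h\<in>f. g h)"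
  using sum_orbits[OF permutation(2) finite_subset_H[OF assms(1)] assms(2), of g]
  by (simp add: F_orbit[abs_def])

lemma sum_\<alpha>:
  assumes "X \<subseteq> H" "\<alpha> ` X \<subseteq> X"
  shows "(\<Sum>h\<in>X. g (\<alpha> h)) = (\<Sum>h\<in>X. g h)"
proof (rule sum.reindex_bij_witness[of _ \<alpha> \<alpha>])
qed (use assms in auto)

lemma E_eq_iff: "E h = E k \<longleftrightarrow> h = k \<or> h = \<alpha> k"
  by (auto simp: edge_of_def doubleton_eq_iff)

lemma E_mem_image_iff: "E h \<in> E ` X \<longleftrightarrow> h \<in> X \<or> \<alpha> h \<in> X"
  by (auto simp: E_eq_iff image_iff) (metis \<alpha>_\<alpha>)

lemma card_edges:
  assumes "X \<subseteq> H" "\<alpha> ` X \<subseteq> X"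
  shows "card X = 2 * card (E ` X)"
proof -
  have fin: "finite X" using assms(1) by (rule finite_subset_H)
  have "card X = (\<Sum>e\<in>E ` X. \<Sum>h | h \<in> X \<and> E h = e. 1)"
    using sum.group[of X "E ` X" E "\<lambda>_. 1::nat"] fin by simp
  also have "\<dots> = (\<Sum>e\<in>E ` X. 2)"
  proof (rule sum.cong[OF refl])
    fix e assume "e \<in> E ` X"
    then obtain k where k: "k \<in> X" "e = E k" by blast
    then have "{h \<in> X. E h = e} = {k, \<alpha> k}" using assms(2) by (auto simp: E_eq_iff)
    moreover have "k \<noteq> \<alpha> k" using \<alpha>_neq k assms by (metis subsetD)
    ultimately show "(\<Sum>h | h \<in> X \<and> E h = e. 1) = (2::nat)" by simp
  qed
  finally show ?thesis by simp
qed

lemma euler: "2 * card (V ` H) + 2 * card (F ` H) = card H + 4"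
proof -
  have "card H = 2 * card (E ` H)" by (rule card_edges) auto
  moreover have "card (V ` H) + card (F ` H) = card (E ` H) + 2"
    using plane by (simp add: is_plane_map_def vertices_def faces_def edges_def)
  ultimately show ?thesis by simp
qed

lemma root_face_obtain: obtains h where "h \<in> H" "root = F h"
  using plane by (auto simp: is_plane_map_def faces_def)

lemma root_sub_H: "root \<subseteq> H"
  using root_face_obtain orbit_sub_H by metis

lemma root_nonempty: "root \<noteq> {}"
  by (metis root_face_obtain self_mem(2) empty_iff)

lemma root_\<phi>: "\<phi> ` root \<subseteq> root"
  by (metis root_face_obtain F_\<phi> mem_F_iff image_subsetI)

lemma root_F: "h \<in> root \<Longrightarrow> F h = root"
  by (metis root_face_obtain mem_F_iff)

lemma mem_root_iff: "h \<in> root \<longleftrightarrow> F h = root"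
  using root_F by (metis self_mem(2))

section \<open>Circulations and face potentials\<close>

text \<open>A vertex potential that is constant along the edges outside a dual tree has as gradient a
  circulation of the dual tree, hence is constant.\<close>

lemma cotree_connected:
  fixes x :: "'h \<Rightarrow> int"
  assumes T: "T \<subseteq> H" "\<alpha> ` T \<subseteq> T" "F ` T \<subseteq> W"  "W \<subseteq> F ` H"
    and tree: "circulation_free \<alpha> F W T"
    and x: "\<And>h. h \<in> H \<Longrightarrow> x (\<sigma> h) = x h" "\<And>h. h \<in> H - T \<Longrightarrow> x (\<alpha> h) = x h"
    and hk: "h \<in> H" "k \<in> H"
  shows "x h = x k"
proof -
  have div: "(\<Sum>h | h \<in> T \<and> F h = f. x (\<alpha> h) - x h) = 0" if "f \<in> W" for f
  proof -
    obtain k where k: "k \<in> H" "f = F k" using T \<open>f \<in> W\<close> by blast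
    have "(\<Sum>h | h \<in> T \<and> F h = f. x (\<alpha> h) - x h) = (\<Sum>h\<in>F k. x (\<alpha> h) - x h)"
    proof (rule sum.mono_neutral_left)
      show "finite (F k)" using orbit_sub_H(2)[OF k(1)] by (rule finite_subset_H)
    qed (use k x(2) orbit_sub_H(2)[OF k(1)] in \<open>auto simp: mem_F_iff\<close>)
    also have "\<dots> = 0" using x(1) k(1) by (rule vertex_gradient_div)
    finally show ?thesis .
  qed
  have zero: "x (\<alpha> h) - x h = 0" if "h \<in> T" for h
    by (rule circulation_freeD[OF tree _ _ that]) (use div in simp_all)
  have "{l \<in> H. x l = x h} = H"
  proof (rule connected)
    have "x (\<alpha> l) = x l" if "l \<in> H" for l using zero x(2) that by (cases "l \<in> T") auto
    then show "\<alpha> ` {l \<in> H. x l = x h} \<subseteq> {l \<in> H. x l = x h}" by auto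
  qed (use x(1) hk in auto)
  then have "k \<in> {l \<in> H. x l = x h}" using hk by simp
  then show ?thesis by simp
qed

lemma faces_connected:
  assumes "X \<subset> F ` H" "X \<noteq> {}"
  shows "\<exists>h\<in>H. F h \<in> X \<and> F (\<alpha> h) \<in> F ` H - X"
proof (rule ccontr)
  assume neg: "\<not> ?thesis"
  have "{h \<in> H. F h \<in> X} = H"
  proof (rule connected_faces)
    show "{h \<in> H. F h \<in> X} \<noteq> {}" using assms by blast
    show "\<alpha> ` {h \<in> H. F h \<in> X} \<subseteq> {h \<in> H. F h \<in> X}" using neg by auto
  qed auto
  then show False using assms by blast
qed

text \<open>The sphere has no first homology. Subtracting the gradient that agrees with
  \<open>\<tau>\<close> on a dual spanning tree \<open>T\<close> leaves a circulation on the
  complement of \<open>T\<close>; this complement is itself a spanning tree of the map, so the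
  remainder is 0.\<close>

lemma circulation_potential:
  fixes \<tau> :: "'h \<Rightarrow> int"
  assumes anti: "\<And>h. h \<in> H \<Longrightarrow> \<tau> (\<alpha> h) = - \<tau> h"
    and div: "\<And>h. h \<in> H \<Longrightarrow> (\<Sum>k\<in>V h. \<tau> k) = 0"
  obtains \<gamma> where "\<And>h. \<gamma> (\<phi> h) = \<gamma> h" "\<And>h. h \<in> H \<Longrightarrow> \<gamma> (\<alpha> h) - \<gamma> h = \<tau> h"
proof -
  obtain h0 where h0: "h0 \<in> H" using root_face_obtain .
  obtain T where T: "T \<subseteq> H" "finite T" "\<alpha> ` T \<subseteq> T" "F ` T \<subseteq> F ` H" "card T + 2 = 2 * card (F ` H)"
    and tree: "circulation_free \<alpha> F (F ` H) T" and grad: "all_gradients \<alpha> F T"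
  proof (rule spanning_tree[of "F ` H" H \<alpha> F])
    show "F ` H \<noteq> {}" using h0 by blast
    show "\<exists>h\<in>H. F h \<in> X \<and> F (\<alpha> h) \<in> F ` H - X" if "X \<subset> F ` H" "X \<noteq> {}" for X
      using that by (rule faces_connected)
  qed (simp_all add: \<alpha>_neq)
  obtain \<gamma> where \<gamma>: "\<And>h. h \<in> T \<Longrightarrow> \<gamma> (F (\<alpha> h)) - \<gamma> (F h) = \<tau> h"
    using all_gradientsE[OF grad, of \<tau>] anti T(1) by blast
  define \<rho> where "\<rho> h = \<tau> h - (\<gamma> (F (\<alpha> h)) - \<gamma> (F h))" for h
  \<comment> \<open>The complement of the dual tree connects the map: if no edge outside
    \<open>T\<close> crossed the cut \<open>X\<close>, the indicator of \<open>X\<close> would be a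
    vertex potential as in \<open>cotree_connected\<close>, hence constant.\<close>
  have conn: "\<exists>h\<in>H - T. V h \<in> X \<and> V (\<alpha> h) \<in> V ` H - X" if X: "X \<subset> V ` H" "X \<noteq> {}" for X
  proof (rule ccontr)
    assume neg: "\<not> ?thesis"
    obtain h k where hk: "h \<in> H" "k \<in> H" "V h \<in> X" "V k \<notin> X" using X by blast
    have aT: "\<alpha> h \<in> T \<longleftrightarrow> h \<in> T" for h using invariant_iff(3)[OF T(1,3)] .
    define x where "x l = (of_bool (V l \<in> X) :: int)" for l
    have cross: "V (\<alpha> l) \<in> X" if "l \<in> H - T" "V l \<in> X" for l
      using neg that imageI[of "\<alpha> l" H V] by auto
    have x\<alpha>: "x (\<alpha> l) = x l" if "l \<in> H - T" for l
      using cross[of l] cross[of "\<alpha> l"] that aT[of l] by (auto simp: x_def)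
    have x\<sigma>: "x (\<sigma> l) = x l" for l by (simp add: x_def)
    have "x h = x k"
      using cotree_connected[OF T(1,3,4) order_refl tree x\<sigma> x\<alpha> hk(1,2)] by simp
    then show False using hk by (simp add: x_def)
  qed
  obtain T' where T': "T' \<subseteq> H - T" "card T' + 2 = 2 * card (V ` H)"
    and tree': "circulation_free \<alpha> V (V ` H) T'"
  proof (rule spanning_tree[of "V ` H" "H - T" \<alpha> V])
    show "V ` H \<noteq> {}" using h0 by blast
    show "\<alpha> h \<in> H - T \<and> \<alpha> (\<alpha> h) = h \<and> \<alpha> h \<noteq> h" if "h \<in> H - T" for h
      using that \<alpha>_neq invariant_iff(3)[OF T(1,3)] by simp
    show "\<exists>h\<in>H - T. V h \<in> X \<and> V (\<alpha> h) \<in> V ` H - X" if "X \<subset> V ` H" "X \<noteq> {}" for X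
      using that by (rule conn)
  qed simp_all
  \<comment> \<open>Euler's formula: a tree and a dual tree together have as many half-edges as the
    map, so \<open>T'\<close> fills the whole complement of \<open>T\<close>.\<close>
  have "card T' + card T = card H" using T(5) T'(2) euler by simp
  then have "card T' = card (H - T)"
    using T(1,2) by (simp add: card_Diff_subset)
  then have T'_eq: "T' = H - T" using T'(1) by (simp add: card_subset_eq)
  have div': "(\<Sum>h | h \<in> T' \<and> V h = v. \<rho> h) = 0" if "v \<in> V ` H" for v
  proof -
    obtain k where k: "k \<in> H" "v = V k" using \<open>v \<in> V ` H\<close> by blast
    have "(\<Sum>h | h \<in> T' \<and> V h = v. \<rho> h) = (\<Sum>h\<in>V k. \<rho> h)"
    proof (rule sum.mono_neutral_left)
      show "finite (V k)" using orbit_sub_H(1)[OF k(1)] by (rule finite_subset_H)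
      show "\<forall>i\<in>V k - {h \<in> T'. V h = v}. \<rho> i = 0"
        using \<gamma> T'_eq k(2) orbit_sub_H(1)[OF k(1)] by (auto simp: \<rho>_def mem_V_iff)
      show "{h \<in> T'. V h = v} \<subseteq> V k" unfolding k(2) by (simp add: mem_V_iff subset_iff)
    qed
    also have "\<dots> = (\<Sum>h\<in>V k. \<tau> h) - (\<Sum>h\<in>V k. \<gamma> (F (\<alpha> h)) - \<gamma> (F h))"
      unfolding \<rho>_def by (rule sum_subtractf)
    also have "\<dots> = 0" using div[OF k(1)] face_gradient_div[of "\<lambda>h. \<gamma> (F h)"] by simp
    finally show ?thesis .
  qed
  have "\<rho> (\<alpha> h) = - \<rho> h" if "h \<in> T'" for h using that anti T'_eq by (simp add: \<rho>_def)
  then have "\<rho> h = 0" if "h \<in> T'" for h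
    using circulation_freeD[OF tree' _ div' that] by blast
  then have "\<gamma> (F (\<alpha> h)) - \<gamma> (F h) = \<tau> h" if "h \<in> H" for h
    using that \<gamma> T'_eq by (cases "h \<in> T") (auto simp: \<rho>_def)
  then show thesis using that[of "\<lambda>h. \<gamma> (F h)"] by simp
qed

text \<open>The half-edges \<open>W\<close>, \<open>A\<close> and \<open>B\<close> make up the faces, edges and vertices of an open connected region,
  whose Euler characteristic is thus at most 1: a dual spanning tree of the region and a spanning
  tree of the map in which everything outside \<open>B\<close> is contracted to one vertex are disjoint.\<close>

lemma region_euler:
  assumes W: "W \<subseteq> H" "W \<noteq> {}" "\<phi> ` W \<subseteq> W"
    and A: "A \<subseteq> W" "\<alpha> ` A \<subseteq> A"
    and B: "B \<subseteq> A" "\<sigma> ` B \<subseteq> B" "B \<noteq> H"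
    and conn: "\<And>X. X \<subset> W \<Longrightarrow> X \<noteq> {} \<Longrightarrow> \<phi> ` X \<subseteq> X \<Longrightarrow> \<exists>h\<in>A. h \<in> X \<and> \<alpha> h \<notin> X"
  shows "2 * card (V ` B) + 2 * card (F ` W) \<le> card A + 2"
proof -
  have finW: "finite W" using W(1) by (rule finite_subset_H)
  have AH: "A \<subseteq> H" and BH: "B \<subseteq> H" using W A B by auto
  have FW: "F h \<in> F ` W \<longleftrightarrow> h \<in> W" for h
    using F_subset[OF W(3)] by (metis imageE image_eqI mem_F_iff subsetD)
  have VB: "V h \<in> V ` B \<longleftrightarrow> h \<in> B" for h
    using V_subset[OF B(2)] by (metis imageE image_eqI mem_V_iff subsetD)
  have aA: "\<alpha> h \<in> A \<longleftrightarrow> h \<in> A" for h using invariant_iff(3)[OF AH A(2)] .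
  have dual_conn: "\<exists>h\<in>A. F h \<in> X \<and> F (\<alpha> h) \<in> F ` W - X" if X: "X \<subset> F ` W" "X \<noteq> {}" for X
  proof -
    let ?X = "{h \<in> W. F h \<in> X}"
    have "?X \<subset> W" "?X \<noteq> {}" using X by blast+
    moreover have "\<phi> ` ?X \<subseteq> ?X" using W(3) by auto
    ultimately obtain h where "h \<in> A" "h \<in> ?X" "\<alpha> h \<notin> ?X" using conn by blast
    moreover from this have "\<alpha> h \<in> W" using A by blast
    ultimately show ?thesis by auto
  qed
  obtain T where T: "T \<subseteq> A" "finite T" "\<alpha> ` T \<subseteq> T" "F ` T \<subseteq> F ` W" "card T + 2 = 2 * card (F ` W)"
    and tree: "circulation_free \<alpha> F (F ` W) T"
  proof (rule spanning_tree[of "F ` W" A \<alpha> F])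
    show "\<alpha> h \<in> A \<and> \<alpha> (\<alpha> h) = h \<and> \<alpha> h \<noteq> h" if "h \<in> A" for h
      using that A(2) AH \<alpha>_neq by auto
    show "\<exists>h\<in>A. F h \<in> X \<and> F (\<alpha> h) \<in> F ` W - X" if "X \<subset> F ` W" "X \<noteq> {}" for X
      using that by (rule dual_conn)
  qed (use finW W(2) in simp_all)
  \<comment> \<open>\<open>None\<close> is the contracted vertex. Edges outside \<open>A\<close>
    have both ends there, because \<open>B \<subseteq> A\<close> and \<open>A\<close> contains both
    halves of its edges.\<close>
  define c where "c h = (if h \<in> B then Some (V h) else None)" for h
  have c\<sigma>: "c (\<sigma> h) = c h" for h
    using invariant_iff(1)[OF BH B(2)] by (simp add: c_def)
  let ?C = "insert None (Some ` V ` B)"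
  have cH: "c ` H = ?C" using B(3) BH by (auto simp: c_def)
  have TH: "T \<subseteq> H" using T AH by blast
  have aT: "\<alpha> h \<in> T \<longleftrightarrow> h \<in> T" for h using invariant_iff(3)[OF TH T(3)] .
  have primal_conn: "\<exists>h\<in>A - T. c h \<in> X \<and> c (\<alpha> h) \<in> ?C - X" if X: "X \<subset> ?C" "X \<noteq> {}" for X
  proof (rule ccontr)
    assume neg: "\<not> ?thesis"
    have "X \<subseteq> c ` H" "\<exists>z\<in>c ` H. z \<notin> X" using X cH by auto
    then obtain h k where hk: "h \<in> H" "k \<in> H" "c h \<in> X" "c k \<notin> X" using X(2) by blast
    define x where "x l = (of_bool (c l \<in> X) :: int)" for l
    have cross: "c (\<alpha> l) \<in> X" if "l \<in> A - T" "c l \<in> X" "c (\<alpha> l) \<in> ?C" for l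
      using neg that by blast
    have "x (\<alpha> l) = x l" if l: "l \<in> H - T" for l
    proof (cases "l \<in> A")
      case True
      have C: "c m \<in> ?C" if "m \<in> H" for m unfolding cH[symmetric] using that by (rule imageI)
      have "c l \<in> ?C" "c (\<alpha> l) \<in> ?C" using C l by simp_all
      then have "c l \<in> X \<longleftrightarrow> c (\<alpha> l) \<in> X"
        using cross[of l] cross[of "\<alpha> l"] True l aT[of l] aA[of l] by auto
      then show ?thesis by (simp add: x_def)
    next
      case False
      then have "l \<notin> B" "\<alpha> l \<notin> B" using aA[of l] B(1) by blast+
      then show ?thesis by (simp add: c_def x_def)
    qed
    note x\<alpha> = this
    have x\<sigma>: "x (\<sigma> l) = x l" for l by (simp add: x_def c\<sigma>)
    have "F ` W \<subseteq> F ` H" using W(1) by blast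
    then have "x h = x k"
      using cotree_connected[OF TH T(3,4) _ tree x\<sigma> x\<alpha> hk(1,2)] by simp
    then show False using hk by (simp add: x_def)
  qed
  obtain T' where T': "T' \<subseteq> A - T" "card T' + 2 = 2 * card ?C"
  proof (rule spanning_tree[of ?C "A - T" \<alpha> c])
    show "\<alpha> h \<in> A - T \<and> \<alpha> (\<alpha> h) = h \<and> \<alpha> h \<noteq> h" if "h \<in> A - T" for h
      using that AH \<alpha>_neq[of h] aA aT by auto
    show "finite ?C" using finite_subset_H[OF BH] by simp
    show "\<exists>h\<in>A - T. c h \<in> X \<and> c (\<alpha> h) \<in> ?C - X" if "X \<subset> ?C" "X \<noteq> {}" for X
      using that by (rule primal_conn)
  qed simp_all
  have finA: "finite A" using AH by (rule finite_subset_H)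
  have "card ?C = card (V ` B) + 1"
    using finite_subset_H[OF BH] by (subst card_insert_disjoint) (auto simp: card_image)
  \<comment> \<open>Two disjoint trees inside \<open>A\<close>. The extra node \<open>None\<close>
    makes up for the edge that the second tree is short of, so the constant 2 comes from the dual
    tree alone.\<close>
  moreover have "card T' + card T \<le> card A"
    using card_mono[of "A - T" T'] card_mono[OF finA T(1)] T T'(1) finA
    by (simp add: card_Diff_subset)
  ultimately show ?thesis using T(5) T'(2) by simp
qed

section \<open>Simple cycles\<close>

text \<open>Following a successor that depends only on the end vertex must close up. On a minimal
  successor-closed set the successor is a bijection; if two of its half-edges leave the same vertex,
  their predecessors enter that vertex and so have equal successors. Hence no vertex is
  repeated.\<close>

lemma simple_cycle_exists:
  assumes A: "A \<subseteq> H" "A \<noteq> {}" "\<And>h. h \<in> A \<Longrightarrow> \<alpha> h \<notin> A"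
    and succ: "\<And>h. h \<in> A \<Longrightarrow> \<exists>k\<in>A. V k = V (\<alpha> h)"
  obtains C where "simple_cycle M C" "set C \<subseteq> A"
proof -
  define a where "a v = (SOME k. k \<in> A \<and> V k = v)" for v
  define s where "s h = a (V (\<alpha> h))" for h
  have a: "s h \<in> A" "V (s h) = V (\<alpha> h)" if "h \<in> A" for h
    using someI_ex[of "\<lambda>k. k \<in> A \<and> V k = V (\<alpha> h)"] succ[OF that] unfolding s_def a_def by blast+
  let ?R = "{(h, s h) |h. h \<in> A}"
  have finA: "finite A" using A(1) by (rule finite_subset_H)
  obtain K where K: "K \<subseteq> A" "K \<noteq> {}" "?R `` K \<subseteq> K"
    and K': "\<And>x y. x \<in> K \<Longrightarrow> y \<in> K \<Longrightarrow> (x, y) \<in> (?R \<inter> K \<times> K)\<^sup>*"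
    by (rule minimal_closed_set[of A ?R]) (use finA A a in blast)+
  have sK: "s h \<in> K" if "h \<in> K" for h using that K by blast
  have inK: "h \<in> s ` K" if "h \<in> K" for h
  proof -
    have "(s h, h) \<in> (?R \<inter> K \<times> K)\<^sup>*" using K' that sK by blast
    then show ?thesis
    proof (cases rule: rtranclE)
      case base
      then show ?thesis using that by (metis imageI)
    next
      case (step y)
      then show ?thesis by auto
    qed
  qed
  have finK: "finite K" using K(1) finA finite_subset by blast
  have sKK: "s ` K = K" using sK inK by blast
  have injV: "inj_on V K"
  proof (rule inj_onI)
    fix x y assume xy: "x \<in> K" "y \<in> K" "V x = V y"
    obtain x' y' where x': "x' \<in> K" "x = s x'" and y': "y' \<in> K" "y = s y'"
      using inK xy by blast
    have "V x = V (\<alpha> x')" "V y = V (\<alpha> y')" using a x' y' K by blast+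
    then show "x = y" using x'(2) y'(2) xy(3) by (simp add: s_def)
  qed
  \<comment> \<open>Extension by the identity makes the successor a permutation, whose orbit and
    period give the list.\<close>
  define p where "p h = (if h \<in> K then s h else h)" for h
  have "bij_betw p K K"
    using eq_card_imp_inj_on[OF finK, of s] sKK by (auto simp: bij_betw_def p_def cong: image_cong_simp inj_on_cong)
  then have "p permutes K" by (rule bij_imp_permutes) (simp add: p_def)
  then have perm: "permutation p" using finK permutation_permutes by blast
  obtain h where h: "h \<in> K" using K by blast
  define n where "n = funpow_dist1 p h h"
  have self: "h \<in> orbit p h" using perm by (rule permutation_self_in_orbit)
  have n: "(p ^^ n) h = h" "0 < n" unfolding n_def using self by (rule funpow_dist1_prop, simp)
  have inj: "inj_on (\<lambda>i. (p ^^ i) h) {0..<n}" unfolding n_def using self by (rule inj_on_funpow_dist1)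
  have pK: "(p ^^ i) h \<in> K" for i by (induction i) (use h sK in \<open>auto simp: p_def\<close>)
  define C where "C = map (\<lambda>i. (p ^^ i) h) [0..<n]"
  have setC: "set C \<subseteq> K" using pK by (auto simp: C_def)
  have distC: "distinct C" using inj by (simp add: C_def distinct_map)
  have "simple_cycle M C"
    unfolding simple_cycle_def
  proof (intro conjI allI impI)
    show "C \<noteq> []" using n by (simp add: C_def)
    show "set C \<subseteq> H" using setC K A by blast
    show "distinct (map V C)" using injV setC distC by (simp add: distinct_map inj_on_subset)
    have "inj_on E (set C)"
      by (rule inj_onI) (use A(3) setC K in \<open>auto simp: E_eq_iff\<close>)
    then show "distinct (map E C)" using distC by (simp add: distinct_map)
    fix i assume i: "i < length C"
    then have "C ! (Suc i mod length C) = (p ^^ (Suc i mod n)) h"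
      using n by (simp add: C_def)
    also have "\<dots> = (p ^^ Suc i) h" using n(1) by (rule funpow_mod_eq)
    also have "\<dots> = s (C ! i)" using i pK by (simp add: C_def p_def)
    finally show "V (\<alpha> (C ! i)) = V (C ! (Suc i mod length C))"
      using a(2)[of "C ! i"] i setC K by (metis nth_mem subsetD)
  qed
  then show thesis using that setC K by blast
qed

text \<open>At the end of a boundary half-edge, turning around the vertex from inside
  \<open>W\<close> must leave \<open>W\<close> again, and the half-edge where this happens is a
  boundary half-edge that can serve as successor.\<close>

lemma region_boundary_cycle:
  assumes W: "W \<subseteq> H" "W \<noteq> {}" "W \<noteq> H" "\<phi> ` W \<subseteq> W"
  obtains C where "simple_cycle M C" "set C \<subseteq> {h \<in> W. \<alpha> h \<notin> W}"
proof (rule simple_cycle_exists[of "{h \<in> W. \<alpha> h \<notin> W}"])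
  show "{h \<in> W. \<alpha> h \<notin> W} \<noteq> {}" using connected_faces[OF W(1,2,4)] W(3) by blast
  have \<phi>W: "\<phi> h \<in> W \<longleftrightarrow> h \<in> W" for h using invariant_iff(2)[OF W(1,4)] .
  fix h assume h: "h \<in> {h \<in> W. \<alpha> h \<notin> W}"
  have "\<sigma> (\<alpha> h) \<in> W" using h \<phi>W[of h] by (simp add: \<phi>_def)
  moreover have "\<alpha> h \<in> orbit \<sigma> (\<sigma> (\<alpha> h))"
    by (metis V_\<sigma> mem_V_iff vertex_of_def)
  ultimately obtain k where k: "k \<in> orbit \<sigma> (\<sigma> (\<alpha> h))" "k \<in> W" "\<sigma> k \<notin> W"
    using orbit_leaves[OF permutation(1)] h by blast
  then have "\<alpha> k \<notin> W" using \<phi>W[of "\<alpha> k"] by simp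
  moreover have "V k = V (\<alpha> h)" using k(1) by (metis V_\<sigma> mem_V_iff vertex_of_def)
  ultimately show "\<exists>k\<in>{h \<in> W. \<alpha> h \<notin> W}. V k = V (\<alpha> h)" using k by blast
qed (use W that in auto)

section \<open>The cyclic order of a simple cycle and its two sides\<close>

lemma simple_cycle_succ:
  assumes "simple_cycle M C"
  obtains s where "s ` set C = set C" "\<And>k. k \<in> set C \<Longrightarrow> V (s k) = V (\<alpha> k)"
    "\<And>X. X \<subseteq> set C \<Longrightarrow> X \<noteq> {} \<Longrightarrow> s ` X \<subseteq> X \<Longrightarrow> X = set C"
proof -
  let ?n = "length C"
  have C: "C \<noteq> []" "distinct (map V C)"
    "\<And>i. i < ?n \<Longrightarrow> V (\<alpha> (C ! i)) = V (C ! (Suc i mod ?n))"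
    using assms by (auto simp: simple_cycle_def)
  have dist: "distinct C" using C(2) by (simp add: distinct_map)
  define s where "s k = C ! (Suc (THE i. i < ?n \<and> C ! i = k) mod ?n)" for k
  have s: "s (C ! i) = C ! (Suc i mod ?n)" if "i < ?n" for i
  proof -
    have "(THE j. j < ?n \<and> C ! j = C ! i) = i"
      using that dist by (auto simp: nth_eq_iff_index_eq)
    then show ?thesis by (simp add: s_def)
  qed
  have closed: "X = set C" if X: "X \<subseteq> set C" "X \<noteq> {}" "s ` X \<subseteq> X" for X
  proof -
    obtain i where i: "i < ?n" "C ! i \<in> X" using X by (metis all_not_in_conv in_set_conv_nth subsetD)
    have "C ! ((i + j) mod ?n) \<in> X" for j
    proof (induction j)
      case (Suc j)
      have "(i + j) mod ?n < ?n" using i(1) by (intro mod_less_divisor) linarith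
      then have "s (C ! ((i + j) mod ?n)) = C ! ((i + Suc j) mod ?n)"
        by (simp add: s mod_Suc_eq)
      then show ?case using Suc X(3) by auto
    qed (use i in simp)
    note * = this
    \<comment> \<open>A shift by \<open>?n - i + j\<close> leads from position \<open>i\<close> to
      position \<open>j\<close> modulo \<open>?n\<close>.\<close>
    have "C ! j \<in> X" if "j < ?n" for j
      using *[of "?n - i + j"] that i by simp
    then show ?thesis using X(1) by (metis in_set_conv_nth subsetI subset_antisym)
  qed
  have "s ` set C \<subseteq> set C"
  proof
    fix x assume "x \<in> s ` set C"
    then obtain i where "i < ?n" "x = s (C ! i)" by (metis imageE in_set_conv_nth)
    moreover from this have "Suc i mod ?n < ?n" by (intro mod_less_divisor) linarith
    ultimately show "x \<in> set C" using s by simp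
  qed
  moreover from this have "s ` set C = set C" by (intro closed) (use C in auto)
  moreover have "V (s k) = V (\<alpha> k)" if "k \<in> set C" for k
    using that C(3) s by (metis in_set_conv_nth)
  ultimately show thesis using that closed by blast
qed

lemma simple_cycle_props:
  assumes "simple_cycle M C"
  shows "set C \<subseteq> H" "set C \<noteq> {}" "inj_on V (set C)" "\<And>k. k \<in> set C \<Longrightarrow> \<alpha> k \<notin> set C"
    "card (set C) = length C"
proof -
  show 1: "set C \<subseteq> H" "set C \<noteq> {}" "inj_on V (set C)"
    using assms by (auto simp: simple_cycle_def distinct_map)
  show "card (set C) = length C" using assms by (auto simp: simple_cycle_def distinct_map distinct_card)
  have "inj_on E (set C)" using assms by (auto simp: simple_cycle_def distinct_map)
  then show "\<alpha> k \<notin> set C" if "k \<in> set C" for k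
    using that 1(1) \<alpha>_neq by (metis E_eq_iff inj_onD subsetD)
qed

text \<open>At the vertex between two consecutive edges of the cycle the divergence of a face
  gradient vanishes, and the other edges there contribute 0; so the jump is handed on unchanged from
  edge to edge.\<close>

lemma simple_cycle_gradient:
  fixes \<gamma> :: "'h \<Rightarrow> int"
  assumes C: "simple_cycle M C" and \<gamma>: "\<And>h. \<gamma> (\<phi> h) = \<gamma> h"
    and off: "\<And>h. h \<in> H \<Longrightarrow> h \<notin> set C \<Longrightarrow> \<alpha> h \<notin> set C \<Longrightarrow> \<gamma> (\<alpha> h) = \<gamma> h"
    and kl: "k \<in> set C" "l \<in> set C"
  shows "\<gamma> (\<alpha> k) - \<gamma> k = \<gamma> (\<alpha> l) - \<gamma> l"
proof -
  obtain s where s: "s ` set C = set C" "\<And>k. k \<in> set C \<Longrightarrow> V (s k) = V (\<alpha> k)"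
    "\<And>X. X \<subseteq> set C \<Longrightarrow> X \<noteq> {} \<Longrightarrow> s ` X \<subseteq> X \<Longrightarrow> X = set C"
    by (rule simple_cycle_succ[OF C]) blast
  note D = simple_cycle_props[OF C]
  have inj_s: "inj_on s (set C)" by (rule eq_card_imp_inj_on) (use s in auto)
  have step: "\<gamma> (\<alpha> (s k)) - \<gamma> (s k) = \<gamma> (\<alpha> k) - \<gamma> k" if k: "k \<in> set C" for k
  proof -
    let ?g = "\<lambda>h. \<gamma> (\<alpha> h) - \<gamma> h"
    have sk: "s k \<in> set C" using s k by blast
    have ne: "s k \<noteq> \<alpha> k" using D(4)[OF k] sk by auto
    have "0 = sum ?g (V (s k))" using face_gradient_div[of \<gamma> "s k"] \<gamma> by simp
    also have "\<dots> = sum ?g {s k, \<alpha> k}"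
    proof (rule sum.mono_neutral_right)
      show "finite (V (s k))" using sk D(1) by (intro finite_subset_H orbit_sub_H) auto
      show "{s k, \<alpha> k} \<subseteq> V (s k)" using s(2)[OF k] by (simp add: mem_V_iff)
      show "\<forall>h\<in>V (s k) - {s k, \<alpha> k}. ?g h = 0"
      proof
        fix h assume h: "h \<in> V (s k) - {s k, \<alpha> k}"
        then have Vh: "V h = V (s k)" by (simp add: mem_V_iff)
        have "h \<notin> set C" using h Vh D(3) sk by (auto dest: inj_onD)
        moreover have "\<alpha> h \<notin> set C"
        proof
          assume a: "\<alpha> h \<in> set C"
          then have "V (s (\<alpha> h)) = V (s k)" using s(2)[OF a] Vh by simp
          then have "s (\<alpha> h) = s k" using s(1) a sk D(3) by (metis imageI inj_onD)
          then have "\<alpha> h = k" using inj_s a k by (metis inj_onD)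
          then show False using h by auto
        qed
        moreover have "h \<in> H" using h sk D(1) orbit_sub_H(1)[of "s k"] by auto
        ultimately show "?g h = 0" using off by simp
      qed
    qed
    also have "\<dots> = ?g (s k) + ?g (\<alpha> k)" using ne by simp
    finally show ?thesis by simp
  qed
  let ?X = "{l \<in> set C. \<gamma> (\<alpha> l) - \<gamma> l = \<gamma> (\<alpha> k) - \<gamma> k}"
  have "?X = set C" by (rule s(3)) (use kl s(1) step in auto)
  then have "l \<in> ?X" using kl by simp
  then show ?thesis by simp
qed

text \<open>Discrete Jordan curve theorem. The unit circulation along the cycle is the gradient of a
  face potential that takes just two values; \<open>L\<close> consists of the faces of the higher
  one, on the left of the cycle.\<close>

lemma simple_cycle_sides:
  assumes C: "simple_cycle M C"
  obtains L where "L \<subseteq> H" "\<phi> ` L \<subseteq> L" "\<And>h. h \<in> set C \<Longrightarrow> h \<notin> L \<and> \<alpha> h \<in> L"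
    "\<And>h. h \<in> H \<Longrightarrow> h \<notin> set C \<Longrightarrow> \<alpha> h \<notin> set C \<Longrightarrow> \<alpha> h \<in> L \<longleftrightarrow> h \<in> L"
proof -
  obtain s where s: "s ` set C = set C" "\<And>k. k \<in> set C \<Longrightarrow> V (s k) = V (\<alpha> k)"
    by (rule simple_cycle_succ[OF C]) blast
  note D = simple_cycle_props[OF C]
  have inj_s: "inj_on s (set C)" by (rule eq_card_imp_inj_on) (use s in auto)
  define \<tau> :: "'h \<Rightarrow> int" where "\<tau> h = of_bool (h \<in> set C) - of_bool (\<alpha> h \<in> set C)" for h
  obtain \<gamma> where \<gamma>: "\<And>h. \<gamma> (\<phi> h) = \<gamma> h" "\<And>h. h \<in> H \<Longrightarrow> \<gamma> (\<alpha> h) - \<gamma> h = \<tau> h"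
  proof (rule circulation_potential[of \<tau>])
    fix h assume h: "h \<in> H"
    have fin: "finite (V h)" using h by (intro finite_subset_H orbit_sub_H)
    have "card {k \<in> V h. k \<in> set C} = card {k \<in> V h. \<alpha> k \<in> set C}"
    proof (rule bij_betw_same_card[symmetric])
      show "bij_betw (\<lambda>k. s (\<alpha> k)) {k \<in> V h. \<alpha> k \<in> set C} {k \<in> V h. k \<in> set C}"
        unfolding bij_betw_def
      proof
        show "inj_on (\<lambda>k. s (\<alpha> k)) {k \<in> V h. \<alpha> k \<in> set C}"
          using inj_s by (auto intro!: inj_onI dest: inj_onD)
        show "(\<lambda>k. s (\<alpha> k)) ` {k \<in> V h. \<alpha> k \<in> set C} = {k \<in> V h. k \<in> set C}" (is "?L = ?R")
        proof
          show "?L \<subseteq> ?R" using s by (auto simp: mem_V_iff)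
          show "?R \<subseteq> ?L"
          proof
            fix k assume k: "k \<in> ?R"
            then obtain l where l: "l \<in> set C" "k = s l" using s(1) by blast
            then have "\<alpha> l \<in> {k \<in> V h. \<alpha> k \<in> set C}" using k s(2)[of l] by (auto simp: mem_V_iff)
            moreover have "k = s (\<alpha> (\<alpha> l))" using l by simp
            ultimately show "k \<in> ?L" by blast
          qed
        qed
      qed
    qed
    then show "(\<Sum>k\<in>V h. \<tau> k) = 0"
      using fin by (simp add: \<tau>_def sum_subtractf of_bool_def sum.If_cases Int_def)
  qed (auto simp: \<tau>_def)
  obtain k0 where k0: "k0 \<in> set C" using D(2) by (meson ex_in_conv)
  define t where "t = \<gamma> k0"
  have on: "\<gamma> (\<alpha> k) = \<gamma> k + 1" if "k \<in> set C" for k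
    using \<gamma>(2)[of k] that D by (auto simp: \<tau>_def)
  have off: "\<gamma> (\<alpha> h) = \<gamma> h" if "h \<in> H" "h \<notin> set C" "\<alpha> h \<notin> set C" for h
    using \<gamma>(2)[of h] that by (simp add: \<tau>_def)
  \<comment> \<open>A priori the edges of the cycle could separate different pairs of levels. The
    threshold function of \<open>\<gamma> > t\<close> jumps at \<open>k0\<close>, hence at every
    edge of the cycle, which pins \<open>\<gamma> k\<close> to \<open>t\<close>.\<close>
  have level: "\<gamma> k = t" if k: "k \<in> set C" for k
  proof -
    have "of_bool (\<gamma> (\<alpha> k0) > t) - of_bool (\<gamma> k0 > t) =
      (of_bool (\<gamma> (\<alpha> k) > t) - of_bool (\<gamma> k > t) :: int)"
      by (rule simple_cycle_gradient[OF C, of "\<lambda>h. of_bool (\<gamma> h > t)"])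
        (use \<gamma>(1) off k0 k in auto)
    then show ?thesis using on[OF k0] on[OF k] by (auto simp: t_def of_bool_def split: if_splits)
  qed
  have "{h \<in> H. \<gamma> h = t \<or> \<gamma> h = t + 1} = H"
  proof (rule connected_faces)
    show "{h \<in> H. \<gamma> h = t \<or> \<gamma> h = t + 1} \<noteq> {}" using k0 D(1) by (auto simp: t_def)
    have "\<gamma> (\<alpha> h) = t \<or> \<gamma> (\<alpha> h) = t + 1" if "h \<in> H" "\<gamma> h = t \<or> \<gamma> h = t + 1" for h
      using that on[of h] level[of h] level[of "\<alpha> h"] off[of h]
      by (cases "h \<in> set C"; cases "\<alpha> h \<in> set C") auto
    then show "\<alpha> ` {h \<in> H. \<gamma> h = t \<or> \<gamma> h = t + 1} \<subseteq> {h \<in> H. \<gamma> h = t \<or> \<gamma> h = t + 1}" by auto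
  qed (use \<gamma>(1) in auto)
  show thesis
  proof (rule that[of "{h \<in> H. \<gamma> h = t + 1}"])
    show "h \<notin> {h \<in> H. \<gamma> h = t + 1} \<and> \<alpha> h \<in> {h \<in> H. \<gamma> h = t + 1}" if "h \<in> set C" for h
      using that on level D(1) by auto
  qed (use \<gamma>(1) off in auto)
qed

section \<open>Interiors of cycles and a criterion for minimality\<close>

lemma vertex_invariant_mem:
  assumes "\<sigma> ` U \<subseteq> U" "V h \<in> V ` U"
  shows "h \<in> U"
proof -
  obtain k where k: "k \<in> U" "V h = V k" using assms(2) by blast
  then have "h \<in> V k" by (simp add: mem_V_iff)
  then show ?thesis using V_subset[OF assms(1) k(1)] by blast
qed

lemma face_invariant_mem:
  assumes "\<phi> ` L \<subseteq> L" "F h = F k" "k \<in> L"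
  shows "h \<in> L"
proof -
  have "h \<in> F k" using assms(2) by (simp add: mem_F_iff)
  then show ?thesis using F_subset[OF assms(1,3)] by blast
qed

text \<open>Faces reached from the root face without crossing the cycle stay on its side. If that
  side were \<open>L\<close> while the left faces are interior, the reached set would have no
  boundary and fill the sphere, although the faces on the right of the cycle are not in
  \<open>L\<close>.\<close>

lemma interior_on_left_iff:
  assumes C: "simple_cycle M C" and L: "L \<subseteq> H" "\<phi> ` L \<subseteq> L"
    and on: "\<And>h. h \<in> set C \<Longrightarrow> h \<notin> L \<and> \<alpha> h \<in> L"
    and off: "\<And>h. h \<in> H \<Longrightarrow> h \<notin> set C \<Longrightarrow> \<alpha> h \<notin> set C \<Longrightarrow> \<alpha> h \<in> L \<longleftrightarrow> h \<in> L"
  shows "interior_on_left M C \<longleftrightarrow> root \<inter> L = {}"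
proof
  assume disj: "root \<inter> L = {}"
  have reach: "\<exists>k\<in>H - L. f = F k" if "(root, f) \<in> (face_step M C)\<^sup>*" for f
    using that
  proof induction
    case base
    obtain h where h: "h \<in> H" "root = F h" by (rule root_face_obtain)
    then have "h \<in> root" by simp
    then have "h \<notin> L" using disj by blast
    then show ?case using h by blast
  next
    case (step y z)
    then obtain k where k: "k \<in> H" "k \<notin> L" "y = F k" by blast
    obtain h where h: "h \<in> H" "y = F h" "z = F (\<alpha> h)" "E h \<notin> E ` set C"
      using step.hyps(2) by (auto simp: face_step_def)
    have "h \<notin> L" using face_invariant_mem[OF L(2), of k h] k h by auto
    moreover have "h \<notin> set C" "\<alpha> h \<notin> set C" using h(4) by (auto simp: E_mem_image_iff)
    ultimately have "\<alpha> h \<notin> L" using off h(1) by simp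
    then show ?case using h by auto
  qed
  show "interior_on_left M C"
    unfolding interior_on_left_def interior_faces_def
  proof (intro ballI CollectI conjI notI)
    fix h assume h: "h \<in> set C"
    then have hH: "h \<in> H" using simple_cycle_props(1)[OF C] by blast
    then show "F (\<alpha> h) \<in> faces M" by (simp add: faces_def)
    assume "(root, F (\<alpha> h)) \<in> (face_step M C)\<^sup>*"
    then obtain k where "k \<in> H - L" "F (\<alpha> h) = F k" using reach by blast
    then have "\<alpha> h \<notin> L" using face_invariant_mem[OF L(2), of k "\<alpha> h"] by auto
    then show False using on h by blast
  qed
next
  assume left: "interior_on_left M C"
  show "root \<inter> L = {}"
  proof (rule ccontr)
    assume "root \<inter> L \<noteq> {}"
    then obtain h0 where h0: "h0 \<in> root" "h0 \<in> L" by blast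
    have reach: "h \<in> L" if "(root, f) \<in> (face_step M C)\<^sup>*" "f = F h" for f h
      using that
    proof (induction arbitrary: h)
      case base
      then show ?case using face_invariant_mem[OF L(2) _ h0(2)] root_F[OF h0(1)] by simp
    next
      case (step y z)
      obtain k where k: "k \<in> H" "y = F k" "z = F (\<alpha> k)" "E k \<notin> E ` set C"
        using step.hyps(2) by (auto simp: face_step_def)
      have "k \<in> L" using step.IH k(2) by blast
      moreover have "k \<notin> set C" "\<alpha> k \<notin> set C" using k(4) by (auto simp: E_mem_image_iff)
      ultimately have "\<alpha> k \<in> L" using off k(1) by simp
      then show ?case using face_invariant_mem[OF L(2), of h "\<alpha> k"] step.prems k(3) by simp
    qed
    let ?R = "{h \<in> H. (root, F h) \<in> (face_step M C)\<^sup>*}"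
    have "?R = H"
    proof (rule connected_faces)
      have "h0 \<in> ?R" using h0 root_F root_sub_H by auto
      then show "?R \<noteq> {}" by blast
      show "\<alpha> ` ?R \<subseteq> ?R"
      proof
        fix x assume "x \<in> \<alpha> ` ?R"
        then obtain h where h: "h \<in> H" "(root, F h) \<in> (face_step M C)\<^sup>*" "x = \<alpha> h" by blast
        have "h \<in> L" using reach[OF h(2)] by simp
        then have "h \<notin> set C" using on by blast
        moreover have "\<alpha> h \<notin> set C"
        proof
          assume "\<alpha> h \<in> set C"
          then have "F (\<alpha> (\<alpha> h)) \<in> interior_faces M C"
            using left unfolding interior_on_left_def by blast
          then show False using h(2) by (simp add: interior_faces_def)
        qed
        ultimately have "E h \<notin> E ` set C" by (simp add: E_mem_image_iff)
        then have "(F h, F (\<alpha> h)) \<in> face_step M C" using h(1) by (auto simp: face_step_def)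
        then have "(root, F (\<alpha> h)) \<in> (face_step M C)\<^sup>*" using h(2) by (rule rtrancl_into_rtrancl[rotated])
        then show "x \<in> ?R" using h by simp
      qed
    qed auto
    moreover obtain k where "k \<in> set C" using simple_cycle_props(2)[OF C] by (meson ex_in_conv)
    ultimately have "k \<in> L" "k \<notin> L"
      using reach[of "F k" k] on simple_cycle_props(1)[OF C] by blast+
    then show False by blast
  qed
qed

text \<open>The component of the root face when only half-edges satisfying \<open>Q\<close> may be
  crossed; the last clause is its induction principle. Here and elsewhere a set of faces is encoded
  as a \<phi>-invariant set of half-edges.\<close>

lemma root_component:
  obtains W where "W \<subseteq> H" "root \<subseteq> W" "\<phi> ` W \<subseteq> W" "\<And>h. h \<in> W \<Longrightarrow> Q h \<Longrightarrow> \<alpha> h \<in> W"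
    "\<And>X. X \<subseteq> H \<Longrightarrow> root \<subseteq> X \<Longrightarrow> \<phi> ` X \<subseteq> X \<Longrightarrow>
      (\<And>h. h \<in> X \<Longrightarrow> Q h \<Longrightarrow> \<alpha> h \<in> X) \<Longrightarrow> W \<subseteq> X"
proof -
  define P where "P X \<longleftrightarrow> X \<subseteq> H \<and> root \<subseteq> X \<and> \<phi> ` X \<subseteq> X \<and>
    (\<forall>h\<in>X. Q h \<longrightarrow> \<alpha> h \<in> X)" for X
  have PH: "P H" using root_sub_H by (auto simp: P_def)
  show thesis
  proof (rule that[of "\<Inter> {X. P X}"])
    show "\<Inter> {X. P X} \<subseteq> H" using PH by blast
    show "root \<subseteq> \<Inter> {X. P X}" by (auto simp: P_def)
    show "\<phi> ` \<Inter> {X. P X} \<subseteq> \<Inter> {X. P X}" unfolding P_def by blast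
    show "\<alpha> h \<in> \<Inter> {X. P X}" if "h \<in> \<Inter> {X. P X}" "Q h" for h
      using that unfolding P_def by blast
    show "\<Inter> {X. P X} \<subseteq> X" if "X \<subseteq> H" "root \<subseteq> X" "\<phi> ` X \<subseteq> X"
      "\<And>h. h \<in> X \<Longrightarrow> Q h \<Longrightarrow> \<alpha> h \<in> X" for X
    proof -
      have "P X" using that by (simp add: P_def)
      then show ?thesis by blast
    qed
  qed
qed

text \<open>Filling the holes of \<open>S\<close> makes the complement connected, so that a simple cycle on
  the boundary of the filled set has the root face on its right.\<close>

lemma minimal_iff:
  "minimal M B \<longleftrightarrow> (\<forall>S\<subseteq>H. \<phi> ` S \<subseteq> S \<longrightarrow> S \<inter> root = {} \<longrightarrow>
     (\<forall>h\<in>H. h \<notin> S \<longrightarrow> \<alpha> h \<in> S \<longrightarrow> traversable M B h) \<longrightarrow> S = {})"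
  (is "_ \<longleftrightarrow> ?R")
proof
  assume R: ?R
  show "minimal M B"
    unfolding minimal_def
  proof
    assume "\<exists>C. ccw_circuit M B C"
    then obtain C where C: "simple_cycle M C" "interior_on_left M C" "\<And>h. h \<in> set C \<Longrightarrow> traversable M B h"
      by (auto simp: ccw_circuit_def)
    obtain L where L: "L \<subseteq> H" "\<phi> ` L \<subseteq> L" "\<And>h. h \<in> set C \<Longrightarrow> h \<notin> L \<and> \<alpha> h \<in> L"
      "\<And>h. h \<in> H \<Longrightarrow> h \<notin> set C \<Longrightarrow> \<alpha> h \<notin> set C \<Longrightarrow> \<alpha> h \<in> L \<longleftrightarrow> h \<in> L"
      using simple_cycle_sides[OF C(1)] by metis
    have disj: "L \<inter> root = {}" using interior_on_left_iff[OF C(1) L] C(2) by (simp add: Int_commute)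
    have trav: "traversable M B h" if h: "h \<in> H" "h \<notin> L" "\<alpha> h \<in> L" for h
    proof -
      have "\<alpha> h \<notin> set C" using L(3)[of "\<alpha> h"] h(3) by blast
      then have "h \<in> set C" using L(4)[OF h(1)] h by blast
      then show ?thesis by (rule C(3))
    qed
    have "L = {}" by (rule R[rule_format, OF L(1,2) disj]) (rule trav)
    moreover obtain k where "k \<in> set C" using simple_cycle_props(2)[OF C(1)] by (meson ex_in_conv)
    ultimately show False using L(3)[of k] by simp
  qed
next
  assume min: "minimal M B"
  show ?R
  proof (intro allI impI)
    fix S assume S: "S \<subseteq> H" "\<phi> ` S \<subseteq> S" "S \<inter> root = {}"
      and trav: "\<forall>h\<in>H. h \<notin> S \<longrightarrow> \<alpha> h \<in> S \<longrightarrow> traversable M B h"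
    show "S = {}"
    proof (rule ccontr)
      assume "S \<noteq> {}"
      obtain Y where YH: "Y \<subseteq> H" and Y_root: "root \<subseteq> Y" and Y\<phi>: "\<phi> ` Y \<subseteq> Y"
        and Y\<alpha>: "\<And>h. h \<in> Y \<Longrightarrow> \<alpha> h \<notin> S \<Longrightarrow> \<alpha> h \<in> Y"
        and Yle: "\<And>X. X \<subseteq> H \<Longrightarrow> root \<subseteq> X \<Longrightarrow> \<phi> ` X \<subseteq> X \<Longrightarrow>
          (\<And>h. h \<in> X \<Longrightarrow> \<alpha> h \<notin> S \<Longrightarrow> \<alpha> h \<in> X) \<Longrightarrow> Y \<subseteq> X"
        by (rule root_component[of "\<lambda>h. \<alpha> h \<notin> S"]) blast
      have "Y \<subseteq> H - S"
      proof (rule Yle)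
        show "root \<subseteq> H - S" using S(3) root_sub_H by blast
        have "\<phi> h \<in> H - S" if "h \<in> H - S" for h
          using that invariant_iff(2)[OF S(1,2), of h] by simp
        then show "\<phi> ` (H - S) \<subseteq> H - S" by blast
        show "\<alpha> h \<in> H - S" if "h \<in> H - S" "\<alpha> h \<notin> S" for h using that by simp
      qed (rule Diff_subset)
      then have YS: "Y \<inter> S = {}" by blast
      have "Y \<noteq> {}" using Y_root root_nonempty by blast
      moreover have "Y \<noteq> H" using YS S(1) \<open>S \<noteq> {}\<close> by blast
      ultimately obtain C where C: "simple_cycle M C" "set C \<subseteq> {h \<in> Y. \<alpha> h \<notin> Y}"
        using region_boundary_cycle[OF YH _ _ Y\<phi>] by metis
      obtain L where L: "L \<subseteq> H" "\<phi> ` L \<subseteq> L" "\<And>h. h \<in> set C \<Longrightarrow> h \<notin> L \<and> \<alpha> h \<in> L"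
        "\<And>h. h \<in> H \<Longrightarrow> h \<notin> set C \<Longrightarrow> \<alpha> h \<notin> set C \<Longrightarrow> \<alpha> h \<in> L \<longleftrightarrow> h \<in> L"
        using simple_cycle_sides[OF C(1)] by metis
      obtain k where k: "k \<in> set C" using simple_cycle_props(2)[OF C(1)] by (meson ex_in_conv)
      \<comment> \<open>Otherwise \<open>Y \<inter> L\<close> would have the closure properties of
        \<open>Y\<close>, since a crossing that stays inside \<open>Y\<close> never crosses
        \<open>C\<close>. Leastness would then put \<open>Y\<close>, and with it the half-edges of
        \<open>C\<close>, into \<open>L\<close>.\<close>
      have "root \<inter> L = {}"
      proof (rule ccontr)
        assume "root \<inter> L \<noteq> {}"
        then obtain h0 where h0: "h0 \<in> root" "h0 \<in> L" by blast
        have "Y \<subseteq> Y \<inter> L"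
        proof (rule Yle)
          show "Y \<inter> L \<subseteq> H" using YH by blast
          show "root \<subseteq> Y \<inter> L"
            using Y_root F_subset[OF L(2) h0(2)] root_F[OF h0(1)] by simp
          show "\<phi> ` (Y \<inter> L) \<subseteq> Y \<inter> L" using Y\<phi> L(2) by blast
          fix h assume h: "h \<in> Y \<inter> L" "\<alpha> h \<notin> S"
          then have aY: "\<alpha> h \<in> Y" using Y\<alpha> by blast
          then have "h \<notin> set C" using C(2) by blast
          moreover have "\<alpha> h \<notin> set C" using C(2) h(1) by auto
          ultimately have "\<alpha> h \<in> L" using L(4)[of h] h(1) YH by blast
          then show "\<alpha> h \<in> Y \<inter> L" using aY by simp
        qed
        then show False using k C(2) L(3)[OF k] by blast
      qed
      then have "interior_on_left M C" using interior_on_left_iff[OF C(1) L] by blast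
      moreover have "traversable M B h" if h: "h \<in> set C" for h
      proof -
        have hY: "h \<in> Y" "\<alpha> h \<notin> Y" using h C(2) by auto
        then have "\<alpha> h \<in> S" using Y\<alpha> by blast
        moreover have "h \<notin> S" using hY(1) YS by blast
        ultimately show ?thesis using trav hY(1) YH by blast
      qed
      ultimately have "ccw_circuit M B C" using C(1) by (simp add: ccw_circuit_def)
      then show False using min by (auto simp: minimal_def)
    qed
  qed
qed

section \<open>Potentials on corners and closed walks\<close>

text \<open>Integration along the steps \<sigma> and \<phi> at once. A potential
  \<open>\<beta>\<close> solves the face equations; what is then missing at the \<sigma>-steps is
  antisymmetric by \<open>edge\<close>, hence a circulation, and the face potential integrating it
  does not disturb the \<phi>-steps.\<close>

lemma corner_potential:
  fixes a b :: "'h \<Rightarrow> int"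
  assumes edge: "\<And>h. h \<in> H \<Longrightarrow> a h - b h + a (\<alpha> h) - b (\<alpha> h) = 0"
    and vertex: "\<And>h. h \<in> H \<Longrightarrow> (\<Sum>k\<in>V h. a k) = 0"
    and face: "\<And>h. h \<in> H \<Longrightarrow> (\<Sum>k\<in>F h. b k) = 0"
  obtains \<pi> where "\<And>h. h \<in> H \<Longrightarrow> a h = \<pi> (\<sigma> h) - \<pi> h" "\<And>h. h \<in> H \<Longrightarrow> b h = \<pi> (\<phi> h) - \<pi> h"
proof -
  define b' where "b' h = (if h \<in> H then b h else 0)" for h
  have "(\<Sum>k\<in>orbit \<phi> h. b' k) = 0" for h
  proof (cases "h \<in> H")
    case True
    then have "(\<Sum>k\<in>F h. b' k) = (\<Sum>k\<in>F h. b k)"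
      using orbit_sub_H(2) by (intro sum.cong) (auto simp: b'_def)
    then show ?thesis using face[OF True] by (simp add: F_orbit)
  next
    case False
    then have "orbit \<phi> h = {h}" using permutes(3) by (simp add: orbit_eq_singleton_iff permutes_not_in)
    then show ?thesis using False by (simp add: b'_def)
  qed
  then obtain \<beta> where \<beta>': "\<And>h. \<beta> (\<phi> h) - \<beta> h = b' h"
    using orbit_primitive[OF permutation(2), of b'] by blast
  have \<beta>: "\<beta> (\<phi> h) - \<beta> h = b h" if "h \<in> H" for h using \<beta>'[of h] that by (simp add: b'_def)
  define \<tau> where "\<tau> h = a h - \<beta> (\<sigma> h) + \<beta> h" for h
  obtain \<gamma> where \<gamma>: "\<And>h. \<gamma> (\<phi> h) = \<gamma> h" "\<And>h. h \<in> H \<Longrightarrow> \<gamma> (\<alpha> h) - \<gamma> h = \<tau> h"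
  proof (rule circulation_potential[of \<tau>])
    show "\<tau> (\<alpha> h) = - \<tau> h" if "h \<in> H" for h
      using edge[OF that] \<beta>[OF that] \<beta>[of "\<alpha> h"] that by (simp add: \<tau>_def \<phi>_def)
    show "(\<Sum>k\<in>V h. \<tau> k) = 0" if "h \<in> H" for h
      using vertex[OF that] by (simp add: \<tau>_def sum.distrib sum_subtractf sum_V_shift)
  qed blast
  show thesis
  proof (rule that[of "\<lambda>h. \<beta> h + \<gamma> h"])
    fix h assume h: "h \<in> H"
    have "\<gamma> (\<sigma> h) = \<gamma> (\<alpha> h)" using \<gamma>(1)[of "\<alpha> h"] by simp
    then show "a h = \<beta> (\<sigma> h) + \<gamma> (\<sigma> h) - (\<beta> h + \<gamma> h)"
      using \<gamma>(2)[OF h] by (simp add: \<tau>_def)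
    show "b h = \<beta> (\<phi> h) + \<gamma> (\<phi> h) - (\<beta> h + \<gamma> h)" using \<beta>[OF h] \<gamma>(1) by simp
  qed
qed

section \<open>Closed walks and winding numbers\<close>

lemma sum_V_indicator:
  assumes "z \<in> H"
  shows "(\<Sum>h\<in>V z. of_bool (h = k) :: int) = of_bool (V z = V k)"
    "(\<Sum>h\<in>V z. of_bool (\<alpha> h = k) :: int) = of_bool (V z = V (\<alpha> k))"
proof -
  have fin: "finite (V z)" using orbit_sub_H(1)[OF assms] by (rule finite_subset_H)
  show *: "(\<Sum>h\<in>V z. of_bool (h = k) :: int) = of_bool (V z = V k)" for k
  proof -
    have "(\<Sum>h\<in>V z. of_bool (h = k) :: int) = of_bool (k \<in> V z)"
      using fin by (simp add: of_bool_def)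
    then show ?thesis by (simp add: mem_V_iff eq_commute)
  qed
  have "(\<alpha> h = k) = (h = \<alpha> k)" for h by auto
  then show "(\<Sum>h\<in>V z. of_bool (\<alpha> h = k) :: int) = of_bool (V z = V (\<alpha> k))"
    using *[of "\<alpha> k"] by simp
qed

text \<open>\<open>c\<close> counts how often the path runs along each half-edge; its divergence is
  a unit source at the start and a unit sink at the end.\<close>

lemma path_flow:
  assumes "(x, y) \<in> {(V h, V (\<alpha> h)) |h. h \<in> D}\<^sup>*" "D \<subseteq> H"
  shows "\<exists>c :: 'h \<Rightarrow> int. (\<forall>h. 0 \<le> c h) \<and> (\<forall>h. c h \<noteq> 0 \<longrightarrow> h \<in> D) \<and>
    (\<forall>z\<in>H. (\<Sum>h\<in>V z. c h - c (\<alpha> h)) = of_bool (V z = x) - of_bool (V z = y))"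
  using assms(1)
proof induction
  case base
  show ?case by (rule exI[of _ "\<lambda>_. 0"]) simp
next
  case (step y y')
  obtain k where k: "k \<in> D" "y = V k" "y' = V (\<alpha> k)" using step.hyps(2) by blast
  obtain c :: "'h \<Rightarrow> int" where c: "\<And>h. 0 \<le> c h" "\<And>h. c h \<noteq> 0 \<Longrightarrow> h \<in> D"
    "\<And>z. z \<in> H \<Longrightarrow> (\<Sum>h\<in>V z. c h - c (\<alpha> h)) = of_bool (V z = x) - of_bool (V z = y)"
    using step.IH by blast
  define e where "e h = (of_bool (h = k) :: int)" for h
  have "(\<Sum>h\<in>V z. (c h + e h) - (c (\<alpha> h) + e (\<alpha> h))) = of_bool (V z = x) - of_bool (V z = y')"
    if z: "z \<in> H" for z
  proof -
    have "(\<Sum>h\<in>V z. e h) = of_bool (V z = V k)"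
      unfolding e_def by (rule sum_V_indicator(1)[OF z])
    moreover have "(\<Sum>h\<in>V z. e (\<alpha> h)) = of_bool (V z = V (\<alpha> k))"
      unfolding e_def by (rule sum_V_indicator(2)[OF z])
    moreover have "(\<Sum>h\<in>V z. (c h + e h) - (c (\<alpha> h) + e (\<alpha> h))) =
      (\<Sum>h\<in>V z. c h - c (\<alpha> h)) + (\<Sum>h\<in>V z. e h) - (\<Sum>h\<in>V z. e (\<alpha> h))"
      by (simp add: sum.distrib sum_subtractf)
    ultimately show ?thesis using c(3)[OF z] k by simp
  qed
  moreover have "0 \<le> c h + e h" "c h + e h \<noteq> 0 \<longrightarrow> h \<in> D" for h
    using c(1)[of h] c(2)[of h] k(1) by (auto simp: e_def)
  ultimately show ?case by (intro exI[of _ "\<lambda>h. c h + e h"]) simp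
qed

text \<open>\<open>c\<close> counts the passages of a closed walk through \<open>h\<close>, and
  \<open>\<gamma>\<close> is its clockwise winding number around the faces, normalized to 0 at the
  root face: each passage along a half-edge raises the face on its right by one against the face on
  its left.\<close>

lemma closed_walk_potential:
  assumes D: "D \<subseteq> H" "h \<in> D" and walk: "(V (\<alpha> h), V h) \<in> {(V k, V (\<alpha> k)) |k. k \<in> D}\<^sup>*"
  obtains c \<gamma> :: "'h \<Rightarrow> int" where "\<And>k. 0 \<le> c k" "\<And>k. c k > 0 \<Longrightarrow> k \<in> D" "c h \<ge> 1"
    "\<And>k. \<gamma> (\<phi> k) = \<gamma> k" "\<And>k. k \<in> H \<Longrightarrow> \<gamma> k - \<gamma> (\<alpha> k) = c k - c (\<alpha> k)"
    "\<And>k. k \<in> root \<Longrightarrow> \<gamma> k = 0"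
proof -
  obtain c0 :: "'h \<Rightarrow> int" where c0: "\<And>k. 0 \<le> c0 k" "\<And>k. c0 k \<noteq> 0 \<Longrightarrow> k \<in> D"
    "\<And>z. z \<in> H \<Longrightarrow> (\<Sum>k\<in>V z. c0 k - c0 (\<alpha> k)) = of_bool (V z = V (\<alpha> h)) - of_bool (V z = V h)"
    using path_flow[OF walk D(1)] by blast
  define e where "e k = (of_bool (k = h) :: int)" for k
  define c where "c k = c0 k + e k" for k
  obtain \<gamma> where \<gamma>: "\<And>k. \<gamma> (\<phi> k) = \<gamma> k" "\<And>k. k \<in> H \<Longrightarrow> \<gamma> (\<alpha> k) - \<gamma> k = c (\<alpha> k) - c k"
  proof (rule circulation_potential[of "\<lambda>k. c (\<alpha> k) - c k"])
    fix z assume z: "z \<in> H"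
    have "(\<Sum>k\<in>V z. e k) = of_bool (V z = V h)"
      unfolding e_def by (rule sum_V_indicator(1)[OF z])
    moreover have "(\<Sum>k\<in>V z. e (\<alpha> k)) = of_bool (V z = V (\<alpha> h))"
      unfolding e_def by (rule sum_V_indicator(2)[OF z])
    moreover have "(\<Sum>k\<in>V z. c (\<alpha> k) - c k) =
      - (\<Sum>k\<in>V z. c0 k - c0 (\<alpha> k)) + (\<Sum>k\<in>V z. e (\<alpha> k)) - (\<Sum>k\<in>V z. e k)"
      by (simp add: c_def sum.distrib sum_subtractf)
    ultimately show "(\<Sum>k\<in>V z. c (\<alpha> k) - c k) = 0" using c0(3)[OF z] by simp
  next
    show "c (\<alpha> (\<alpha> k)) - c (\<alpha> k) = - (c (\<alpha> k) - c k)" for k by simp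
  qed blast
  obtain h0 where h0: "root = F h0" by (metis root_face_obtain)
  show thesis
  proof (rule that[of c "\<lambda>k. \<gamma> k - \<gamma> h0"])
    show "0 \<le> c k" for k using c0(1)[of k] by (simp add: c_def e_def)
    show "k \<in> D" if "c k > 0" for k
      using that c0(2)[of k] D(2) by (cases "k = h") (auto simp: c_def e_def)
    show "c h \<ge> 1" using c0(1)[of h] by (simp add: c_def e_def)
    show "\<gamma> (\<phi> k) - \<gamma> h0 = \<gamma> k - \<gamma> h0" for k using \<gamma>(1) by simp
    show "\<gamma> k - \<gamma> h0 - (\<gamma> (\<alpha> k) - \<gamma> h0) = c k - c (\<alpha> k)" if "k \<in> H" for k
      using \<gamma>(2)[OF that] by simp
    show "\<gamma> k - \<gamma> h0 = 0" if "k \<in> root" for k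
      using const_on_face[of \<gamma> k h0] \<gamma>(1) root_F[OF that] h0 by simp
  qed
qed

section \<open>The contour of the root face\<close>

lemma outer_contour_props:
  assumes h: "h \<in> root"
  shows "set (outer_contour M h) = root" "distinct (outer_contour M h)"
    "length (outer_contour M h) = card (root)"
    "\<And>i. i < card (root) \<Longrightarrow>
       \<phi> (outer_contour M h ! i) = outer_contour M h ! (Suc i mod card (root))"
proof -
  define n where "n = funpow_dist1 \<phi> h h"
  have self: "h \<in> orbit \<phi> h" using permutation(2) by (rule permutation_self_in_orbit)
  have orb: "orbit \<phi> h = root" using root_F[OF h] by (simp add: F_orbit)
  have inj: "inj_on (\<lambda>i. (\<phi> ^^ i) h) {0..<n}"
    unfolding n_def using self by (rule inj_on_funpow_dist1)
  have img: "root = (\<lambda>i. (\<phi> ^^ i) h) ` {0..<n}"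
    using orbit_conv_funpow_dist1[OF self] orb by (simp add: n_def)
  have n: "card (root) = n" unfolding img using inj by (simp add: card_image)
  have per: "(\<phi> ^^ n) h = h" unfolding n_def using self by (rule funpow_dist1_prop)
  have "\<sigma> \<circ> \<alpha> = \<phi>" by (simp add: \<phi>_def fun_eq_iff)
  then have C: "outer_contour M h = map (\<lambda>i. (\<phi> ^^ i) h) [0..<n]"
    by (simp add: outer_contour_def outer_degree_def face_degree_def n)
  show "set (outer_contour M h) = root" using img by (simp add: C)
  show "distinct (outer_contour M h)" using inj by (simp add: C distinct_map)
  show "length (outer_contour M h) = card (root)" by (simp add: C n)
  fix i assume i: "i < card (root)"
  then have "Suc i mod n < n" using n by (intro mod_less_divisor) linarith
  then have "outer_contour M h ! (Suc i mod n) = (\<phi> ^^ (Suc i mod n)) h" by (simp add: C)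
  also have "\<dots> = (\<phi> ^^ Suc i) h" using per by (rule funpow_mod_eq)
  also have "\<dots> = \<phi> (outer_contour M h ! i)" using i n by (simp add: C)
  finally show "\<phi> (outer_contour M h ! i) = outer_contour M h ! (Suc i mod card (root))"
    using n by simp
qed

lemma simple_contour_iff:
  assumes h: "h \<in> root"
  shows "simple_cycle M (outer_contour M h) \<longleftrightarrow>
    inj_on V (root) \<and> (\<forall>k\<in>root. \<alpha> k \<notin> root)"
proof
  assume "simple_cycle M (outer_contour M h)"
  from simple_cycle_props[OF this]
  show "inj_on V (root) \<and> (\<forall>k\<in>root. \<alpha> k \<notin> root)"
    by (simp add: outer_contour_props[OF h])
next
  assume R: "inj_on V (root) \<and> (\<forall>k\<in>root. \<alpha> k \<notin> root)"
  note P = outer_contour_props[OF h]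
  show "simple_cycle M (outer_contour M h)"
    unfolding simple_cycle_def
  proof (intro conjI allI impI)
    show "outer_contour M h \<noteq> []" using P(1) root_nonempty by force
    show "set (outer_contour M h) \<subseteq> H" using P(1) root_sub_H by simp
    show "distinct (map V (outer_contour M h))" using P R by (simp add: distinct_map)
    have "inj_on E (root)" by (rule inj_onI) (use R in \<open>auto simp: E_eq_iff\<close>)
    then show "distinct (map E (outer_contour M h))" using P by (simp add: distinct_map)
    fix i assume "i < length (outer_contour M h)"
    then show "V (\<alpha> (outer_contour M h ! i)) =
        V (outer_contour M h ! (Suc i mod length (outer_contour M h)))"
      using P(3) P(4)[of i] V_\<phi>[of "outer_contour M h ! i"] by simp
  qed
qed

section \<open>Girth and simplicity of the contour\<close>

lemma girth_ge: "girth M = enat d \<Longrightarrow> simple_cycle M C \<Longrightarrow> d \<le> length C"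
  unfolding girth_def by (metis (mono_tags, lifting) INF_lower enat_ord_simps(1) mem_Collect_eq)

lemma girth_eqI:
  assumes "\<And>C. simple_cycle M C \<Longrightarrow> d \<le> length C" "simple_cycle M C0" "length C0 = d"
  shows "girth M = enat d"
  unfolding girth_def
proof (rule antisym)
  show "(INF C\<in>{C. simple_cycle M C}. enat (length C)) \<le> enat d"
    using INF_lower[of C0 "{C. simple_cycle M C}" "\<lambda>C. enat (length C)"] assms(2,3) by simp
  show "enat d \<le> (INF C\<in>{C. simple_cycle M C}. enat (length C))"
    by (rule INF_greatest) (use assms(1) in simp)
qed

text \<open>The boundary of the root face contains a simple cycle, which by the girth is long enough
  to use every half-edge of the face. Finiteness of the girth supplies a cycle, whose two sides show
  that there is a second face and thus a boundary.\<close>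

lemma root_contour_simple:
  assumes girth: "girth M = enat (card (root))"
  shows "inj_on V (root)" "\<And>k. k \<in> root \<Longrightarrow> \<alpha> k \<notin> root"
proof -
  have ex: "\<exists>C. simple_cycle M C"
  proof (rule ccontr)
    assume "\<nexists>C. simple_cycle M C"
    then have "girth M = \<infinity>" by (simp add: girth_def top_enat_def)
    then show False using girth by simp
  qed
  then obtain C where C: "simple_cycle M C" by blast
  obtain L where L: "L \<subseteq> H" "\<phi> ` L \<subseteq> L" "\<And>h. h \<in> set C \<Longrightarrow> h \<notin> L \<and> \<alpha> h \<in> L"
    using simple_cycle_sides[OF C] by metis
  obtain k where k: "k \<in> set C" using simple_cycle_props(2)[OF C] by (meson ex_in_conv)
  have "root \<noteq> H"
  proof
    assume "root = H"
    then have "F k = F (\<alpha> k)" using simple_cycle_props(1)[OF C] k root_F[of k] root_F[of "\<alpha> k"] by auto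
    then show False using face_invariant_mem[OF L(2), of k "\<alpha> k"] L(3)[OF k] by blast
  qed
  then obtain C' where C': "simple_cycle M C'" "set C' \<subseteq> {h \<in> root. \<alpha> h \<notin> root}"
    using region_boundary_cycle[OF root_sub_H root_nonempty _ root_\<phi>] by metis
  have "card (root) \<le> card (set C')"
    using girth_ge[OF girth C'(1)] simple_cycle_props(5)[OF C'(1)] by simp
  moreover have "set C' \<subseteq> root" using C'(2) by blast
  ultimately have eq: "set C' = root"
    using finite_subset_H[OF root_sub_H] by (intro card_seteq)
  show "inj_on V (root)" using simple_cycle_props(3)[OF C'(1)] eq by simp
  show "\<alpha> k \<notin> root" if "k \<in> root" for k
    using that simple_cycle_props(4)[OF C'(1)] eq by simp
qed

end

section \<open>Flows\<close>

locale rooted_plane = plane M for M :: "'h plane_map" +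
  assumes root_inj: "inj_on V (root)"
    and root_sides: "k \<in> root \<Longrightarrow> \<alpha> k \<notin> root"
begin

abbreviation d where "d \<equiv> int (card root)"

definition Out where "Out = root \<union> \<alpha> ` root"
definition Z where "Z = {h \<in> H. V h \<in> V ` root}"

lemma d_pos: "d \<ge> 1"
proof -
  have "card root > 0" using root_nonempty finite_subset_H[OF root_sub_H] by (simp add: card_gt_0_iff)
  then show ?thesis by linarith
qed

lemma Out_sub_H: "Out \<subseteq> H"
  using root_sub_H by (auto simp: Out_def)

lemma Out_\<alpha>: "\<alpha> ` Out \<subseteq> Out"
  by (auto simp: Out_def)

lemma \<alpha>_Out [simp]: "\<alpha> h \<in> Out \<longleftrightarrow> h \<in> Out"
  using invariant_iff(3)[OF Out_sub_H Out_\<alpha>] .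

lemma card_Out: "card Out = 2 * card root"
proof -
  have fin: "finite root" using root_sub_H by (rule finite_subset_H)
  have "card (\<alpha> ` root) = card root" by (rule card_image) (simp add: inj_on_def)
  moreover have "root \<inter> \<alpha> ` root = {}" using root_sides by auto
  ultimately show ?thesis using fin by (simp add: Out_def card_Un_disjoint)
qed

lemma Z_sub_H: "Z \<subseteq> H"
  by (auto simp: Z_def)

lemma Z_\<sigma>: "\<sigma> ` Z \<subseteq> Z"
  by (auto simp: Z_def)

lemma V_mem_Z: "h \<in> H \<Longrightarrow> V h = V k \<Longrightarrow> k \<in> Z \<Longrightarrow> h \<in> Z"
  by (simp add: Z_def)

lemma root_sub_Z: "root \<subseteq> Z"
  using root_sub_H by (auto simp: Z_def)

lemma Out_sub_Z: "Out \<subseteq> Z"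
proof -
  have "\<alpha> h \<in> Z" if h: "h \<in> root" for h
  proof -
    have "\<phi> h \<in> root" using h root_\<phi> by blast
    then have "V (\<alpha> h) \<in> V ` root" using V_\<phi>[of h] by (metis imageI)
    then show ?thesis using h root_sub_H by (auto simp: Z_def)
  qed
  then show ?thesis using root_sub_Z by (auto simp: Out_def)
qed

lemma V_Z: "V ` Z = V ` root"
  using root_sub_Z by (auto simp: Z_def)

lemma card_V_Z: "card (V ` Z) = card root"
  unfolding V_Z using root_inj by (rule card_image)

text \<open>A \<open>d/(d-2)\<close>-orientation with weight function \<open>w\<close> is encoded by the positive parts
  \<open>p = max 0 w\<close>, which flow from edges to vertices, and the negative parts \<open>n = max 0 (-w)\<close>, which flow
  from faces to edges.\<close>

definition balanced :: "('h \<Rightarrow> int) \<Rightarrow> ('h \<Rightarrow> int) \<Rightarrow> bool" where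
  "balanced p n \<longleftrightarrow> (\<forall>h\<in>H. 0 \<le> p h \<and> 0 \<le> n h) \<and>
     (\<forall>h\<in>H - Out. p h - n h + (p (\<alpha> h) - n (\<alpha> h)) = d - 2) \<and>
     (\<forall>h\<in>H - Z. (\<Sum>k\<in>V h. p k) = d) \<and>
     (\<forall>h\<in>H - root. (\<Sum>k\<in>F h. n k) = int (card (F h)) - d)"

text \<open>The values on the outer edges direct the contour with the root face on its left.
  Suitability admits no other direction, as \<open>suitable_root_ingoing\<close> shows.\<close>

definition flow :: "('h \<Rightarrow> int) \<Rightarrow> ('h \<Rightarrow> int) \<Rightarrow> bool" where
  "flow p n \<longleftrightarrow> balanced p n \<and>
     (\<forall>h\<in>root. p h = 1 \<and> p (\<alpha> h) = 0 \<and> n h = 0 \<and> n (\<alpha> h) = 0) \<and> (\<forall>h\<in>Z - Out. p h = 0)"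

definition step_closed :: "('h \<Rightarrow> int) \<Rightarrow> ('h \<Rightarrow> int) \<Rightarrow> 'h set \<Rightarrow> bool" where
  "step_closed p n S \<longleftrightarrow> S \<subseteq> H \<and> (\<forall>h\<in>S. (p h = 0 \<longrightarrow> \<sigma> h \<in> S) \<and> (n h = 0 \<longrightarrow> \<phi> h \<in> S))"

text \<open>A half-edge stands for the corner on its right. The boundary of a set of corners is a clockwise
  residual circulation of the flow network iff the set is closed under the steps above, so the
  terminal flows are the extremal elements of the lattice of flows.\<close>

definition terminal :: "('h \<Rightarrow> int) \<Rightarrow> ('h \<Rightarrow> int) \<Rightarrow> bool" where
  "terminal p n \<longleftrightarrow> (\<forall>S. step_closed p n S \<longrightarrow> S \<inter> root = {} \<longrightarrow> S = {})"

lemma balancedD: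
  assumes "balanced p n"
  shows "h \<in> H \<Longrightarrow> 0 \<le> p h" "h \<in> H \<Longrightarrow> 0 \<le> n h"
    "h \<in> H \<Longrightarrow> h \<notin> Out \<Longrightarrow> p h - n h + (p (\<alpha> h) - n (\<alpha> h)) = d - 2"
    "h \<in> H \<Longrightarrow> h \<notin> Z \<Longrightarrow> (\<Sum>k\<in>V h. p k) = d"
    "h \<in> H \<Longrightarrow> h \<notin> root \<Longrightarrow> (\<Sum>k\<in>F h. n k) = int (card (F h)) - d"
  using assms by (simp_all add: balanced_def)

lemma flowD:
  assumes "flow p n"
  shows "balanced p n" "h \<in> root \<Longrightarrow> p h = 1" "h \<in> root \<Longrightarrow> p (\<alpha> h) = 0"
    "h \<in> root \<Longrightarrow> n h = 0" "h \<in> root \<Longrightarrow> n (\<alpha> h) = 0"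
    "h \<in> Z \<Longrightarrow> h \<notin> Out \<Longrightarrow> p h = 0"
  using assms by (simp_all add: flow_def)

lemma flow_Out:
  assumes "flow p n" "h \<in> Out"
  shows "n h = 0" "h \<notin> root \<Longrightarrow> p h = 0"
  using assms(2) flowD(3-5)[OF assms(1)] by (auto simp: Out_def)

text \<open>Among the half-edges of an outer vertex \<open>p\<close> vanishes except at the one of
  the root face, so a step-closed set with a corner at this vertex turns around it until it meets
  the root face.\<close>

lemma step_closed_Z:
  assumes "flow p n" "step_closed p n S" "S \<inter> root = {}"
  shows "S \<inter> Z = {}"
proof (rule ccontr)
  assume "S \<inter> Z \<noteq> {}"
  then obtain h where h: "h \<in> S" "h \<in> Z" by blast
  then obtain k where k: "k \<in> root" "V k = V h" by (auto simp: Z_def)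
  have "orbit \<sigma> h \<subseteq> {y \<in> S. V y = V h}"
  proof (rule orbit_subset_closed)
    fix y assume y: "y \<in> {y \<in> S. V y = V h}"
    then have yH: "y \<in> H" using assms(2) by (auto simp: step_closed_def)
    have "y \<in> Z" using V_mem_Z[OF yH] y h(2) by simp
    moreover have "y \<notin> root" using y assms(3) by blast
    ultimately have "p y = 0" using flow_Out(2)[OF assms(1)] flowD(6)[OF assms(1)] by blast
    then have "\<sigma> y \<in> S" using y assms(2) by (simp add: step_closed_def)
    then show "\<sigma> y \<in> {y \<in> S. V y = V h}" using y by simp
  qed (use h in simp)
  moreover have "k \<in> orbit \<sigma> h" using k(2) by (simp add: mem_V_iff flip: vertex_of_def)
  ultimately show False using k(1) assms(3) by blast
qed

section \<open>Uniqueness of terminal flows\<close>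

text \<open>The set where \<open>\<pi>\<close> is maximal is step-closed, since a step out of it
  lowers \<open>\<pi>\<close> and so needs a positive part. If the maximum were positive, this set
  would avoid the root face, against terminality.\<close>

lemma potential_nonpos:
  fixes \<pi> :: "'h \<Rightarrow> int"
  assumes tml: "terminal p n"
    and le: "\<And>h. h \<in> H \<Longrightarrow> - p h \<le> \<pi> (\<sigma> h) - \<pi> h" "\<And>h. h \<in> H \<Longrightarrow> - n h \<le> \<pi> (\<phi> h) - \<pi> h"
    and root: "\<And>h. h \<in> root \<Longrightarrow> \<pi> h = 0" and h: "h \<in> H"
  shows "\<pi> h \<le> 0"
proof (rule ccontr)
  assume pos: "\<not> \<pi> h \<le> 0"
  define m where "m = Max (\<pi> ` H)"
  have le_m: "\<pi> k \<le> m" if "k \<in> H" for k unfolding m_def using that by simp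
  have m: "m \<in> \<pi> ` H" unfolding m_def by (rule Max_in) (use h in auto)
  have mpos: "m > 0" using le_m[OF h] pos by simp
  have "step_closed p n {k \<in> H. \<pi> k = m}"
    unfolding step_closed_def
  proof (intro conjI ballI impI)
    fix k assume k: "k \<in> {k \<in> H. \<pi> k = m}"
    show "\<sigma> k \<in> {k \<in> H. \<pi> k = m}" if "p k = 0"
      using k le(1)[of k] le_m[of "\<sigma> k"] that by simp
    show "\<phi> k \<in> {k \<in> H. \<pi> k = m}" if "n k = 0"
      using k le(2)[of k] le_m[of "\<phi> k"] that by simp
  qed auto
  moreover have "{k \<in> H. \<pi> k = m} \<inter> root = {}" using root mpos by force
  ultimately have "{k \<in> H. \<pi> k = m} = {}" using tml unfolding terminal_def by blast
  then show False using m by auto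
qed

lemma terminal_unique:
  assumes f1: "flow p1 n1" "terminal p1 n1" and f2: "flow p2 n2" "terminal p2 n2" and h: "h \<in> H"
  shows "p1 h = p2 h \<and> n1 h = n2 h"
proof -
  note b1 = balancedD[OF flowD(1)[OF f1(1)]] and b2 = balancedD[OF flowD(1)[OF f2(1)]]
  have out: "p1 k = p2 k \<and> n1 k = n2 k" if "k \<in> Out" for k
    using that flow_Out[OF f1(1) that] flow_Out[OF f2(1) that] flowD(2)[OF f1(1)] flowD(2)[OF f2(1)]
    by (cases "k \<in> root") simp_all
  have onZ: "p1 k = p2 k" if "k \<in> Z" for k
    using that out[of k] flowD(6)[OF f1(1)] flowD(6)[OF f2(1)] by (cases "k \<in> Out") simp_all
  obtain \<pi>0 where \<pi>0: "\<And>k. k \<in> H \<Longrightarrow> p1 k - p2 k = \<pi>0 (\<sigma> k) - \<pi>0 k"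
    "\<And>k. k \<in> H \<Longrightarrow> n1 k - n2 k = \<pi>0 (\<phi> k) - \<pi>0 k"
  proof (rule corner_potential[of "\<lambda>k. p1 k - p2 k" "\<lambda>k. n1 k - n2 k"])
    fix k assume k: "k \<in> H"
    show "p1 k - p2 k - (n1 k - n2 k) + (p1 (\<alpha> k) - p2 (\<alpha> k)) - (n1 (\<alpha> k) - n2 (\<alpha> k)) = 0"
    proof (cases "k \<in> Out")
      case True
      then show ?thesis using out[of k] out[of "\<alpha> k"] by simp
    next
      case False
      then show ?thesis using b1(3)[OF k] b2(3)[OF k] by simp
    qed
    show "(\<Sum>l\<in>V k. p1 l - p2 l) = 0"
    proof (cases "k \<in> Z")
      case True
      have "p1 l - p2 l = 0" if "l \<in> V k" for l
        using onZ[of l] V_subset[OF Z_\<sigma> True] that by auto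
      then show ?thesis by simp
    next
      case False
      then show ?thesis using b1(4)[OF k] b2(4)[OF k] by (simp add: sum_subtractf)
    qed
    show "(\<Sum>l\<in>F k. n1 l - n2 l) = 0"
    proof (cases "k \<in> root")
      case True
      have "n1 l - n2 l = 0" if "l \<in> F k" for l
        using that root_F[OF True] flowD(4)[OF f1(1)] flowD(4)[OF f2(1)] by simp
      then show ?thesis by simp
    next
      case False
      then show ?thesis using b1(5)[OF k] b2(5)[OF k] by (simp add: sum_subtractf)
    qed
  qed blast
  obtain h0 where h0: "h0 \<in> root" using root_nonempty by blast
  \<comment> \<open>Both \<open>n1\<close> and \<open>n2\<close> vanish on the root face, so the
    potential is constant there and can be normalized to 0.\<close>
  have F0: "F h0 \<subseteq> {k \<in> root. \<pi>0 k = \<pi>0 h0}"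
  proof (rule F_subset)
    show "\<phi> ` {k \<in> root. \<pi>0 k = \<pi>0 h0} \<subseteq> {k \<in> root. \<pi>0 k = \<pi>0 h0}"
    proof
      fix x assume "x \<in> \<phi> ` {k \<in> root. \<pi>0 k = \<pi>0 h0}"
      then obtain k where k: "k \<in> root" "\<pi>0 k = \<pi>0 h0" "x = \<phi> k" by blast
      have "k \<in> H" using k root_sub_H by blast
      then have "\<pi>0 (\<phi> k) = \<pi>0 k"
        using \<pi>0(2)[of k] flowD(4)[OF f1(1) k(1)] flowD(4)[OF f2(1) k(1)] by simp
      moreover have "\<phi> k \<in> root" using k(1) root_\<phi> by blast
      ultimately show "x \<in> {k \<in> root. \<pi>0 k = \<pi>0 h0}" using k by simp
    qed
  qed (use h0 in simp)
  define \<pi> where "\<pi> k = \<pi>0 k - \<pi>0 h0" for k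
  have \<pi>: "p1 k - p2 k = \<pi> (\<sigma> k) - \<pi> k" "n1 k - n2 k = \<pi> (\<phi> k) - \<pi> k" if "k \<in> H" for k
    using \<pi>0[OF that] by (simp_all add: \<pi>_def)
  have root: "\<pi> k = 0" if "k \<in> root" for k
    using F0 root_F[OF h0] that by (auto simp: \<pi>_def)
  \<comment> \<open>In each direction the subtracted flow is the terminal one: its parts bound the
    drop of the potential, as the parts of the other flow are nonnegative.\<close>
  have le: "\<pi> k \<le> 0" if "k \<in> H" for k
  proof (rule potential_nonpos[OF f2(2) _ _ root that])
    show "- p2 l \<le> \<pi> (\<sigma> l) - \<pi> l" if "l \<in> H" for l using \<pi>(1)[OF that] b1(1)[OF that] by simp
    show "- n2 l \<le> \<pi> (\<phi> l) - \<pi> l" if "l \<in> H" for l using \<pi>(2)[OF that] b1(2)[OF that] by simp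
  qed
  have ge: "- \<pi> k \<le> 0" if "k \<in> H" for k
  proof (rule potential_nonpos[OF f1(2) _ _ _ that])
    show "- p1 l \<le> - \<pi> (\<sigma> l) - - \<pi> l" if "l \<in> H" for l using \<pi>(1)[OF that] b2(1)[OF that] by simp
    show "- n1 l \<le> - \<pi> (\<phi> l) - - \<pi> l" if "l \<in> H" for l using \<pi>(2)[OF that] b2(2)[OF that] by simp
  qed (simp add: root)
  have zero: "\<pi> k = 0" if "k \<in> H" for k using le[OF that] ge[OF that] by simp
  show ?thesis using \<pi>[OF h] zero[OF h] zero[of "\<sigma> h"] zero[of "\<phi> h"] h by simp
qed

section \<open>Properties of terminal flows\<close>

lemma terminal_complementary:
  assumes "flow p n" "terminal p n" "h \<in> H"
  shows "p h = 0 \<or> n h = 0"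
proof (rule ccontr)
  assume "\<not> ?thesis"
  then have "step_closed p n {h}" "{h} \<inter> root = {}"
    using assms(3) flowD(4)[OF assms(1)] by (auto simp: step_closed_def)
  then show False using assms(2) by (auto simp: terminal_def)
qed

text \<open>As \<open>\<sigma> h = \<phi> (\<alpha> h)\<close>, a turn can leave a set of whole
  faces only across the edge of \<open>h\<close>, and there \<open>trav\<close> provides a positive
  part.\<close>

lemma terminal_minimal:
  assumes "terminal p n" "S \<subseteq> H" "\<phi> ` S \<subseteq> S" "S \<inter> root = {}"
    and trav: "\<And>h. h \<in> H \<Longrightarrow> h \<notin> S \<Longrightarrow> \<alpha> h \<in> S \<Longrightarrow> p (\<alpha> h) > 0"
  shows "S = {}"
proof -
  have "\<sigma> h \<in> S" if h: "h \<in> S" "p h = 0" for h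
  proof (rule ccontr)
    assume "\<sigma> h \<notin> S"
    then have "\<alpha> h \<notin> S" using invariant_iff(2)[OF assms(2,3), of "\<alpha> h"] by simp
    then show False using trav[of "\<alpha> h"] h assms(2) by auto
  qed
  then have "step_closed p n S" using assms(2,3) by (auto simp: step_closed_def)
  then show ?thesis using assms(1,4) by (simp add: terminal_def)
qed

section \<open>Weight totals over regions, and accessibility\<close>

lemma face_total:
  assumes "balanced p n" "X \<subseteq> H" "\<phi> ` X \<subseteq> X" "X \<inter> root = {}"
  shows "(\<Sum>h\<in>X. n h) = int (card X) - d * int (card (F ` X))"
proof -
  have "(\<Sum>h\<in>X. n h - 1) = (\<Sum>f\<in>F ` X. \<Sum>h\<in>f. n h - 1)" using assms(2,3) by (rule sum_faces)
  also have "\<dots> = (\<Sum>f\<in>F ` X. - d)"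
  proof (rule sum.cong[OF refl])
    fix f assume "f \<in> F ` X"
    then obtain k where k: "k \<in> X" "f = F k" by blast
    then have "k \<in> H" "k \<notin> root" using assms(2,4) by auto
    then show "(\<Sum>h\<in>f. n h - 1) = - d"
      using balancedD(5)[OF assms(1), of k] k(2) by (simp add: sum_subtractf)
  qed
  finally show ?thesis by (simp add: sum_subtractf algebra_simps)
qed

lemma vertex_total:
  assumes "balanced p n" "X \<subseteq> H" "\<sigma> ` X \<subseteq> X" "X \<inter> Z = {}"
  shows "(\<Sum>h\<in>X. p h) = d * int (card (V ` X))"
proof -
  have "(\<Sum>h\<in>X. p h) = (\<Sum>v\<in>V ` X. \<Sum>h\<in>v. p h)" using assms(2,3) by (rule sum_vertices)
  also have "\<dots> = (\<Sum>v\<in>V ` X. d)"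
  proof (rule sum.cong[OF refl])
    fix v assume "v \<in> V ` X"
    then obtain k where k: "k \<in> X" "v = V k" by blast
    then have "k \<in> H" "k \<notin> Z" using assms(2,4) by auto
    then show "(\<Sum>h\<in>v. p h) = d" using balancedD(4)[OF assms(1), of k] k(2) by simp
  qed
  finally show ?thesis by simp
qed

lemma edge_total:
  assumes "balanced p n" "X \<subseteq> H" "\<alpha> ` X \<subseteq> X" "X \<inter> Out = {}"
  shows "2 * (\<Sum>h\<in>X. p h - n h) = (d - 2) * int (card X)"
proof -
  have "2 * (\<Sum>h\<in>X. p h - n h) = (\<Sum>h\<in>X. p h - n h) + (\<Sum>h\<in>X. p (\<alpha> h) - n (\<alpha> h))"
    using sum_\<alpha>[OF assms(2,3), of "\<lambda>h. p h - n h"] by simp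
  also have "\<dots> = (\<Sum>h\<in>X. p h - n h + (p (\<alpha> h) - n (\<alpha> h)))" by (simp add: sum.distrib)
  also have "\<dots> = (\<Sum>h\<in>X. d - 2)"
  proof (rule sum.cong[OF refl])
    fix h assume "h \<in> X"
    then have "h \<in> H" "h \<notin> Out" using assms(2,4) by auto
    then show "p h - n h + (p (\<alpha> h) - n (\<alpha> h)) = d - 2" by (rule balancedD(3)[OF assms(1)])
  qed
  finally show ?thesis by (simp add: algebra_simps)
qed

text \<open>\<open>U0\<close> stands for vertices that cannot be entered from outside:
  \<open>p h > 0\<close> means that the edge can be traversed towards the vertex of
  \<open>h\<close>. A strongly connected part of \<open>U0\<close> is looked at from the region
  \<open>W\<close> around the root face that its edges leave free. The totals over \<open>W\<close>
  force a boundary half-edge with \<open>n h \<ge> 2\<close>; the opposite half-edge then lies on a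
  closed walk, and the faces around which it winds clockwise form a step-closed set.\<close>

lemma terminal_accessible:
  assumes flow: "flow p n" and tml: "terminal p n"
    and U0: "U0 \<subseteq> H" "\<sigma> ` U0 \<subseteq> U0" "U0 \<inter> Z = {}"
    and pred: "\<And>h. h \<in> U0 \<Longrightarrow> p h > 0 \<Longrightarrow> \<alpha> h \<in> U0"
  shows "U0 = {}"
proof (rule ccontr)
  assume ne: "U0 \<noteq> {}"
  note bal = flowD(1)[OF flow]
  note b = balancedD[OF bal]
  \<comment> \<open>The relation runs against the traversable direction, so its closed sets are
    those entered by no edge from outside.\<close>
  let ?R = "{(V k, V (\<alpha> k)) |k. k \<in> U0 \<and> p k > 0}"
  obtain Y where Y: "Y \<subseteq> V ` U0" "Y \<noteq> {}" "?R `` Y \<subseteq> Y"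
    and conn: "\<And>x y. x \<in> Y \<Longrightarrow> y \<in> Y \<Longrightarrow> (x, y) \<in> (?R \<inter> Y \<times> Y)\<^sup>*"
  proof (rule minimal_closed_set[of "V ` U0" ?R])
    show "finite (V ` U0)" using finite_subset_H[OF U0(1)] by simp
    show "?R `` (V ` U0) \<subseteq> V ` U0" using pred by blast
  qed (use ne in blast)+
  define U where "U = {h \<in> H. V h \<in> Y}"
  have UH: "U \<subseteq> H" by (auto simp: U_def)
  have U_U0: "U \<subseteq> U0"
  proof
    fix h assume "h \<in> U"
    then have "V h \<in> V ` U0" using Y(1) unfolding U_def by blast
    then show "h \<in> U0" by (rule vertex_invariant_mem[OF U0(2)])
  qed
  have U_ne: "U \<noteq> {}"
  proof -
    obtain v where v: "v \<in> Y" using Y(2) by blast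
    then obtain h where h: "h \<in> U0" "v = V h" using Y(1) by blast
    then have "h \<in> U" using v U0(1) by (auto simp: U_def)
    then show ?thesis by blast
  qed
  have U\<sigma>: "\<sigma> ` U \<subseteq> U" by (auto simp: U_def)
  have UZ: "U \<inter> Z = {}" using U_U0 U0(3) by blast
  have Upred: "\<alpha> h \<in> U" if h: "h \<in> U" "p h > 0" for h
  proof -
    have "h \<in> U0" using h U_U0 by blast
    then have "(V h, V (\<alpha> h)) \<in> ?R" using h by blast
    then have "V (\<alpha> h) \<in> Y" using Y(3) h(1) by (auto simp: U_def)
    then show ?thesis using h(1) by (simp add: U_def)
  qed
  define E' where "E' = {h \<in> U. \<alpha> h \<in> U}"
  have E'\<alpha>: "\<alpha> h \<in> E' \<longleftrightarrow> h \<in> E'" for h by (auto simp: E'_def)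
  have E'Z: "E' \<inter> Z = {}" using UZ by (auto simp: E'_def)
  \<comment> \<open>The face, around the root face, of the subgraph with edges \<open>E'\<close>. As
    an open region it has the edges \<open>A\<close> and the vertices \<open>B\<close>; the
    half-edges of \<open>E'\<close> facing it are \<open>W - A\<close>.\<close>
  obtain W where WH: "W \<subseteq> H" and rootW: "root \<subseteq> W" and W\<phi>: "\<phi> ` W \<subseteq> W"
    and W\<alpha>: "\<And>h. h \<in> W \<Longrightarrow> h \<notin> E' \<Longrightarrow> \<alpha> h \<in> W"
    and Wle: "\<And>X. X \<subseteq> H \<Longrightarrow> root \<subseteq> X \<Longrightarrow> \<phi> ` X \<subseteq> X \<Longrightarrow>
      (\<And>h. h \<in> X \<Longrightarrow> h \<notin> E' \<Longrightarrow> \<alpha> h \<in> X) \<Longrightarrow> W \<subseteq> X"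
    by (rule root_component[of "\<lambda>h. h \<notin> E'"]) blast
  define A where "A = W - E'"
  define B where "B = W - U"
  have AW: "A \<subseteq> W" by (auto simp: A_def)
  have A\<alpha>: "\<alpha> ` A \<subseteq> A" using W\<alpha> E'\<alpha> by (auto simp: A_def)
  have BA: "B \<subseteq> A" by (auto simp: A_def B_def E'_def)
  have B\<sigma>: "\<sigma> ` B \<subseteq> B"
  proof
    fix x assume "x \<in> \<sigma> ` B"
    then obtain h where h: "h \<in> W" "h \<notin> U" "x = \<sigma> h" by (auto simp: B_def)
    have "\<alpha> h \<in> W" using W\<alpha> h by (auto simp: E'_def)
    then have "\<phi> (\<alpha> h) \<in> W" using W\<phi> by blast
    moreover have "\<sigma> h \<notin> U" using h(2) invariant_iff(1)[OF UH U\<sigma>] by simp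
    ultimately show "x \<in> B" using h(3) by (simp add: B_def)
  qed
  have BH: "B \<noteq> H" using U_ne UH by (auto simp: B_def)
  have W_ne: "W \<noteq> {}" using rootW root_nonempty by blast
  have W_conn: "\<exists>h\<in>A. h \<in> X \<and> \<alpha> h \<notin> X" if X: "X \<subset> W" "X \<noteq> {}" "\<phi> ` X \<subseteq> X" for X
  proof (rule ccontr)
    assume neg: "\<not> ?thesis"
    have XH: "X \<subseteq> H" using X(1) WH by blast
    have step: "\<alpha> h \<in> X" if "h \<in> X" "h \<notin> E'" for h
    proof -
      have "h \<in> A" using that X(1) by (auto simp: A_def)
      then show ?thesis using neg that by blast
    qed
    show False
    proof (cases "root \<inter> X = {}")
      case False
      then obtain h where h: "h \<in> root" "h \<in> X" by blast
      have "root \<subseteq> X" using F_subset[OF X(3) h(2)] root_F[OF h(1)] by simp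
      then have "W \<subseteq> X" using Wle[OF XH _ X(3)] step by blast
      then show False using X(1) by blast
    next
      case True
      have "W \<subseteq> W - X"
      proof (rule Wle)
        show "W - X \<subseteq> H" using WH by blast
        show "root \<subseteq> W - X" using rootW True by blast
        show "\<phi> ` (W - X) \<subseteq> W - X"
          using W\<phi> invariant_iff(2)[OF XH X(3)] by auto
        fix h assume h: "h \<in> W - X" "h \<notin> E'"
        have "\<alpha> h \<in> W" using W\<alpha> h by blast
        moreover have "\<alpha> h \<notin> X" using step[of "\<alpha> h"] E'\<alpha>[of h] h by auto
        ultimately show "\<alpha> h \<in> W - X" by blast
      qed
      then show False using X(1,2) by blast
    qed
  qed
  have chi: "2 * card (V ` B) + 2 * card (F ` W) \<le> card A + 2"
    by (rule region_euler[OF WH W_ne W\<phi> AW A\<alpha> BA B\<sigma> BH W_conn])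
  have OutA: "Out \<subseteq> A"
  proof -
    have "h \<in> A \<and> \<alpha> h \<in> A" if h: "h \<in> root" for h
    proof -
      have "h \<notin> E'" using h root_sub_Z E'Z by blast
      then have "h \<in> A" using h rootW by (auto simp: A_def)
      then show ?thesis using A\<alpha> by blast
    qed
    then show ?thesis by (auto simp: Out_def)
  qed
  have ZB: "Z \<subseteq> B"
  proof
    fix h assume h: "h \<in> Z"
    then obtain k where k: "k \<in> root" "V k = V h" by (auto simp: Z_def)
    have "k \<in> B" using k(1) rootW root_sub_Z UZ by (auto simp: B_def)
    then have "V k \<subseteq> B" by (rule V_subset[OF B\<sigma>])
    then show "h \<in> B" using k(2) by auto
  qed
  have fin: "finite W" "finite A" "finite B"
    using WH AW BA finite_subset_H by auto
  have sum_W: "(\<Sum>h\<in>W. n h) = int (card W) - d * int (card (F ` W))"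
  proof -
    have fW: "(\<Sum>h\<in>W - root. n h) = int (card (W - root)) - d * int (card (F ` (W - root)))"
    proof (rule face_total[OF bal])
      show "\<phi> ` (W - root) \<subseteq> W - root"
        using W\<phi> invariant_iff(2)[OF root_sub_H root_\<phi>] by auto
    qed (use WH in auto)
    have "(\<Sum>h\<in>W - root. n h) = (\<Sum>h\<in>W. n h)"
      by (rule sum.mono_neutral_left) (use fin flowD(4)[OF flow] in auto)
    moreover have "int (card (W - root)) = int (card W) - d" using WH rootW by (rule int_card_Diff)
    moreover have "card (F ` W) = card (F ` (W - root)) + 1"
    proof -
      have "F ` W = insert root (F ` (W - root))"
        using rootW root_F root_nonempty by (auto simp: image_iff)
      moreover have "root \<notin> F ` (W - root)" using mem_root_iff by auto
      ultimately show ?thesis using fin by simp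
    qed
    ultimately show ?thesis using fW by (simp add: algebra_simps)
  qed
  have sum_A: "2 * (\<Sum>h\<in>A. n h) = 2 * d * (int (card (V ` B)) - d) - (d - 2) * (int (card A) - 2 * d)"
  proof -
    have "(\<Sum>h\<in>A. n h) = (\<Sum>h\<in>A - Out. n h)"
      by (rule sum.mono_neutral_right) (use fin flow_Out(1)[OF flow] in auto)
    moreover have "2 * (\<Sum>h\<in>A - Out. p h - n h) = (d - 2) * int (card (A - Out))"
    proof (rule edge_total[OF bal])
      show "\<alpha> ` (A - Out) \<subseteq> A - Out" using A\<alpha> by auto
    qed (use AW WH in auto)
    moreover have "int (card (A - Out)) = int (card A) - 2 * d"
      using int_card_Diff[OF _ OutA] AW WH card_Out by auto
    \<comment> \<open>An edge of \<open>A\<close> with an end in \<open>U\<close> has its other end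
      outside \<open>U\<close>, so \<open>Upred\<close> makes \<open>p\<close> vanish at the end in
      \<open>U\<close>.\<close>
    moreover have "(\<Sum>h\<in>A - Out. p h) = (\<Sum>h\<in>B - Z. p h)"
    proof (rule sum.mono_neutral_right)
      show "B - Z \<subseteq> A - Out" using BA Out_sub_Z by blast
      show "\<forall>h\<in>A - Out - (B - Z). p h = 0"
      proof
        fix h assume h: "h \<in> A - Out - (B - Z)"
        show "p h = 0"
        proof (cases "h \<in> Z")
          case True
          then show ?thesis using h flowD(6)[OF flow] by blast
        next
          case False
          then have hU: "h \<in> U" "\<alpha> h \<notin> U" using h by (auto simp: A_def B_def E'_def)
          then have "\<not> p h > 0" using Upred by blast
          then show ?thesis using b(1)[of h] hU(1) UH by force
        qed
      qed
    qed (use fin in simp)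
    moreover have "(\<Sum>h\<in>B - Z. p h) = d * int (card (V ` (B - Z)))"
    proof (rule vertex_total[OF bal])
      show "\<sigma> ` (B - Z) \<subseteq> B - Z" using B\<sigma> invariant_iff(1)[OF Z_sub_H Z_\<sigma>] by auto
    qed (use BA AW WH in auto)
    moreover have "int (card (V ` (B - Z))) = int (card (V ` B)) - d"
    proof -
      have "B \<subseteq> H" using BA AW WH by blast
      then have "h \<in> Z" if "h \<in> B" "V h = V k" "k \<in> Z" for h k
        using V_mem_Z[of h k] that by blast
      then have "V ` (B - Z) = V ` B - V ` Z" by auto
      moreover have "V ` Z \<subseteq> V ` B" using ZB by blast
      ultimately show ?thesis
        using card_Diff_subset[of "V ` Z" "V ` B"] card_mono[of "V ` B" "V ` Z"] fin
          finite_subset_H[OF Z_sub_H] card_V_Z by simp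
    qed
    ultimately show ?thesis by (simp add: sum_subtractf algebra_simps)
  qed
  have card_WA: "int (card (W - A)) = int (card W) - int (card A)"
    using WH AW by (rule int_card_Diff)
  have "(\<Sum>h\<in>W. n h) = (\<Sum>h\<in>W - A. n h) + (\<Sum>h\<in>A. n h)"
    using sum.subset_diff[OF AW fin(1)] .
  \<comment> \<open>The bracket is at least -2, as the Euler characteristic of \<open>W\<close> is
    at most 1; so the sum exceeds the number of boundary half-edges by at least
    \<open>d\<close>.\<close>
  then have "2 * (\<Sum>h\<in>W - A. n h) =
      2 * int (card (W - A)) + d * (int (card A) - 2 * int (card (F ` W)) - 2 * int (card (V ` B))) + 4 * d"
    using sum_W sum_A card_WA by (simp add: algebra_simps)
  moreover have "d * (- 2) \<le> d * (int (card A) - 2 * int (card (F ` W)) - 2 * int (card (V ` B)))"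
    using chi by (intro mult_left_mono) simp_all
  ultimately have big: "(\<Sum>h\<in>W - A. n h) > int (card (W - A))" using d_pos by linarith
  have "\<exists>h\<in>W - A. n h \<ge> 2"
  proof (rule ccontr)
    assume "\<not> ?thesis"
    then have "(\<Sum>h\<in>W - A. n h) \<le> (\<Sum>h\<in>W - A. 1)" by (intro sum_mono) force
    then show False using big by simp
  qed
  then obtain h where h: "h \<in> W" "h \<in> E'" "n h \<ge> 2" by (auto simp: A_def)
  have hH: "h \<in> H" using h(1) WH by blast
  have ph: "p h = 0" using terminal_complementary[OF flow tml hH] h(3) by simp
  have "h \<notin> Out" using h(2) E'Z Out_sub_Z by blast
  \<comment> \<open>The edge total \<open>d - 2\<close> together with \<open>n h \<ge> 2\<close>
    leaves at least \<open>d\<close> for the opposite half-edge.\<close>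
  then have "p (\<alpha> h) > 0"
    using b(3)[OF hH] ph h(3) b(2)[of "\<alpha> h"] d_pos hH by simp
  define D where "D = {k \<in> U. p k > 0}"
  have D: "D \<subseteq> H" "\<alpha> h \<in> D" "D \<subseteq> E'"
    using UH h(2) \<open>p (\<alpha> h) > 0\<close> Upred by (auto simp: D_def E'_def)
  have inY: "V (\<alpha> (\<alpha> h)) \<in> Y" "V (\<alpha> h) \<in> Y" using h(2) by (simp_all add: E'_def U_def)
  have "?R \<inter> Y \<times> Y \<subseteq> {(V k, V (\<alpha> k)) |k. k \<in> D}"
    using U0(1) by (auto simp: D_def U_def)
  then have "(V (\<alpha> (\<alpha> h)), V (\<alpha> h)) \<in> {(V k, V (\<alpha> k)) |k. k \<in> D}\<^sup>*"
    using conn[OF inY] rtrancl_mono by blast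
  then obtain c \<gamma> :: "'h \<Rightarrow> int" where c: "\<And>k. 0 \<le> c k" "\<And>k. c k > 0 \<Longrightarrow> k \<in> D" "c (\<alpha> h) \<ge> 1"
    and \<gamma>: "\<And>k. \<gamma> (\<phi> k) = \<gamma> k" "\<And>k. k \<in> H \<Longrightarrow> \<gamma> k - \<gamma> (\<alpha> k) = c k - c (\<alpha> k)"
      "\<And>k. k \<in> root \<Longrightarrow> \<gamma> k = 0"
    by (rule closed_walk_potential[OF D(1,2)]) blast
  have c0: "c k = 0" if "k \<notin> D" for k using c(1)[of k] c(2)[of k] that by force
  have "W \<subseteq> {k \<in> H. \<gamma> k = 0}"
  proof (rule Wle)
    fix k assume k: "k \<in> {k \<in> H. \<gamma> k = 0}" "k \<notin> E'"
    then have "k \<notin> D" "\<alpha> k \<notin> D" using D(3) E'\<alpha>[of k] by blast+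
    then show "\<alpha> k \<in> {k \<in> H. \<gamma> k = 0}" using \<gamma>(2)[of k] c0 k(1) by simp
  qed (use root_sub_H \<gamma>(1,3) in auto)
  then have "\<gamma> h = 0" using h(1) by blast
  moreover have "c h = 0" using c0[of h] ph by (simp add: D_def)
  ultimately have pos: "\<gamma> (\<alpha> h) \<ge> 1" using \<gamma>(2)[OF hH] c(3) by simp
  \<comment> \<open>The winding number is 0 on \<open>W\<close>, because the walk uses only edges of
    \<open>E'\<close>. The walk passes \<open>\<alpha> h\<close> but never \<open>h\<close>, so it
    is at least 1 on the other side of this edge, and \<open>S\<close> is not empty.\<close>
  define S where "S = {k \<in> H. \<gamma> k \<ge> 1}"
  have "step_closed p n S"
    unfolding step_closed_def
  proof (intro conjI ballI impI)
    show "S \<subseteq> H" by (auto simp: S_def)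
    fix k assume k: "k \<in> S"
    show "\<phi> k \<in> S" using k \<gamma>(1) by (simp add: S_def)
    assume "p k = 0"
    then have "c k = 0" using c0[of k] by (simp add: D_def)
    then have "\<gamma> (\<alpha> k) \<ge> \<gamma> k" using \<gamma>(2)[of k] c(1)[of "\<alpha> k"] k by (simp add: S_def)
    then show "\<sigma> k \<in> S" using \<gamma>(1)[of "\<alpha> k"] k by (simp add: S_def)
  qed
  moreover have "S \<inter> root = {}" using \<gamma>(3) by (auto simp: S_def)
  ultimately have "S = {}" using tml by (simp add: terminal_def)
  then show False using pos hH by (auto simp: S_def)
qed

text \<open>The largest step-closed set \<open>S0\<close> off the root face has to be empty. By
  \<open>acc\<close> some vertex of a strongly connected part is covered by \<open>S0\<close> only
  partially, and a closed walk passes the half-edge \<open>h\<close> where the cover ends. By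
  \<open>min\<close> its winding numbers are at most 0, and by maximality the faces with negative
  ones lie in \<open>S0\<close>; at \<open>h\<close> this is contradictory.\<close>

lemma terminalI:
  assumes flow: "flow p n" and comp: "\<And>h. h \<in> H \<Longrightarrow> p h = 0 \<or> n h = 0"
    and min: "\<And>S. S \<subseteq> H \<Longrightarrow> \<phi> ` S \<subseteq> S \<Longrightarrow> S \<inter> root = {} \<Longrightarrow>
      (\<And>h. h \<in> H \<Longrightarrow> h \<notin> S \<Longrightarrow> \<alpha> h \<in> S \<Longrightarrow> p (\<alpha> h) > 0) \<Longrightarrow> S = {}"
    and acc: "\<And>U. U \<subseteq> H \<Longrightarrow> \<sigma> ` U \<subseteq> U \<Longrightarrow> U \<inter> Z = {} \<Longrightarrow>
      (\<And>h. h \<in> U \<Longrightarrow> p h > 0 \<Longrightarrow> \<alpha> h \<in> U) \<Longrightarrow> U = {}"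
  shows "terminal p n"
proof -
  note b = balancedD[OF flowD(1)[OF flow]]
  define S0 where "S0 = \<Union> {S. step_closed p n S \<and> S \<inter> root = {}}"
  have S0: "step_closed p n S0" unfolding step_closed_def S0_def by blast
  have S0_root: "S0 \<inter> root = {}" by (auto simp: S0_def)
  have S0_max: "S \<subseteq> S0" if "step_closed p n S" "S \<inter> root = {}" for S
    using that by (auto simp: S0_def)
  have S0H: "S0 \<subseteq> H" and S0\<sigma>: "\<And>h. h \<in> S0 \<Longrightarrow> p h = 0 \<Longrightarrow> \<sigma> h \<in> S0"
    and S0\<phi>: "\<And>h. h \<in> S0 \<Longrightarrow> n h = 0 \<Longrightarrow> \<phi> h \<in> S0"
    using S0 by (auto simp: step_closed_def)
  have S0Z: "S0 \<inter> Z = {}" by (rule step_closed_Z[OF flow S0 S0_root])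
  have "S0 = {}"
  proof (rule ccontr)
    assume ne: "S0 \<noteq> {}"
    define D where "D = {k \<in> S0. p k > 0}"
    have DH: "D \<subseteq> H" using S0H by (auto simp: D_def)
    \<comment> \<open>Complementarity turns a positive \<open>p\<close> into a permitted
      \<phi>-step, so going back along an edge from a corner of \<open>S0\<close> ends at a vertex
      of \<open>S0\<close>.\<close>
    have D\<phi>: "\<phi> k \<in> S0" if "k \<in> D" for k
    proof -
      have k: "k \<in> S0" "p k > 0" using that by (auto simp: D_def)
      then have "n k = 0" using comp[of k] S0H by auto
      then show ?thesis using S0\<phi> k by blast
    qed
    let ?R = "{(V k, V (\<alpha> k)) |k. k \<in> D}"
    obtain Y where Y: "Y \<subseteq> V ` S0" "Y \<noteq> {}" "?R `` Y \<subseteq> Y"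
      and conn: "\<And>x y. x \<in> Y \<Longrightarrow> y \<in> Y \<Longrightarrow> (x, y) \<in> (?R \<inter> Y \<times> Y)\<^sup>*"
    proof (rule minimal_closed_set[of "V ` S0" ?R])
      show "finite (V ` S0)" using finite_subset_H[OF S0H] by simp
      show "?R `` (V ` S0) \<subseteq> V ` S0"
      proof
        fix y assume "y \<in> ?R `` (V ` S0)"
        then obtain k where k: "k \<in> D" "y = V (\<alpha> k)" by blast
        then show "y \<in> V ` S0" using D\<phi> V_\<phi>[of k] by (metis imageI)
      qed
    qed (use ne in blast)+
    define U where "U = {h \<in> H. V h \<in> Y}"
    have U_ne: "U \<noteq> {}" using Y(1,2) S0H by (auto simp: U_def)
    \<comment> \<open>If \<open>S0\<close> covered all corners at the vertices of \<open>Y\<close>,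
      no edge would enter \<open>Y\<close> from outside, which \<open>acc\<close> excludes.\<close>
    have "\<not> U \<subseteq> S0"
    proof
      assume sub: "U \<subseteq> S0"
      have "U = {}"
      proof (rule acc)
        show "U \<subseteq> H" "\<sigma> ` U \<subseteq> U" by (auto simp: U_def)
        show "U \<inter> Z = {}" using sub S0Z by blast
        fix h assume h: "h \<in> U" "p h > 0"
        then have "h \<in> D" using sub by (auto simp: D_def)
        then have "V (\<alpha> h) \<in> Y" using Y(3) h(1) by (auto simp: U_def)
        then show "\<alpha> h \<in> U" using h(1) by (simp add: U_def)
      qed
      then show False using U_ne by blast
    qed
    then obtain h0 where h0: "h0 \<in> U" "h0 \<notin> S0" by blast
    then obtain k0 where k0: "k0 \<in> S0" "V h0 = V k0" using Y(1) by (auto simp: U_def)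
    have "h0 \<in> orbit \<sigma> k0" using k0(2) by (simp add: mem_V_iff flip: vertex_of_def)
    then obtain h where h: "h \<in> orbit \<sigma> k0" "h \<in> S0" "\<sigma> h \<notin> S0"
      using orbit_leaves[OF permutation(1) k0(1)] h0(2) by blast
    have hH: "h \<in> H" using h(2) S0H by blast
    have "V h = V k0" using h(1) by (simp add: mem_V_iff flip: vertex_of_def)
    then have Vh: "V h \<in> Y" using h0(1) k0(2) by (simp add: U_def)
    have "p h > 0" using S0\<sigma>[OF h(2)] h(3) b(1)[OF hH] by force
    then have hD: "h \<in> D" using h(2) by (simp add: D_def)
    then have "V (\<alpha> h) \<in> Y" using Y(3) Vh by blast
    then have "(V (\<alpha> h), V h) \<in> ?R\<^sup>*"
      using conn[OF _ Vh] rtrancl_mono[of "?R \<inter> Y \<times> Y" ?R] by blast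
    then obtain c \<gamma> :: "'h \<Rightarrow> int" where c: "\<And>k. 0 \<le> c k" "\<And>k. c k > 0 \<Longrightarrow> k \<in> D" "c h \<ge> 1"
      and \<gamma>: "\<And>k. \<gamma> (\<phi> k) = \<gamma> k" "\<And>k. k \<in> H \<Longrightarrow> \<gamma> k - \<gamma> (\<alpha> k) = c k - c (\<alpha> k)"
        "\<And>k. k \<in> root \<Longrightarrow> \<gamma> k = 0"
      by (rule closed_walk_potential[OF DH hD]) blast
    have \<gamma>\<sigma>: "\<gamma> (\<sigma> k) = \<gamma> (\<alpha> k)" for k using \<gamma>(1)[of "\<alpha> k"] by simp
    have up: "\<alpha> k \<in> D" if "k \<in> H" "\<gamma> k < \<gamma> (\<alpha> k)" for k
      using \<gamma>(2)[OF that(1)] that(2) c(1)[of k] by (intro c(2)) linarith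
    have "{k \<in> H. \<gamma> k > 0} = {}"
    proof (rule min)
      show "{k \<in> H. \<gamma> k > 0} \<inter> root = {}" using \<gamma>(3) by auto
      fix k assume "k \<in> H" "k \<notin> {k \<in> H. \<gamma> k > 0}" "\<alpha> k \<in> {k \<in> H. \<gamma> k > 0}"
      then have "\<alpha> k \<in> D" by (intro up) auto
      then show "p (\<alpha> k) > 0" by (simp add: D_def)
    qed (use \<gamma>(1) in auto)
    then have nonpos: "\<gamma> k \<le> 0" if "k \<in> H" for k using that by force
    \<comment> \<open>A \<sigma>-step from a face with negative winding number to one with winding
      number at least 0 crosses an edge that the walk passes along \<open>\<alpha> k\<close>; then
      \<open>\<alpha> k\<close> is in \<open>D\<close>, and the step ends in
      \<open>S0\<close>.\<close>
    have "step_closed p n (S0 \<union> {k \<in> H. \<gamma> k < 0})"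
      unfolding step_closed_def
    proof (intro conjI ballI impI)
      show "S0 \<union> {k \<in> H. \<gamma> k < 0} \<subseteq> H" using S0H by blast
      fix k assume k: "k \<in> S0 \<union> {k \<in> H. \<gamma> k < 0}"
      show "\<phi> k \<in> S0 \<union> {k \<in> H. \<gamma> k < 0}" if "n k = 0" using k S0\<phi> that \<gamma>(1) by auto
      show "\<sigma> k \<in> S0 \<union> {k \<in> H. \<gamma> k < 0}" if "p k = 0"
      proof (cases "k \<in> S0")
        case True
        then show ?thesis using S0\<sigma> that by blast
      next
        case False
        then have k: "k \<in> H" "\<gamma> k < 0" using k by auto
        show ?thesis
        proof (cases "\<gamma> (\<alpha> k) < 0")
          case True
          then show ?thesis using k \<gamma>\<sigma> by simp
        next
          case False
          then have "\<alpha> k \<in> D" using up k by simp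
          then show ?thesis using D\<phi>[of "\<alpha> k"] by simp
        qed
      qed
    qed
    moreover have "(S0 \<union> {k \<in> H. \<gamma> k < 0}) \<inter> root = {}" using S0_root \<gamma>(3) by auto
    ultimately have "S0 \<union> {k \<in> H. \<gamma> k < 0} \<subseteq> S0" by (rule S0_max)
    \<comment> \<open>As \<open>\<sigma> h\<close> is outside \<open>S0\<close>, the winding number
      across \<open>h\<close> is 0 and the walk does not use \<open>\<alpha> h\<close>; its passage
      along \<open>h\<close> then makes the winding number at \<open>h\<close> positive.\<close>
    then have "\<sigma> h \<notin> {k \<in> H. \<gamma> k < 0}" using h(3) by blast
    then have "\<not> \<gamma> (\<sigma> h) < 0" using hH by simp
    then have "\<gamma> (\<alpha> h) = 0" using nonpos[of "\<sigma> h"] hH \<gamma>\<sigma> by simp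
    moreover have "c (\<alpha> h) = 0"
    proof (rule ccontr)
      assume "c (\<alpha> h) \<noteq> 0"
      then have "\<alpha> h \<in> D" using c(1)[of "\<alpha> h"] by (intro c(2)) simp
      then show False using D\<phi>[of "\<alpha> h"] h(3) by simp
    qed
    ultimately have "\<gamma> h \<ge> 1" using \<gamma>(2)[OF hH] c(3) by simp
    then show False using nonpos[OF hH] by simp
  qed
  then show ?thesis using S0_max by (auto simp: terminal_def)
qed

section \<open>Orientations force large girth\<close>

text \<open>Totals over a region, with the contribution of \<open>n\<close> on the boundary
  estimated by 0 from below. When the Euler characteristic is at least 1, the inequality says that
  the boundary has length at least \<open>d\<close>.\<close>

lemma interior_count:
  assumes bal: "balanced p n"
    and W: "W \<subseteq> H" "\<phi> ` W \<subseteq> W" "W \<inter> root = {}" and A: "A \<subseteq> W" "\<alpha> ` A \<subseteq> A"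
    and B: "B \<subseteq> A" "\<sigma> ` B \<subseteq> B"
  shows "2 * d * (int (card (V ` B)) + int (card (F ` W))) \<le>
    2 * int (card (W - A)) + d * int (card A)"
proof -
  note b = balancedD[OF bal]
  have fin: "finite W" "finite A" using W A finite_subset_H by auto
  have AOut: "A \<inter> Out = {}"
  proof -
    have "h \<notin> root" "\<alpha> h \<notin> root" if "h \<in> A" for h using that A W(3) by blast+
    moreover have "h \<in> root \<or> \<alpha> h \<in> root" if "h \<in> Out" for h using that by (auto simp: Out_def)
    ultimately show ?thesis by blast
  qed
  have BZ: "B \<inter> Z = {}"
  proof (rule ccontr)
    assume "B \<inter> Z \<noteq> {}"
    then obtain h where h: "h \<in> B" "h \<in> Z" by blast
    then obtain k where k: "k \<in> root" "V k = V h" by (auto simp: Z_def)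
    have "V h \<subseteq> B" using V_subset[OF B(2) h(1)] .
    moreover have "k \<in> V h" using k(2) by (simp add: mem_V_iff)
    ultimately have "k \<in> B" by blast
    then show False using k(1) A B W(3) by blast
  qed
  have "(\<Sum>h\<in>W. n h) = int (card W) - d * int (card (F ` W))" by (rule face_total[OF bal W])
  moreover have "2 * (\<Sum>h\<in>A. p h - n h) = (d - 2) * int (card A)"
    by (rule edge_total[OF bal _ A(2) AOut]) (use A W in blast)
  moreover have "(\<Sum>h\<in>B. p h) = d * int (card (V ` B))"
    by (rule vertex_total[OF bal _ B(2) BZ]) (use A B W in blast)
  moreover have "(\<Sum>h\<in>B. p h) \<le> (\<Sum>h\<in>A. p h)"
    by (rule sum_mono2) (use fin B A W b(1) in auto)
  moreover have "(\<Sum>h\<in>W. n h) = (\<Sum>h\<in>W - A. n h) + (\<Sum>h\<in>A. n h)"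
    using sum.subset_diff[OF A(1) fin(1)] .
  moreover have "0 \<le> (\<Sum>h\<in>W - A. n h)" by (rule sum_nonneg) (use W b(2) in auto)
  moreover have "int (card (W - A)) = int (card W) - int (card A)"
    using W(1) A(1) by (rule int_card_Diff)
  ultimately show ?thesis by (simp add: sum_subtractf algebra_simps)
qed

end

context plane
begin

text \<open>The interior of a simple cycle has Euler characteristic at least 1, since the whole map has
  Euler characteristic 2 and the exterior has at most 1.\<close>

lemma cycle_region_euler:
  assumes C: "simple_cycle M C"
  obtains W A B where "W \<subseteq> H" "\<phi> ` W \<subseteq> W" "W \<inter> root = {}" "A \<subseteq> W" "\<alpha> ` A \<subseteq> A"
    "B \<subseteq> A" "\<sigma> ` B \<subseteq> B" "card (W - A) = length C"
    "card A + 2 \<le> 2 * card (V ` B) + 2 * card (F ` W)"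
proof -
  note D = simple_cycle_props[OF C]
  obtain s where s: "s ` set C = set C" "\<And>k. k \<in> set C \<Longrightarrow> V (s k) = V (\<alpha> k)"
    by (rule simple_cycle_succ[OF C]) blast
  obtain L where L: "L \<subseteq> H" "\<phi> ` L \<subseteq> L" "\<And>h. h \<in> set C \<Longrightarrow> h \<notin> L \<and> \<alpha> h \<in> L"
    "\<And>h. h \<in> H \<Longrightarrow> h \<notin> set C \<Longrightarrow> \<alpha> h \<notin> set C \<Longrightarrow> \<alpha> h \<in> L \<longleftrightarrow> h \<in> L"
    using simple_cycle_sides[OF C] by metis
  define CE where "CE = set C \<union> \<alpha> ` set C"
  define VC where "VC = {h \<in> H. V h \<in> V ` set C}"
  have CEH: "CE \<subseteq> H" using D(1) by (auto simp: CE_def)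
  have CE_iff: "h \<in> CE \<longleftrightarrow> h \<in> set C \<or> \<alpha> h \<in> set C" for h
    unfolding CE_def by (metis UnE UnI1 UnI2 \<alpha>_\<alpha> imageE imageI)
  have CE\<alpha>: "\<alpha> h \<in> CE \<longleftrightarrow> h \<in> CE" for h by (auto simp: CE_iff)
  have CEVC: "CE \<subseteq> VC"
  proof
    fix h assume h: "h \<in> CE"
    show "h \<in> VC"
    proof (cases "h \<in> set C")
      case True
      then show ?thesis using D(1) by (auto simp: VC_def)
    next
      case False
      then have k: "\<alpha> h \<in> set C" using h CE_iff by blast
      have "V h = V (s (\<alpha> h))" using s(2)[OF k] by simp
      moreover have "s (\<alpha> h) \<in> set C" using s(1) k by blast
      ultimately show ?thesis using h CEH by (auto simp: VC_def)
    qed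
  qed
  obtain k0 where k0: "k0 \<in> set C" using D(2) by (meson ex_in_conv)
  define side where "side X \<longleftrightarrow> X = L \<or> X = H - L" for X
  have side: "X \<subseteq> H" "\<phi> ` X \<subseteq> X" "X \<noteq> {}" "card (X \<inter> CE) = length C"
    "\<And>h. h \<in> H \<Longrightarrow> h \<notin> CE \<Longrightarrow> \<alpha> h \<in> X \<longleftrightarrow> h \<in> X"
    "\<And>h. h \<in> CE \<Longrightarrow> \<alpha> h \<in> X \<longleftrightarrow> h \<notin> X" if X: "side X" for X
  proof -
    show "X \<subseteq> H" using X L(1) by (auto simp: side_def)
    show "\<phi> ` X \<subseteq> X" using X L(2) invariant_iff(2)[OF L(1,2)] by (auto simp: side_def)
    show "X \<noteq> {}" using X L(3)[OF k0] D(1) k0 by (auto simp: side_def)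
    show "\<alpha> h \<in> X \<longleftrightarrow> h \<in> X" if "h \<in> H" "h \<notin> CE" for h
      using X L(4)[of h] that by (auto simp: side_def CE_iff)
    show "\<alpha> h \<in> X \<longleftrightarrow> h \<notin> X" if h: "h \<in> CE" for h
    proof -
      have "\<alpha> h \<in> L \<longleftrightarrow> h \<notin> L"
        using h L(3)[of h] L(3)[of "\<alpha> h"] by (auto simp: CE_iff)
      moreover have "h \<in> H" using h CEH by blast
      ultimately show ?thesis using X by (auto simp: side_def)
    qed
    have "L \<inter> CE = \<alpha> ` set C" "(H - L) \<inter> CE = set C"
      using L(3) D(1) by (auto simp: CE_def)
    moreover have "card (\<alpha> ` set C) = card (set C)" by (rule card_image) (simp add: inj_on_def)
    ultimately show "card (X \<inter> CE) = length C" using X D(5) by (auto simp: side_def)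
  qed
  have regions: "X - CE \<subseteq> X" "\<alpha> ` (X - CE) \<subseteq> X - CE" "X - VC \<subseteq> X - CE" "\<sigma> ` (X - VC) \<subseteq> X - VC"
    if X: "side X" for X
  proof -
    show 1: "X - CE \<subseteq> X" "X - VC \<subseteq> X - CE" using CEVC by auto
    show "\<alpha> ` (X - CE) \<subseteq> X - CE"
    proof
      fix y assume "y \<in> \<alpha> ` (X - CE)"
      then obtain h where h: "h \<in> X" "h \<notin> CE" "y = \<alpha> h" by blast
      then have "\<alpha> h \<in> X" using side(5)[OF X, of h] side(1)[OF X] by blast
      then show "y \<in> X - CE" using h CE\<alpha> by simp
    qed
    note 2 = this
    show "\<sigma> ` (X - VC) \<subseteq> X - VC"
    proof
      fix y assume "y \<in> \<sigma> ` (X - VC)"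
      then obtain h where h: "h \<in> X" "h \<notin> VC" "y = \<sigma> h" by blast
      then have "\<alpha> h \<in> X" using 1(2) 2 by blast
      then have "\<phi> (\<alpha> h) \<in> X" using side(2)[OF X] by blast
      moreover have "\<sigma> h \<notin> VC" using h(2) by (simp add: VC_def)
      ultimately show "y \<in> X - VC" using h(3) by simp
    qed
  qed
  have chi: "2 * card (V ` (X - VC)) + 2 * card (F ` X) \<le> card (X - CE) + 2" if X: "side X" for X
  proof (rule region_euler[OF side(1)[OF X] side(3)[OF X] side(2)[OF X] regions[OF X]])
    have "k0 \<in> VC" using k0 D(1) by (auto simp: VC_def)
    then show "X - VC \<noteq> H" using k0 D(1) by blast
    fix Y assume Y: "Y \<subset> X" "Y \<noteq> {}" "\<phi> ` Y \<subseteq> Y"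
    show "\<exists>h\<in>X - CE. h \<in> Y \<and> \<alpha> h \<notin> Y"
    proof (rule ccontr)
      assume neg: "\<not> ?thesis"
      have YH: "Y \<subseteq> H" using Y(1) side(1)[OF X] by blast
      have \<phi>Y: "\<phi> h \<in> Y \<longleftrightarrow> h \<in> Y" for h using invariant_iff(2)[OF YH Y(3)] .
      have off: "\<alpha> h \<in> Y" if "h \<in> Y" "h \<notin> CE" for h using neg that Y(1) by blast
      have off': "\<alpha> h \<in> Y \<longleftrightarrow> h \<in> Y" if "h \<notin> CE" for h
        using off[of h] off[of "\<alpha> h"] that CE\<alpha>[of h] by auto
      define x where "x h = (of_bool (h \<in> Y) :: int)" for h
      \<comment> \<open>By \<open>simple_cycle_gradient\<close> the boundary of \<open>Y\<close>
        uses no edge of the cycle or all of them. In the first case \<open>Y\<close> would fill the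
        sphere, in the second its complement in \<open>X\<close> would.\<close>
      define t where "t = x (\<alpha> k0) - x k0"
      have t: "x (\<alpha> k) - x k = t" if k: "k \<in> set C" for k
        unfolding t_def
        by (rule simple_cycle_gradient[OF C, of x, OF _ _ k k0])
          (use \<phi>Y off' in \<open>auto simp: x_def CE_iff\<close>)
      show False
      proof (cases "t = 0")
        case True
        have "Y = H"
        proof (rule connected_faces[OF YH Y(2,3)])
          have "\<alpha> h \<in> Y" if h: "h \<in> Y" for h
          proof (cases "h \<in> CE")
            case True
            then show ?thesis using t[of h] t[of "\<alpha> h"] \<open>t = 0\<close> h
              by (auto simp: CE_iff x_def split: if_splits)
          qed (use off h in blast)
          then show "\<alpha> ` Y \<subseteq> Y" by blast
        qed
        then show False using Y(1) side(1)[OF X] by blast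
      next
        case False
        have CEY: "h \<in> Y" if h: "h \<in> CE" "h \<in> X" for h
        proof (rule ccontr)
          assume "h \<notin> Y"
          moreover have "\<alpha> h \<notin> Y" using side(6)[OF X h(1)] h(2) Y(1) by blast
          ultimately have "x h = 0" "x (\<alpha> h) = 0" by (simp_all add: x_def)
          then show False using t[of h] t[of "\<alpha> h"] h(1) \<open>t \<noteq> 0\<close> by (auto simp: CE_iff)
        qed
        have "X - Y = H"
        proof (rule connected_faces)
          show "X - Y \<subseteq> H" using side(1)[OF X] by blast
          show "X - Y \<noteq> {}" using Y(1) by blast
          show "\<phi> ` (X - Y) \<subseteq> X - Y" using side(2)[OF X] \<phi>Y by auto
          show "\<alpha> ` (X - Y) \<subseteq> X - Y"
          proof
            fix z assume "z \<in> \<alpha> ` (X - Y)"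
            then obtain h where h: "h \<in> X" "h \<notin> Y" "z = \<alpha> h" by blast
            have nCE: "h \<notin> CE" using CEY h by blast
            then have "\<alpha> h \<in> X" using side(5)[OF X, of h] h side(1)[OF X] by blast
            then show "z \<in> X - Y" using off'[OF nCE] h by simp
          qed
        qed
        then show False using Y YH by blast
      qed
    qed
  qed
  define I where "I = (if root \<inter> L = {} then L else H - L)"
  define J where "J = H - I"
  have sI: "side I" and sJ: "side J"
    using L(1) by (auto simp: side_def I_def J_def)
  have I_root: "I \<inter> root = {}"
  proof (cases "root \<inter> L = {}")
    case True
    then show ?thesis by (auto simp: I_def)
  next
    case False
    then obtain h where h: "h \<in> root" "h \<in> L" by blast
    have "root \<subseteq> L" using F_subset[OF L(2) h(2)] root_F[OF h(1)] by simp
    then show ?thesis using False by (auto simp: I_def)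
  qed
  have IH: "I \<subseteq> H" using side(1)[OF sI] .
  have finH: "finite I" "finite J" "finite CE" using IH CEH finite_subset_H by (auto simp: J_def)
  have card_side: "card X = card (X - CE) + length C" if X: "side X" for X
  proof -
    have "finite X" using side(1)[OF X] by (rule finite_subset_H)
    then show ?thesis using card_Diff_subset_Int[of X CE] side(4)[OF X] card_mono[of X "X \<inter> CE"] by simp
  qed
  have "card H = card I + card J"
    using IH finH by (simp add: J_def card_Diff_subset card_mono)
  moreover have "card (F ` H) = card (F ` I) + card (F ` J)"
  proof -
    have "F ` I \<inter> F ` J = {}"
    proof (rule ccontr)
      assume "F ` I \<inter> F ` J \<noteq> {}"
      then obtain h k where hk: "h \<in> I" "k \<in> J" "F k = F h" by force
      then have "k \<in> I" using face_invariant_mem[OF side(2)[OF sI]] by blast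
      then show False using hk(2) by (simp add: J_def)
    qed
    moreover have "F ` H = F ` I \<union> F ` J" using IH by (auto simp: J_def)
    ultimately show ?thesis using finH by (simp add: card_Un_disjoint)
  qed
  moreover have "card (V ` H) = card (V ` (I - VC)) + card (V ` (J - VC)) + length C"
  proof -
    have "V ` H = V ` (I - VC) \<union> V ` (J - VC) \<union> V ` set C"
      using IH D(1) by (auto simp: J_def VC_def)
    moreover have "V ` (I - VC) \<inter> V ` (J - VC) = {}"
    proof (rule ccontr)
      assume "V ` (I - VC) \<inter> V ` (J - VC) \<noteq> {}"
      then obtain h k where hk: "h \<in> I - VC" "k \<in> J - VC" "V h = V k" by blast
      have "V h \<subseteq> I - VC" using V_subset[OF regions(4)[OF sI] hk(1)] .
      moreover have "k \<in> V h" using hk(3) by (simp add: mem_V_iff)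
      ultimately have "k \<in> I" by blast
      then show False using hk(2) by (simp add: J_def)
    qed
    moreover have "(V ` (I - VC) \<union> V ` (J - VC)) \<inter> V ` set C = {}"
      using IH by (auto simp: VC_def J_def)
    moreover have "card (V ` set C) = length C" using D(3,5) by (simp add: card_image)
    ultimately show ?thesis using finH by (simp add: card_Un_disjoint)
  qed
  \<comment> \<open>The map has Euler characteristic 2, the cycle contributes 0, having as many
    vertices as edges, and the outer side at most 1.\<close>
  ultimately have "card (I - CE) + 2 \<le> 2 * card (V ` (I - VC)) + 2 * card (F ` I)"
    using euler card_side[OF sI] card_side[OF sJ] chi[OF sJ] by linarith
  moreover have "card (I - (I - CE)) = length C"
    using side(4)[OF sI] by (simp add: Diff_Diff_Int)
  ultimately show thesis
    using that[OF side(1,2)[OF sI] I_root regions[OF sI]] by blast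
qed

end

context rooted_plane
begin

lemma cycle_length_ge:
  assumes bal: "balanced p n" and C: "simple_cycle M C"
  shows "card root \<le> length C"
proof -
  obtain W A B where R: "W \<subseteq> H" "\<phi> ` W \<subseteq> W" "W \<inter> root = {}" "A \<subseteq> W" "\<alpha> ` A \<subseteq> A"
    "B \<subseteq> A" "\<sigma> ` B \<subseteq> B" and len: "card (W - A) = length C"
    and chi: "card A + 2 \<le> 2 * card (V ` B) + 2 * card (F ` W)"
    by (rule cycle_region_euler[OF C]) blast
  have "int (card A) + 2 \<le> 2 * (int (card (V ` B)) + int (card (F ` W)))"
    using of_nat_mono[OF chi, where 'a = int] by simp
  then have "d * (int (card A) + 2) \<le> d * (2 * (int (card (V ` B)) + int (card (F ` W))))"
    by (rule mult_left_mono) simp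
  also have "\<dots> \<le> 2 * int (card (W - A)) + d * int (card A)"
    using interior_count[OF bal R] by (simp add: algebra_simps)
  finally show ?thesis using len by (simp add: algebra_simps)
qed

end

section \<open>Integer flows in networks\<close>

lemma rtrancl_distinct_path:
  assumes "(u, v) \<in> R\<^sup>*"
  shows "\<exists>zs. zs \<noteq> [] \<and> hd zs = u \<and> last zs = v \<and> distinct zs \<and> successively (\<lambda>x y. (x, y) \<in> R) zs"
  using assms
proof (induction rule: converse_rtrancl_induct)
  case base
  show ?case by (rule exI[of _ "[v]"]) simp
next
  case (step u w)
  then obtain zs where zs: "zs \<noteq> []" "hd zs = w" "last zs = v" "distinct zs"
    "successively (\<lambda>x y. (x, y) \<in> R) zs" by blast
  show ?case
  proof (cases "u \<in> set zs")
    case True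
    then obtain xs ys where "zs = xs @ u # ys" by (meson split_list)
    then show ?thesis using zs by (intro exI[of _ "u # ys"]) (auto simp: successively_append_iff)
  next
    case False
    then show ?thesis using zs step.hyps(1)
      by (intro exI[of _ "u # zs"]) (auto simp: successively_Cons)
  qed
qed

locale network =
  fixes arcs :: "'a set" and src tgt :: "'a \<Rightarrow> 'n"
  assumes finite_arcs: "finite arcs"
begin

definition net :: "('a \<Rightarrow> int) \<Rightarrow> 'n \<Rightarrow> int" where
  "net x v = (\<Sum>a | a \<in> arcs \<and> tgt a = v. x a) - (\<Sum>a | a \<in> arcs \<and> src a = v. x a)"

text \<open>Capacities are infinite: forward arcs are always residual, and only backward arcs depend
  on the flow.\<close>

definition residual :: "('a \<Rightarrow> int) \<Rightarrow> ('n \<times> 'n) set" where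
  "residual x = {(src a, tgt a) |a. a \<in> arcs} \<union> {(tgt a, src a) |a. a \<in> arcs \<and> x a > 0}"

lemma net_update:
  assumes "a \<in> arcs"
  shows "net (x(a := x a + \<delta>)) v = net x v + \<delta> * (of_bool (tgt a = v) - of_bool (src a = v))"
proof -
  have upd: "(\<Sum>b | b \<in> arcs \<and> f b = v. (x(a := x a + \<delta>)) b) =
    (\<Sum>b | b \<in> arcs \<and> f b = v. x b) + \<delta> * of_bool (f a = v)" for f :: "'a \<Rightarrow> 'n"
  proof -
    have "(\<Sum>b | b \<in> arcs \<and> f b = v. (x(a := x a + \<delta>)) b) =
      (\<Sum>b | b \<in> arcs \<and> f b = v. x b + (if b = a then \<delta> else 0))"
      by (rule sum.cong) auto
    also have "\<dots> = (\<Sum>b | b \<in> arcs \<and> f b = v. x b) +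
        (\<Sum>b | b \<in> arcs \<and> f b = v. if b = a then \<delta> else 0)"
      by (rule sum.distrib)
    also have "(\<Sum>b | b \<in> arcs \<and> f b = v. if b = a then \<delta> else 0) = \<delta> * of_bool (f a = v)"
      using assms finite_arcs by simp
    finally show ?thesis .
  qed
  show ?thesis unfolding net_def upd by (simp add: algebra_simps)
qed

text \<open>One unit is pushed along a path. The middle clause carries the induction: the flow built
  for the rest of the path still agrees with \<open>x\<close> on arcs at the new first node, so a
  backward arc there can be lowered.\<close>

lemma augment:
  assumes "\<And>a. 0 \<le> x a" "zs \<noteq> []" "distinct zs" "successively (\<lambda>u v. (u, v) \<in> residual x) zs"
  shows "\<exists>x'. (\<forall>a. 0 \<le> x' a) \<and> (\<forall>a. src a \<notin> set zs \<or> tgt a \<notin> set zs \<longrightarrow> x' a = x a) \<and>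
    (\<forall>v. net x' v = net x v - of_bool (v = hd zs) + of_bool (v = last zs))"
  using assms(2-4)
proof (induction zs)
  case (Cons z zs)
  show ?case
  proof (cases "zs = []")
    case True
    then show ?thesis using assms(1) by (intro exI[of _ x]) simp
  next
    case False
    then obtain z1 where z1: "hd zs = z1" "z1 \<in> set zs" by simp
    from False Cons.prems Cons.IH obtain x1 where x1: "\<And>a. 0 \<le> x1 a"
      "\<And>a. src a \<notin> set zs \<or> tgt a \<notin> set zs \<Longrightarrow> x1 a = x a"
      "\<And>v. net x1 v = net x v - of_bool (v = hd zs) + of_bool (v = last zs)"
      by (auto simp: successively_Cons)
    have z: "z \<notin> set zs" using Cons.prems by simp
    have "(z, z1) \<in> residual x" using Cons.prems False z1 by (simp add: successively_Cons)
    then obtain a \<delta> where a: "a \<in> arcs" "src a = z \<or> tgt a = z" "src a \<in> {z, z1}" "tgt a \<in> {z, z1}"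
      "0 \<le> x a + \<delta>" "\<And>v. \<delta> * (of_bool (tgt a = v) - of_bool (src a = v)) = of_bool (v = z1) - of_bool (v = z)"
    proof (unfold residual_def, elim UnE CollectE exE conjE)
      fix a assume "(z, z1) = (src a, tgt a)" "a \<in> arcs"
      then show thesis using that[of a 1] assms(1)[of a] by (auto simp: eq_commute)
    next
      fix a assume "(z, z1) = (tgt a, src a)" "a \<in> arcs" "x a > 0"
      then show thesis using that[of a "-1"] by (auto simp: eq_commute)
    qed
    have xa: "x1 a = x a" using x1(2)[of a] a(2) z by blast
    show ?thesis
    proof (intro exI conjI allI impI)
      show "0 \<le> (x1(a := x1 a + \<delta>)) b" for b using x1(1)[of b] a(5) xa by simp
      show "net (x1(a := x1 a + \<delta>)) v = net x v - of_bool (v = hd (z # zs)) + of_bool (v = last (z # zs))" for v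
        using net_update[OF a(1), of x1 \<delta> v] a(6)[of v] x1(3)[of v] z1(1) False by simp
      fix b assume "src b \<notin> set (z # zs) \<or> tgt b \<notin> set (z # zs)"
      moreover from this have "b \<noteq> a" using a(3,4) z1(2) by auto
      ultimately show "(x1(a := x1 a + \<delta>)) b = x b" using x1(2)[of b] by auto
    qed
  qed
qed simp

text \<open>A flow minimizing the total imbalance has no augmenting path, so the nodes that can
  reach a deficient node violate the cut condition.\<close>

lemma integer_flow:
  fixes dem :: "'n \<Rightarrow> int"
  assumes N: "finite N" "src ` arcs \<subseteq> N" "tgt ` arcs \<subseteq> N" and total: "(\<Sum>v\<in>N. dem v) = 0"
    and cut: "\<And>Y. Y \<subseteq> N \<Longrightarrow> (\<And>a. a \<in> arcs \<Longrightarrow> tgt a \<in> Y \<Longrightarrow> src a \<in> Y) \<Longrightarrow> (\<Sum>v\<in>Y. dem v) \<le> 0"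
  obtains x where "\<And>a. 0 \<le> x a" "\<And>v. v \<in> N \<Longrightarrow> net x v = dem v"
proof -
  have sum_net: "(\<Sum>v\<in>Y. net x v) = (\<Sum>a\<in>arcs. x a * (of_bool (tgt a \<in> Y) - of_bool (src a \<in> Y)))"
    if Y: "Y \<subseteq> N" for x Y
  proof -
    have finY: "finite Y" using Y N(1) finite_subset by blast
    have "(\<Sum>v\<in>Y. \<Sum>a | a \<in> arcs \<and> f a = v. x a) = (\<Sum>a\<in>arcs. x a * of_bool (f a \<in> Y))" for f
    proof -
      have "(\<Sum>v\<in>Y. \<Sum>a | a \<in> arcs \<and> f a = v. x a) =
        (\<Sum>v\<in>Y. \<Sum>a\<in>arcs. if f a = v then x a else 0)"
        using finite_arcs by (simp add: sum.inter_filter)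
      also have "\<dots> = (\<Sum>a\<in>arcs. \<Sum>v\<in>Y. if f a = v then x a else 0)" by (rule sum.swap)
      also have "\<dots> = (\<Sum>a\<in>arcs. x a * of_bool (f a \<in> Y))"
        by (rule sum.cong) (use finY in auto)
      finally show ?thesis .
    qed
    then show ?thesis by (simp add: net_def sum_subtractf algebra_simps)
  qed
  define e where "e x v = net x v - dem v" for x v
  let ?cost = "\<lambda>x. nat (\<Sum>v\<in>N. \<bar>e x v\<bar>)"
  obtain x where x0: "\<forall>a. 0 \<le> x a" and least: "\<And>y. \<forall>a. 0 \<le> y a \<Longrightarrow> ?cost x \<le> ?cost y"
    using ex_has_least_nat[of "\<lambda>x. \<forall>a. 0 \<le> x a" "\<lambda>_. 0" ?cost] by auto
  have "e x v = 0" if "v \<in> N" for v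
  proof (rule ccontr)
    assume "e x v \<noteq> 0"
    have "(\<Sum>v\<in>N. e x v) = 0"
    proof -
      have "(\<Sum>v\<in>N. net x v) = 0" unfolding sum_net[OF order_refl]
        by (rule sum.neutral) (use N(2,3) in auto)
      then show ?thesis using total by (simp add: e_def sum_subtractf)
    qed
    have "\<exists>y\<in>N. e x y < 0"
    proof (rule ccontr)
      assume "\<not> ?thesis"
      then have "\<forall>y\<in>N. e x y = 0" using sum_nonneg_eq_0_iff[OF N(1), of "e x"] \<open>(\<Sum>v\<in>N. e x v) = 0\<close>
        by (simp add: not_less)
      then show False using \<open>v \<in> N\<close> \<open>e x v \<noteq> 0\<close> by blast
    qed
    then obtain y where y: "y \<in> N" "e x y < 0" by blast
    define Y where "Y = {z \<in> N. (z, y) \<in> (residual x)\<^sup>*}"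
    have YN: "Y \<subseteq> N" by (auto simp: Y_def)
    have finY: "finite Y" using YN N(1) finite_subset by blast
    have pre: "src a \<in> Y" if "a \<in> arcs" "tgt a \<in> Y" for a
    proof -
      have "(src a, tgt a) \<in> residual x" using that by (auto simp: residual_def)
      then show ?thesis using that N(2) by (auto simp: Y_def intro: converse_rtrancl_into_rtrancl)
    qed
    have forth: "tgt a \<in> Y" if "a \<in> arcs" "src a \<in> Y" "x a > 0" for a
    proof -
      have "(tgt a, src a) \<in> residual x" using that by (auto simp: residual_def)
      then show ?thesis using that N(3) by (auto simp: Y_def intro: converse_rtrancl_into_rtrancl)
    qed
    have nopos: "e x z \<le> 0" if z: "z \<in> Y" for z
    proof (rule ccontr)
      assume pos: "\<not> e x z \<le> 0"
      obtain zs where zs: "zs \<noteq> []" "hd zs = z" "last zs = y" "distinct zs"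
        "successively (\<lambda>u v. (u, v) \<in> residual x) zs"
        using rtrancl_distinct_path[of z y "residual x"] z by (auto simp: Y_def)
      obtain x' where x': "\<forall>a. 0 \<le> x' a"
        "\<And>v. net x' v = net x v - of_bool (v = z) + of_bool (v = y)"
        using augment[of x zs] x0 zs by auto
      have zN: "z \<in> N" "z \<noteq> y" using z YN pos y(2) by auto
      have "(\<Sum>v\<in>N. \<bar>e x' v\<bar>) < (\<Sum>v\<in>N. \<bar>e x v\<bar>)"
      proof (rule sum_strict_mono_ex1[OF N(1)])
        show "\<forall>v\<in>N. \<bar>e x' v\<bar> \<le> \<bar>e x v\<bar>"
          using x'(2) pos y(2) by (auto simp: e_def)
        show "\<exists>v\<in>N. \<bar>e x' v\<bar> < \<bar>e x v\<bar>"
          using x'(2)[of z] pos zN by (intro bexI[of _ z]) (auto simp: e_def)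
      qed
      moreover have "0 \<le> (\<Sum>v\<in>N. \<bar>e x' v\<bar>)" by (simp add: sum_nonneg)
      ultimately show False using least[OF x'(1)] by linarith
    qed
    have "(\<Sum>z\<in>Y. e x z) < 0"
    proof -
      have "y \<in> Y" using y by (simp add: Y_def)
      then have "(\<Sum>z\<in>Y. e x z) = e x y + (\<Sum>z\<in>Y - {y}. e x z)" by (rule sum.remove[OF finY])
      moreover have "(\<Sum>z\<in>Y - {y}. e x z) \<le> 0" by (rule sum_nonpos) (use nopos in blast)
      ultimately show ?thesis using y(2) by linarith
    qed
    \<comment> \<open>An arc carrying flow has both ends in \<open>Y\<close> or neither:
      \<open>pre\<close> excludes arcs entering \<open>Y\<close>, and \<open>forth\<close> those
      that leave it with positive flow.\<close>
    moreover have "(\<Sum>z\<in>Y. net x z) = 0" unfolding sum_net[OF YN]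
    proof (rule sum.neutral, rule ballI)
      fix a assume a: "a \<in> arcs"
      show "x a * (of_bool (tgt a \<in> Y) - of_bool (src a \<in> Y)) = 0"
        using pre[OF a] forth[OF a] x0[rule_format, of a] by (cases "x a = 0") auto
    qed
    moreover have "(\<Sum>z\<in>Y. dem z) \<le> 0" by (rule cut[OF YN pre])
    ultimately show False by (simp add: e_def sum_subtractf)
  qed
  then show thesis using that[of x] x0 by (simp add: e_def)
qed

end

section \<open>Existence of terminal flows\<close>

context rooted_plane
begin

text \<open>An indecomposable region has Euler characteristic at most 1, and its boundary contains a
  simple cycle, of length at least \<open>d\<close>. Any other region splits into two with no edge
  of \<open>A\<close> between them, and the two inequalities add up.\<close>

lemma hall_region:
  assumes girth: "\<And>C. simple_cycle M C \<Longrightarrow> card root \<le> length C"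
  shows "\<lbrakk>W \<subseteq> H; \<phi> ` W \<subseteq> W; W \<inter> root = {}; A \<subseteq> W; \<alpha> ` A \<subseteq> A; B \<subseteq> A; \<sigma> ` B \<subseteq> B\<rbrakk> \<Longrightarrow>
    2 * d * (int (card (V ` B)) + int (card (F ` W))) \<le> d * int (card A) + 2 * int (card (W - A))"
proof (induction "card W" arbitrary: W A B rule: less_induct)
  case less
  note W = less.prems(1-3) and A = less.prems(4,5) and B = less.prems(6,7)
  have fin: "finite W" "finite A" "finite B"
    using W(1) A(1) B(1) finite_subset_H by auto
  show ?case
  proof (cases "W = {}")
    case True
    then show ?thesis using A B by simp
  next
    case False
    show ?thesis
    proof (cases "\<forall>X. X \<subset> W \<longrightarrow> X \<noteq> {} \<longrightarrow> \<phi> ` X \<subseteq> X \<longrightarrow> (\<exists>h\<in>A. h \<in> X \<and> \<alpha> h \<notin> X)")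
      case True
      have WH: "W \<noteq> H" using W(3) root_sub_H root_nonempty by blast
      then have "B \<noteq> H" using A B W(1) by blast
      then have chi: "2 * card (V ` B) + 2 * card (F ` W) \<le> card A + 2"
        using region_euler[OF W(1) False W(2) A B] True by blast
      obtain C where C: "simple_cycle M C" "set C \<subseteq> {h \<in> W. \<alpha> h \<notin> W}"
        using region_boundary_cycle[OF W(1) False WH W(2)] by metis
      have "set C \<subseteq> W - A"
      proof
        fix h assume "h \<in> set C"
        then have "h \<in> W" "\<alpha> h \<notin> W" using C(2) by auto
        then show "h \<in> W - A" using A by blast
      qed
      then have "card (set C) \<le> card (W - A)" using fin by (intro card_mono) simp
      then have "d \<le> int (card (W - A))"
        using girth[OF C(1)] simple_cycle_props(5)[OF C(1)] by simp
      moreover have "2 * (int (card (V ` B)) + int (card (F ` W))) \<le> int (card A) + 2"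
        using of_nat_mono[OF chi, where 'a = int] by simp
      then have "d * (2 * (int (card (V ` B)) + int (card (F ` W)))) \<le> d * (int (card A) + 2)"
        by (rule mult_left_mono) simp
      ultimately show ?thesis by (simp add: algebra_simps)
    next
      case False
      then obtain X where X: "X \<subset> W" "X \<noteq> {}" "\<phi> ` X \<subseteq> X" "\<And>h. h \<in> A \<Longrightarrow> h \<in> X \<Longrightarrow> \<alpha> h \<in> X"
        by blast
      have XH: "X \<subseteq> H" using X(1) W(1) by blast
      have \<phi>X: "\<phi> h \<in> X \<longleftrightarrow> h \<in> X" for h using invariant_iff(2)[OF XH X(3)] .
      have \<alpha>X: "\<alpha> h \<in> X \<longleftrightarrow> h \<in> X" if "h \<in> A" for h
      proof -
        have "\<alpha> h \<in> A" using that A(2) by blast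
        then show ?thesis using X(4)[OF that] X(4)[of "\<alpha> h"] by auto
      qed
      have split: "2 * d * (int (card (V ` (B \<inter> Y))) + int (card (F ` Y))) \<le>
          d * int (card (A \<inter> Y)) + 2 * int (card (Y - A \<inter> Y))"
        if Y: "Y = X \<or> Y = W - X" for Y
      proof (rule less.hyps)
        have Y\<phi>: "\<phi> h \<in> Y" if "h \<in> Y" for h using that Y \<phi>X W(2) by auto
        have Y\<alpha>: "\<alpha> h \<in> Y \<longleftrightarrow> h \<in> Y" if "h \<in> A" for h
        proof -
          have "\<alpha> h \<in> W" "h \<in> W" using that A by blast+
          then show ?thesis using \<alpha>X[OF that] Y by blast
        qed
        have "Y \<subset> W" using X(1,2) Y by blast
        then show "card Y < card W" using fin(1) by (rule psubset_card_mono[rotated])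
        show "Y \<subseteq> H" "Y \<inter> root = {}" using W(1,3) X(1) Y by blast+
        show "\<phi> ` Y \<subseteq> Y" using Y\<phi> by blast
        show "A \<inter> Y \<subseteq> Y" "B \<inter> Y \<subseteq> A \<inter> Y" using B(1) by blast+
        show "\<alpha> ` (A \<inter> Y) \<subseteq> A \<inter> Y" using A(2) Y\<alpha> by blast
        show "\<sigma> ` (B \<inter> Y) \<subseteq> B \<inter> Y"
        proof
          fix z assume "z \<in> \<sigma> ` (B \<inter> Y)"
          then obtain h where h: "h \<in> B" "h \<in> Y" "z = \<sigma> h" by blast
          then have "\<alpha> h \<in> Y" using Y\<alpha> B(1) by blast
          then have "\<phi> (\<alpha> h) \<in> Y" by (rule Y\<phi>)
          then show "z \<in> B \<inter> Y" using h B(2) by auto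
        qed
      qed
      have cV: "card (V ` B) \<le> card (V ` (B \<inter> X)) + card (V ` (B \<inter> (W - X)))"
      proof -
        have "V ` B = V ` (B \<inter> X) \<union> V ` (B \<inter> (W - X))" using A B by blast
        then show ?thesis using card_Un_le[of "V ` (B \<inter> X)" "V ` (B \<inter> (W - X))"] by simp
      qed
      have cF: "card (F ` W) \<le> card (F ` X) + card (F ` (W - X))"
      proof -
        have "F ` W = F ` X \<union> F ` (W - X)" using X(1) by blast
        then show ?thesis using card_Un_le[of "F ` X" "F ` (W - X)"] by simp
      qed
      have cA: "card A = card (A \<inter> X) + card (A \<inter> (W - X))"
      proof -
        have "A = (A \<inter> X) \<union> (A \<inter> (W - X))" using A(1) by blast
        then show ?thesis using fin by (subst card_Un_disjoint[symmetric]) auto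
      qed
      have cW: "card (W - A) = card (X - A \<inter> X) + card (W - X - A \<inter> (W - X))"
      proof -
        have "W - A = (X - A \<inter> X) \<union> (W - X - A \<inter> (W - X))" using X(1) by blast
        moreover have "finite X" using XH by (rule finite_subset_H)
        ultimately show ?thesis using fin by (subst card_Un_disjoint[symmetric]) auto
      qed
      have "int (card (V ` B)) + int (card (F ` W)) \<le>
          (int (card (V ` (B \<inter> X))) + int (card (F ` X))) +
          (int (card (V ` (B \<inter> (W - X)))) + int (card (F ` (W - X))))"
        using cV cF by linarith
      then have "2 * d * (int (card (V ` B)) + int (card (F ` W))) \<le>
          2 * d * ((int (card (V ` (B \<inter> X))) + int (card (F ` X))) +
          (int (card (V ` (B \<inter> (W - X)))) + int (card (F ` (W - X)))))"
        by (rule mult_left_mono) simp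
      then show ?thesis using split[of X] split[of "W - X"] cA cW
        by (simp add: algebra_simps)
    qed
  qed
qed

text \<open>In the network each half-edge gives an arc from its face to its edge, carrying
  \<open>n\<close>, and one from its edge to its vertex, carrying \<open>p\<close>. Node sets closed
  under predecessors are the regions of \<open>hall_region\<close>, which is therefore the cut
  condition.\<close>

lemma flow_exists:
  assumes girth: "\<And>C. simple_cycle M C \<Longrightarrow> card root \<le> length C"
  obtains p n where "flow p n"
proof -
  define arcs :: "('h + 'h) set" where "arcs = Inl ` (H - Out) \<union> Inr ` (H - Z)"
  define src :: "'h + 'h \<Rightarrow> 'h set + 'h set + 'h set" where
    "src = case_sum (\<lambda>h. Inr (Inr (F h))) (\<lambda>h. Inr (Inl (E h)))"
  define tgt :: "'h + 'h \<Rightarrow> 'h set + 'h set + 'h set" where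
    "tgt = case_sum (\<lambda>h. Inr (Inl (E h))) (\<lambda>h. Inl (V h))"
  \<comment> \<open>Inflow minus outflow: \<open>d\<close> units end at each vertex, an edge sends
    \<open>d - 2\<close> more than it receives, and a face sends the excess of its degree over
    \<open>d\<close>.\<close>
  define dem :: "'h set + 'h set + 'h set \<Rightarrow> int" where
    "dem = case_sum (\<lambda>v. d) (case_sum (\<lambda>e. 2 - d) (\<lambda>f. d - int (card f)))"
  define nodes where "nodes B A W = Inl ` V ` B \<union> (Inr ` Inl ` E ` A \<union> Inr ` Inr ` F ` W)" for B A W
  have [simp]: "src (Inl h) = Inr (Inr (F h))" "src (Inr h) = Inr (Inl (E h))"
    "tgt (Inl h) = Inr (Inl (E h))" "tgt (Inr h) = Inl (V h)" for h
    by (simp_all add: src_def tgt_def)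
  have nodesI: "h \<in> B \<Longrightarrow> Inl (V h) \<in> nodes B A W" "h \<in> A \<Longrightarrow> Inr (Inl (E h)) \<in> nodes B A W"
    "h \<in> W \<Longrightarrow> Inr (Inr (F h)) \<in> nodes B A W" for h B A W
    by (auto simp: nodes_def)
  have HZ: "H - Z \<subseteq> H - Out" using Out_sub_Z by blast
  interpret network arcs src tgt
    by unfold_locales (simp add: arcs_def)
  \<comment> \<open>Doubled because \<open>A\<close> contains two half-edges for every edge.\<close>
  have sum_dem: "2 * (\<Sum>y\<in>nodes B A W. dem y) =
      2 * d * (int (card (V ` B)) + int (card (F ` W))) - (d - 2) * int (card A) - 2 * int (card W)"
    if B: "B \<subseteq> H" and A: "A \<subseteq> H" "\<alpha> ` A \<subseteq> A" and W: "W \<subseteq> H" "\<phi> ` W \<subseteq> W" for B A W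
  proof -
    have fin: "finite B" "finite A" "finite W" using B A W finite_subset_H by auto
    have "(\<Sum>y\<in>nodes B A W. dem y) = (\<Sum>y\<in>Inl ` V ` B. dem y) +
        ((\<Sum>y\<in>Inr ` Inl ` E ` A. dem y) + (\<Sum>y\<in>Inr ` Inr ` F ` W. dem y))"
    proof -
      have "(Inr ` Inl ` E ` A) \<inter> (Inr ` Inr ` F ` W :: ('h set + 'h set + 'h set) set) = {}"
        "Inl ` V ` B \<inter> (Inr ` Inl ` E ` A \<union> Inr ` Inr ` F ` W :: ('h set + 'h set + 'h set) set) = {}"
        by auto
      then show ?thesis unfolding nodes_def using fin
        by (subst sum.union_disjoint; simp)+
    qed
    moreover have "(\<Sum>y\<in>Inl ` V ` B. dem y) = d * int (card (V ` B))"
      by (simp add: sum.reindex dem_def)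
    moreover have "(\<Sum>y\<in>Inr ` Inl ` E ` A. dem y) = (2 - d) * int (card (E ` A))"
      by (simp add: sum.reindex dem_def)
    moreover have "(\<Sum>y\<in>Inr ` Inr ` F ` W. dem y) = d * int (card (F ` W)) - int (card W)"
    proof -
      have "int (card W) = (\<Sum>f\<in>F ` W. int (card f))"
        using sum_faces[OF W, of "\<lambda>_. 1::int"] by simp
      then show ?thesis by (simp add: sum.reindex dem_def sum_subtractf algebra_simps)
    qed
    ultimately show ?thesis using card_edges[OF A] by (simp add: algebra_simps)
  qed
  let ?N = "nodes (H - Z) (H - Out) (H - root)"
  have inv: "\<sigma> ` (H - Z) \<subseteq> H - Z" "\<alpha> ` (H - Out) \<subseteq> H - Out" "\<phi> ` (H - root) \<subseteq> H - root"
    using invariant_iff(1)[OF Z_sub_H Z_\<sigma>] invariant_iff(2)[OF root_sub_H root_\<phi>] by auto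
  have root_Out: "root \<subseteq> Out" by (auto simp: Out_def)
  obtain x where x: "\<And>a. 0 \<le> x a" "\<And>v. v \<in> ?N \<Longrightarrow> net x v = dem v"
  proof (rule integer_flow[of ?N dem])
    show "finite ?N" by (simp add: nodes_def)
    have "Inr (Inr (F h)) \<in> ?N" if "h \<in> H - Out" for h
      by (rule nodesI) (use that root_Out in blast)
    moreover have "Inr (Inl (E h)) \<in> ?N" if "h \<in> H - Z" for h
      by (rule nodesI) (use that HZ in blast)
    ultimately show "src ` arcs \<subseteq> ?N" by (auto simp: arcs_def)
    show "tgt ` arcs \<subseteq> ?N" by (auto simp: arcs_def intro: nodesI)
    \<comment> \<open>Global balance is Euler's formula after removal of the root face, its
      \<open>d\<close> vertices and its \<open>d\<close> edges.\<close>
    show "(\<Sum>v\<in>?N. dem v) = 0"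
    proof -
      have "V ` (H - Z) = V ` H - V ` Z" using V_mem_Z by auto
      then have cV: "int (card (V ` (H - Z))) = int (card (V ` H)) - d"
        using card_Diff_subset[of "V ` Z" "V ` H"] card_mono[of "V ` H" "V ` Z"] Z_sub_H
          finite_subset_H[OF Z_sub_H] card_V_Z by (simp add: image_mono)
      have "F ` (H - root) = F ` H - {root}" using mem_root_iff by auto
      moreover have "root \<in> F ` H" by (metis root_face_obtain imageI)
      moreover from this have "card (F ` H) > 0" by (auto simp: card_gt_0_iff)
      ultimately have cF: "int (card (F ` (H - root))) = int (card (F ` H)) - 1" by simp
      have c: "int (card (H - Out)) = int (card H) - 2 * d" "int (card (H - root)) = int (card H) - d"
        using int_card_Diff[OF order_refl Out_sub_H] int_card_Diff[OF order_refl root_sub_H] card_Out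
        by simp_all
      have "2 * (int (card (V ` H)) + int (card (F ` H))) = int (card H) + 4"
        using arg_cong[OF euler, of int] by simp
      then have eu: "d * (2 * (int (card (V ` H)) + int (card (F ` H)))) = d * (int (card H) + 4)" by simp
      have "2 * (\<Sum>v\<in>?N. dem v) = 0"
        unfolding sum_dem[OF Diff_subset Diff_subset inv(2) Diff_subset inv(3)] cV cF c
        using eu by (simp add: algebra_simps)
      then show ?thesis by simp
    qed
    fix Y assume Y: "Y \<subseteq> ?N" "\<And>a. a \<in> arcs \<Longrightarrow> tgt a \<in> Y \<Longrightarrow> src a \<in> Y"
    define B where "B = {h \<in> H - Z. Inl (V h) \<in> Y}"
    define A where "A = {h \<in> H - Out. Inr (Inl (E h)) \<in> Y}"
    define W where "W = {h \<in> H - root. Inr (Inr (F h)) \<in> Y}"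
    have BA: "B \<subseteq> A"
    proof
      fix h assume h: "h \<in> B"
      then have "Inr h \<in> arcs" "tgt (Inr h) \<in> Y" by (auto simp: B_def arcs_def)
      then have "src (Inr h) \<in> Y" by (rule Y(2))
      then show "h \<in> A" using h HZ by (auto simp: A_def B_def)
    qed
    have AW: "A \<subseteq> W"
    proof
      fix h assume h: "h \<in> A"
      then have "Inl h \<in> arcs" "tgt (Inl h) \<in> Y" by (auto simp: A_def arcs_def)
      then have "src (Inl h) \<in> Y" by (rule Y(2))
      then show "h \<in> W" using h root_Out by (auto simp: A_def W_def)
    qed
    have sub: "W \<subseteq> H" "A \<subseteq> H" "B \<subseteq> H" by (auto simp: A_def B_def W_def)
    have Ysub: "Y = nodes B A W"
      using Y(1) by (auto simp: nodes_def A_def B_def W_def)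
    have W\<phi>: "\<phi> ` W \<subseteq> W" using inv(3) by (auto simp: W_def)
    have "E (\<alpha> h) = E h" for h by (simp add: E_eq_iff)
    then have A\<alpha>: "\<alpha> ` A \<subseteq> A" by (auto simp: A_def)
    have B\<sigma>: "\<sigma> ` B \<subseteq> B" using inv(1) by (auto simp: B_def)
    have "2 * d * (int (card (V ` B)) + int (card (F ` W))) \<le> d * int (card A) + 2 * int (card (W - A))"
      using hall_region[OF girth, of W A B] sub W\<phi> AW A\<alpha> BA B\<sigma> by (auto simp: W_def)
    moreover have "int (card (W - A)) = int (card W) - int (card A)"
      using sub(1) AW by (rule int_card_Diff)
    ultimately have "2 * (\<Sum>v\<in>Y. dem v) \<le> 0"
      unfolding Ysub sum_dem[OF sub(3,2) A\<alpha> sub(1) W\<phi>] by (simp add: algebra_simps)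
    then show "(\<Sum>v\<in>Y. dem v) \<le> 0" by simp
  qed blast
  \<comment> \<open>The network has only inner arcs; elsewhere the values prescribed by
    \<open>flow\<close> are filled in.\<close>
  define p where "p h = (if h \<in> H - Z then x (Inr h) else of_bool (h \<in> root))" for h
  define n where "n h = (if h \<in> H - Out then x (Inl h) else 0)" for h
  have "balanced p n"
    unfolding balanced_def
  proof (intro conjI ballI)
    fix h assume h: "h \<in> H"
    show "0 \<le> p h" "0 \<le> n h" using x(1) by (simp_all add: p_def n_def)
  next
    fix h assume h: "h \<in> H - Out"
    have ah: "\<alpha> h \<in> H - Out" "\<alpha> h \<noteq> h" using h \<alpha>_neq by auto
    have "Inr (Inl (E h)) \<in> ?N" using h by (rule nodesI)
    then have "net x (Inr (Inl (E h))) = 2 - d" using x(2) by (simp add: dem_def)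
    moreover have "{a \<in> arcs. tgt a = Inr (Inl (E h))} = Inl ` {h, \<alpha> h}"
      using h ah by (auto simp: arcs_def E_eq_iff)
    moreover have "{a \<in> arcs. src a = Inr (Inl (E h))} = Inr ` ({h, \<alpha> h} \<inter> (H - Z))"
      by (auto simp: arcs_def E_eq_iff)
    moreover have "(\<Sum>a\<in>Inl ` {h, \<alpha> h}. x a) = n h + n (\<alpha> h)"
      using h ah by (simp add: n_def)
    moreover have "(\<Sum>a\<in>Inr ` ({h, \<alpha> h} \<inter> (H - Z)). x a) = p h + p (\<alpha> h)"
    proof -
      have "(\<Sum>a\<in>Inr ` ({h, \<alpha> h} \<inter> (H - Z)). x a) = (\<Sum>k\<in>{h, \<alpha> h} \<inter> (H - Z). p k)"
        by (simp add: sum.reindex p_def)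
      also have "\<dots> = (\<Sum>k\<in>{h, \<alpha> h}. p k)"
        by (rule sum.mono_neutral_left) (use h ah root_Out in \<open>auto simp: p_def\<close>)
      finally show ?thesis using ah by simp
    qed
    ultimately show "p h - n h + (p (\<alpha> h) - n (\<alpha> h)) = d - 2" by (simp add: net_def)
  next
    fix h assume h: "h \<in> H - Z"
    have sub: "V h \<subseteq> H - Z" using V_subset[OF inv(1) h] .
    have "Inl (V h) \<in> ?N" using h by (rule nodesI)
    then have "net x (Inl (V h)) = d" using x(2) by (simp add: dem_def)
    moreover have "{a \<in> arcs. tgt a = Inl (V h)} = Inr ` V h"
      using sub by (auto simp: arcs_def mem_V_iff)
    moreover have "{a \<in> arcs. src a = Inl (V h)} = {}" by (auto simp: arcs_def)
    moreover have "(\<Sum>a\<in>Inr ` V h. x a) = (\<Sum>k\<in>V h. p k)"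
      using sub by (simp add: sum.reindex p_def subset_iff)
    ultimately show "(\<Sum>k\<in>V h. p k) = d" by (simp add: net_def)
  next
    fix h assume h: "h \<in> H - root"
    have sub: "F h \<subseteq> H - root" using F_subset[OF inv(3) h] .
    have "Inr (Inr (F h)) \<in> ?N" using h by (rule nodesI)
    then have "net x (Inr (Inr (F h))) = d - int (card (F h))" using x(2) by (simp add: dem_def)
    moreover have "{a \<in> arcs. src a = Inr (Inr (F h))} = Inl ` (F h \<inter> (H - Out))"
      using sub by (auto simp: arcs_def mem_F_iff)
    moreover have "{a \<in> arcs. tgt a = Inr (Inr (F h))} = {}" by (auto simp: arcs_def)
    moreover have "(\<Sum>a\<in>Inl ` (F h \<inter> (H - Out)). x a) = (\<Sum>k\<in>F h. n k)"
    proof -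
      have "(\<Sum>a\<in>Inl ` (F h \<inter> (H - Out)). x a) = (\<Sum>k\<in>F h \<inter> (H - Out). n k)"
        by (simp add: sum.reindex n_def)
      also have "\<dots> = (\<Sum>k\<in>F h. n k)"
        by (rule sum.mono_neutral_left) (use sub in \<open>auto simp: n_def intro: finite_subset_H\<close>)
      finally show ?thesis .
    qed
    ultimately show "(\<Sum>k\<in>F h. n k) = int (card (F h)) - d" by (simp add: net_def)
  qed
  moreover have "p h = 1 \<and> p (\<alpha> h) = 0 \<and> n h = 0 \<and> n (\<alpha> h) = 0" if h: "h \<in> root" for h
  proof -
    have "h \<in> Out" "\<alpha> h \<in> Out" using h root_Out by auto
    moreover from this have "h \<in> Z" "\<alpha> h \<in> Z" using Out_sub_Z by blast+
    ultimately show ?thesis using h root_sides[OF h] by (simp add: p_def n_def)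
  qed
  moreover have "p h = 0" if "h \<in> Z - Out" for h using that root_Out by (auto simp: p_def)
  ultimately have "flow p n" by (simp add: flow_def)
  then show thesis by (rule that)
qed

text \<open>The increments cancel on each edge because
  \<open>\<phi> h = \<sigma> (\<alpha> h)\<close> and
  \<open>\<phi> (\<alpha> h) = \<sigma> h\<close>, and they telescope around vertices and faces.
  Vanishing on \<open>Z\<close> preserves the values at the outer vertices and on the outer
  edges.\<close>

lemma flow_shift:
  assumes flow: "flow p n"
    and nonneg: "\<And>h. h \<in> H \<Longrightarrow> 0 \<le> p h + (\<pi> (\<sigma> h) - \<pi> h)" "\<And>h. h \<in> H \<Longrightarrow> 0 \<le> n h + (\<pi> (\<phi> h) - \<pi> h)"
    and zero: "\<And>h. h \<in> Z \<Longrightarrow> \<pi> h = 0"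
  shows "flow (\<lambda>h. p h + (\<pi> (\<sigma> h) - \<pi> h)) (\<lambda>h. n h + (\<pi> (\<phi> h) - \<pi> h))"
proof -
  note b = balancedD[OF flowD(1)[OF flow]]
  have Z\<sigma>0: "\<pi> (\<sigma> h) = 0" if "h \<in> Z" for h using zero[of "\<sigma> h"] Z_\<sigma> that by blast
  have Out0: "\<pi> h = 0" "\<pi> (\<sigma> h) = 0" "\<pi> (\<phi> h) = 0" if h: "h \<in> Out" for h
  proof -
    have "h \<in> Z" "\<alpha> h \<in> Z" using h Out_sub_Z Out_\<alpha> by auto
    then show "\<pi> h = 0" "\<pi> (\<sigma> h) = 0" "\<pi> (\<phi> h) = 0"
      using zero Z\<sigma>0[of h] Z\<sigma>0[of "\<alpha> h"] by (simp_all add: \<phi>_def)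
  qed
  have "balanced (\<lambda>h. p h + (\<pi> (\<sigma> h) - \<pi> h)) (\<lambda>h. n h + (\<pi> (\<phi> h) - \<pi> h))"
    unfolding balanced_def
  proof (intro conjI ballI)
    fix h assume h: "h \<in> H"
    show "0 \<le> p h + (\<pi> (\<sigma> h) - \<pi> h)" "0 \<le> n h + (\<pi> (\<phi> h) - \<pi> h)" using nonneg h by auto
  next
    fix h assume h: "h \<in> H - Out"
    then show "p h + (\<pi> (\<sigma> h) - \<pi> h) - (n h + (\<pi> (\<phi> h) - \<pi> h)) +
        (p (\<alpha> h) + (\<pi> (\<sigma> (\<alpha> h)) - \<pi> (\<alpha> h)) - (n (\<alpha> h) + (\<pi> (\<phi> (\<alpha> h)) - \<pi> (\<alpha> h)))) = d - 2"
      using b(3)[of h] by (simp add: \<phi>_def)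
  next
    fix h assume "h \<in> H - Z"
    then show "(\<Sum>k\<in>V h. p k + (\<pi> (\<sigma> k) - \<pi> k)) = d"
      using b(4)[of h] by (simp add: sum.distrib sum_subtractf sum_V_shift)
  next
    fix h assume "h \<in> H - root"
    then show "(\<Sum>k\<in>F h. n k + (\<pi> (\<phi> k) - \<pi> k)) = int (card (F h)) - d"
      using b(5)[of h] by (simp add: sum.distrib sum_subtractf sum_F_shift)
  qed
  moreover have "h \<in> Out" "\<alpha> h \<in> Out" if "h \<in> root" for h using that by (auto simp: Out_def)
  ultimately show ?thesis
    using flowD(2-6)[OF flow] Out0 zero Z\<sigma>0 by (simp add: flow_def)
qed

lemma terminal_flow_exists:
  assumes girth: "\<And>C. simple_cycle M C \<Longrightarrow> card root \<le> length C"
  obtains p n where "flow p n" "terminal p n"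
proof -
  obtain p n where flow: "flow p n" using flow_exists[OF girth] .
  define P where "P \<pi> \<longleftrightarrow> (\<forall>h\<in>H. 0 \<le> p h + (\<pi> (\<sigma> h) - \<pi> h) \<and> 0 \<le> n h + (\<pi> (\<phi> h) - \<pi> h)) \<and>
    (\<forall>h\<in>Z. \<pi> h = 0)" for \<pi> :: "'h \<Rightarrow> int"
  \<comment> \<open>Where the admissible potentials have a common upper bound. A step lowers a
    potential by at most \<open>p h\<close> or \<open>n h\<close>, so boundedness travels backwards
    along steps, starting from \<open>Z\<close>; this makes the maximum below exist.\<close>
  define S where "S = {h \<in> H. \<exists>b. \<forall>\<pi>. P \<pi> \<longrightarrow> \<pi> h \<le> b}"
  have "H - S = {}"
  proof (rule ccontr)
    assume ne: "H - S \<noteq> {}"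
    have "H - S = H"
    proof (rule connected_steps[OF Diff_subset ne])
      have "h \<in> S" if h: "h \<in> H" "\<sigma> h \<in> S" for h
      proof -
        obtain b where "\<forall>\<pi>. P \<pi> \<longrightarrow> \<pi> (\<sigma> h) \<le> b" using h(2) by (auto simp: S_def)
        then have "\<forall>\<pi>. P \<pi> \<longrightarrow> \<pi> h \<le> b + p h" using h(1) unfolding P_def by force
        then show ?thesis using h(1) by (auto simp: S_def)
      qed
      then show "\<sigma> ` (H - S) \<subseteq> H - S" by auto
      have "h \<in> S" if h: "h \<in> H" "\<phi> h \<in> S" for h
      proof -
        obtain b where "\<forall>\<pi>. P \<pi> \<longrightarrow> \<pi> (\<phi> h) \<le> b" using h(2) by (auto simp: S_def)
        then have "\<forall>\<pi>. P \<pi> \<longrightarrow> \<pi> h \<le> b + n h" using h(1) unfolding P_def by force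
        then show ?thesis using h(1) by (auto simp: S_def)
      qed
      then show "\<phi> ` (H - S) \<subseteq> H - S" by auto
    qed
    moreover obtain h where h: "h \<in> Z" using root_sub_Z root_nonempty by blast
    then have "h \<in> S" using Z_sub_H by (auto simp: S_def P_def)
    ultimately show False using h Z_sub_H by blast
  qed
  then have "\<forall>h\<in>H. \<exists>b. \<forall>\<pi>. P \<pi> \<longrightarrow> \<pi> h \<le> b" by (auto simp: S_def)
  then obtain b where b: "\<And>h \<pi>. h \<in> H \<Longrightarrow> P \<pi> \<Longrightarrow> \<pi> h \<le> b h" by metis
  define K where "K = (\<Sum>h\<in>H. b h)"
  have K: "(\<Sum>h\<in>H. \<pi> h) \<le> K" if "P \<pi>" for \<pi>
    unfolding K_def by (rule sum_mono) (use b that in blast)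
  have "P (\<lambda>_. 0)" using balancedD(1,2)[OF flowD(1)[OF flow]] by (simp add: P_def)
  then obtain \<pi> where \<pi>: "P \<pi>"
    and least: "\<And>\<rho>. P \<rho> \<Longrightarrow> nat (K - (\<Sum>h\<in>H. \<pi> h)) \<le> nat (K - (\<Sum>h\<in>H. \<rho> h))"
    using ex_has_least_nat[of P "\<lambda>_. 0" "\<lambda>\<pi>. nat (K - (\<Sum>h\<in>H. \<pi> h))"] by blast
  let ?p = "\<lambda>h. p h + (\<pi> (\<sigma> h) - \<pi> h)" and ?n = "\<lambda>h. n h + (\<pi> (\<phi> h) - \<pi> h)"
  have nonneg: "0 \<le> ?p h" "0 \<le> ?n h" if "h \<in> H" for h using \<pi> that by (simp_all add: P_def)
  have f: "flow ?p ?n"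
    by (rule flow_shift[OF flow nonneg]) (use \<pi> in \<open>simp_all add: P_def\<close>)
  have "terminal ?p ?n"
    unfolding terminal_def
  proof (intro allI impI)
    fix T assume T: "step_closed ?p ?n T" "T \<inter> root = {}"
    have TH: "T \<subseteq> H" using T(1) by (simp add: step_closed_def)
    have TZ: "T \<inter> Z = {}" by (rule step_closed_Z[OF f T])
    \<comment> \<open>Raising the potential on \<open>T\<close> by 1 decreases only the parts on
      steps leaving \<open>T\<close>, and these are positive because \<open>T\<close> is
      step-closed.\<close>
    define \<rho> where "\<rho> h = \<pi> h + of_bool (h \<in> T)" for h
    have "P \<rho>"
      unfolding P_def
    proof (intro conjI ballI)
      fix h assume h: "h \<in> H"
      show "0 \<le> p h + (\<rho> (\<sigma> h) - \<rho> h)"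
        using nonneg(1)[OF h] T(1) by (cases "h \<in> T \<and> \<sigma> h \<notin> T") (auto simp: \<rho>_def step_closed_def)
      show "0 \<le> n h + (\<rho> (\<phi> h) - \<rho> h)"
        using nonneg(2)[OF h] T(1) by (cases "h \<in> T \<and> \<phi> h \<notin> T") (auto simp: \<rho>_def step_closed_def)
    next
      fix h assume "h \<in> Z"
      then show "\<rho> h = 0" using \<pi> TZ by (auto simp: \<rho>_def P_def)
    qed
    have "(\<Sum>h\<in>H. of_bool (h \<in> T)) = int (card T)"
      using TH by (simp add: of_bool_def sum.If_cases Int_absorb1)
    then have "(\<Sum>h\<in>H. \<rho> h) = (\<Sum>h\<in>H. \<pi> h) + int (card T)"
      by (simp add: \<rho>_def sum.distrib)
    \<comment> \<open>The truncation by \<open>nat\<close> does no harm, since \<open>K\<close>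
      bounds the total of \<open>\<rho>\<close> as well.\<close>
    then have "card T = 0" using least[OF \<open>P \<rho>\<close>] K[OF \<open>P \<rho>\<close>] by linarith
    then show "T = {}" using finite_subset_H[OF TH] by simp
  qed
  then show thesis using that f by blast
qed

end

section \<open>Orientations and flows\<close>

context plane
begin

lemma traversable_iff:
  assumes "h \<in> H"
  shows "traversable M B h \<longleftrightarrow> \<alpha> h \<in> ingoing B"
proof -
  have "\<alpha> h \<noteq> h" using assms by (rule \<alpha>_neq)
  then show ?thesis
    by (cases "h \<in> ingoing B"; cases "\<alpha> h \<in> ingoing B")
      (auto simp: traversable_def is_way_def edge_of_def Int_insert_left)
qed

lemma minimalD:
  assumes "minimal M B" "S \<subseteq> H" "\<phi> ` S \<subseteq> S" "S \<inter> root = {}"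
    "\<And>h. h \<in> H \<Longrightarrow> h \<notin> S \<Longrightarrow> \<alpha> h \<in> S \<Longrightarrow> traversable M B h"
  shows "S = {}"
  using assms by (simp add: minimal_iff)

lemma zbiorientationD:
  assumes "is_zbiorientation M B"
  shows "ingoing B = {h \<in> H. weight B h > 0}" "outgoing M B = {h \<in> H. weight B h \<le> 0}"
proof -
  have B: "ingoing B \<subseteq> H" "\<forall>h\<in>ingoing B. weight B h > 0" "\<forall>h\<in>outgoing M B. weight B h \<le> 0"
    using assms by (auto simp: is_zbiorientation_def)
  have "weight B h \<le> 0" if "h \<in> H" "h \<notin> ingoing B" for h
    using B(3) that unfolding outgoing_def by blast
  then have iff: "h \<in> ingoing B \<longleftrightarrow> weight B h > 0" if "h \<in> H" for h
    using B(2) that by (metis not_less)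
  show "ingoing B = {h \<in> H. weight B h > 0}" using B(1) iff by blast
  have "h \<in> outgoing M B \<longleftrightarrow> h \<in> H \<and> weight B h \<le> 0" for h
    using iff[of h] unfolding outgoing_def by (metis DiffD1 DiffD2 DiffI not_less)
  then show "outgoing M B = {h \<in> H. weight B h \<le> 0}" by blast
qed

lemma vertex_weight_eq:
  assumes "is_zbiorientation M B" "h \<in> H"
  shows "vertex_weight B (V h) = (\<Sum>k\<in>V h. max 0 (weight B k))"
proof -
  have sub: "V h \<subseteq> H" using assms(2) by (rule orbit_sub_H)
  have "vertex_weight B (V h) = (\<Sum>k\<in>V h \<inter> ingoing B. max 0 (weight B k))"
    unfolding vertex_weight_def by (rule sum.cong) (auto simp: zbiorientationD[OF assms(1)])
  also have "\<dots> = (\<Sum>k\<in>V h. max 0 (weight B k))"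
    by (rule sum.mono_neutral_left)
      (use sub finite_subset_H[OF sub] in \<open>auto simp: zbiorientationD[OF assms(1)]\<close>)
  finally show ?thesis .
qed

lemma face_weight_eq:
  assumes "is_zbiorientation M B" "h \<in> H"
  shows "face_weight M B (F h) = - (\<Sum>k\<in>F h. max 0 (- weight B k))"
proof -
  have sub: "F h \<subseteq> H" using assms(2) by (rule orbit_sub_H)
  have "face_weight M B (F h) = (\<Sum>k\<in>F h \<inter> outgoing M B. - max 0 (- weight B k))"
    unfolding face_weight_def by (rule sum.cong) (auto simp: zbiorientationD[OF assms(1)])
  also have "\<dots> = (\<Sum>k\<in>F h. - max 0 (- weight B k))"
    by (rule sum.mono_neutral_left)
      (use sub finite_subset_H[OF sub] in \<open>auto simp: zbiorientationD[OF assms(1)]\<close>)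
  finally show ?thesis by (simp add: sum_negf)
qed

lemma edge_weight_eq: "h \<in> H \<Longrightarrow> edge_weight B (E h) = weight B h + weight B (\<alpha> h)"
  using \<alpha>_neq[of h] by (auto simp: edge_weight_def edge_of_def)

end

context rooted_plane
begin

section \<open>Translation between orientations and flows\<close>

lemma contour_simple: "h \<in> root \<Longrightarrow> simple_cycle M (outer_contour M h)"
  using simple_contour_iff root_inj root_sides by blast

lemma Out_iff: "h \<in> Out \<longleftrightarrow> h \<in> root \<or> \<alpha> h \<in> root"
  unfolding Out_def by (metis UnE UnI1 UnI2 \<alpha>_\<alpha> imageE imageI)

lemma inner_edge_iff: "h \<in> H \<Longrightarrow> E h \<in> inner_edges M \<longleftrightarrow> h \<notin> Out"
  by (simp add: inner_edges_def edges_def outer_edges_def E_mem_image_iff Out_iff)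

lemma outer_vertex_iff: "h \<in> H \<Longrightarrow> V h \<in> outer_vertices M \<longleftrightarrow> h \<in> Z"
  by (simp add: outer_vertices_def Z_def)

lemma inner_halfedges_eq: "inner_halfedges M = H - Out"
proof -
  have "outer_halfedges M = Out"
    by (auto simp: outer_halfedges_def outer_edges_def edge_of_def Out_def)
  then show ?thesis by (simp add: inner_halfedges_def)
qed

lemma orientation_balanced:
  assumes "d_orientation (card root) M B"
  shows "balanced (\<lambda>h. max 0 (weight B h)) (\<lambda>h. max 0 (- weight B h))"
proof -
  have z: "is_zbiorientation M B" and
    e: "\<And>e. e \<in> inner_edges M \<Longrightarrow> edge_weight B e = d - 2" and
    v: "\<And>v. v \<in> inner_vertices M \<Longrightarrow> vertex_weight B v = d" and
    f: "\<And>f. f \<in> inner_faces M \<Longrightarrow> int (face_degree f) + face_weight M B f = d"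
    using assms by (auto simp: d_orientation_def)
  show ?thesis
    unfolding balanced_def
  proof (intro conjI ballI)
    fix h assume h: "h \<in> H - Out"
    then have "weight B h + weight B (\<alpha> h) = d - 2"
      using e[of "E h"] inner_edge_iff[of h] edge_weight_eq[of h B] by simp
    then show "max 0 (weight B h) - max 0 (- weight B h) +
        (max 0 (weight B (\<alpha> h)) - max 0 (- weight B (\<alpha> h))) = d - 2" by linarith
  next
    fix h assume h: "h \<in> H - Z"
    then have "V h \<in> inner_vertices M"
      using outer_vertex_iff[of h] by (simp add: inner_vertices_def vertices_def)
    from v[OF this] show "(\<Sum>k\<in>V h. max 0 (weight B k)) = d"
      using vertex_weight_eq[OF z, of h] h by simp
  next
    fix h assume h: "h \<in> H - root"
    then have "F h \<in> inner_faces M"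
      using mem_root_iff[of h] by (simp add: inner_faces_def faces_def)
    from f[OF this] show "(\<Sum>k\<in>F h. max 0 (- weight B k)) = int (card (F h)) - d"
      using face_weight_eq[OF z, of h] h by (simp add: face_degree_def)
  qed auto
qed

text \<open>Admissibility leaves the direction of each outer edge open. Two consecutive outer edges
  cannot both point away from their common vertex, which would then have no ingoing half-edge and be
  inaccessible; so if one root half-edge is ingoing, all are. If none were, the contour would be a
  counterclockwise circuit.\<close>

lemma suitable_root_ingoing:
  assumes z: "is_zbiorientation M B" and suit: "suitable M B" and h: "h \<in> root"
  shows "h \<in> ingoing B" "\<alpha> h \<notin> ingoing B"
proof -
  have adm: "admissible M B" and min: "minimal M B"
    and acc: "\<And>k. k \<in> root \<Longrightarrow> accessible_from M B (V k)"
    using suit by (auto simp: suitable_def outer_vertices_def)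
  have way: "k \<in> ingoing B \<longleftrightarrow> \<alpha> k \<notin> ingoing B" if k: "k \<in> root" for k
  proof -
    have "is_way B 1 (E k)" using adm k by (auto simp: admissible_def outer_edges_def)
    moreover have "\<alpha> k \<noteq> k" using k root_sub_H \<alpha>_neq by blast
    ultimately show ?thesis
      by (cases "k \<in> ingoing B"; cases "\<alpha> k \<in> ingoing B")
        (auto simp: is_way_def edge_of_def Int_insert_left)
  qed
  have next_in: "\<phi> k \<in> ingoing B" if k: "k \<in> root" "k \<in> ingoing B" for k
  proof (rule ccontr)
    assume neg: "\<phi> k \<notin> ingoing B"
    have \<phi>k: "\<phi> k \<in> root" using k(1) root_\<phi> by blast
    \<comment> \<open>The only outer half-edges at this vertex are \<open>\<phi> k\<close> and
      \<open>\<alpha> k\<close>, and the inner ones are outgoing by admissibility.\<close>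
    have none: "l \<notin> ingoing B" if l: "l \<in> H" "V l = V (\<phi> k)" for l
    proof
      assume ing: "l \<in> ingoing B"
      have lZ: "l \<in> Z" using V_mem_Z[OF l] root_sub_Z \<phi>k by blast
      then have "l \<in> Out"
        using adm ing l(1) outer_vertex_iff[OF l(1)]
        by (auto simp: admissible_def inner_halfedges_eq outgoing_def)
      then consider "l \<in> root" | m where "m \<in> root" "l = \<alpha> m" by (auto simp: Out_def)
      then show False
      proof cases
        case 1
        then have "l = \<phi> k" using root_inj l(2) \<phi>k by (auto dest: inj_onD)
        then show False using neg ing by simp
      next
        case 2
        have "\<phi> m \<in> root" using 2(1) root_\<phi> by blast
        moreover have "V (\<phi> m) = V (\<phi> k)" using 2(2) l(2) V_\<phi>[of m] by simp
        ultimately have "\<phi> m = \<phi> k" using root_inj \<phi>k by (auto dest: inj_onD)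
        then have "m = k" using inj_perm(2) by (simp add: inj_eq)
        then show False using way[OF k(1)] k(2) ing 2(2) by simp
      qed
    qed
    have "k \<in> H" using k(1) root_sub_H by blast
    then have ne: "V k \<noteq> V (\<phi> k)" using none[of k] k(2) by blast
    have "V (\<phi> k) \<in> vertices M" using \<phi>k root_sub_H by (auto simp: vertices_def)
    then have "(V k, V (\<phi> k)) \<in>
        {(V h, V (\<alpha> h)) |h. h \<in> H \<and> traversable M B h}\<^sup>*"
      using acc[OF k(1)] by (simp add: accessible_from_def)
    then obtain l where l: "l \<in> H" "traversable M B l" "V (\<alpha> l) = V (\<phi> k)"
      using ne by (cases rule: rtranclE) auto
    then show False using none[of "\<alpha> l"] traversable_iff[of l B] by simp
  qed
  have "\<exists>k\<in>root. k \<in> ingoing B"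
  proof (rule ccontr)
    assume none: "\<not> ?thesis"
    have inv: "\<phi> k \<in> H - root" if "k \<in> H - root" for k
      using that invariant_iff(2)[OF root_sub_H root_\<phi>, of k] by simp
    \<comment> \<open>The faces other than the root face form a region whose entire boundary could
      be traversed with the region on its left.\<close>
    have "H - root = {}"
    proof (rule minimalD[OF min])
      show "\<phi> ` (H - root) \<subseteq> H - root" using inv by blast
      show "traversable M B k" if k: "k \<in> H" "k \<notin> H - root" for k
      proof -
        have "k \<in> root" using k by blast
        then have "\<alpha> k \<in> ingoing B" using none way[of k] by blast
        then show ?thesis using traversable_iff[OF k(1)] by blast
      qed
    qed blast+
    moreover have "\<alpha> h \<in> H" using h root_sub_H by auto
    ultimately show False using root_sides[OF h] by blast
  qed
  then obtain k where k: "k \<in> root" "k \<in> ingoing B" by blast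
  have "F k \<subseteq> {l \<in> root. l \<in> ingoing B}"
    by (rule F_subset) (use k next_in root_\<phi> in auto)
  then show "h \<in> ingoing B" using h root_F[OF k(1)] by blast
  then show "\<alpha> h \<notin> ingoing B" using way[OF h] by blast
qed

lemma suitable_terminal_flow:
  assumes ori: "d_orientation (card root) M B" and suit: "suitable M B"
  shows "flow (\<lambda>h. max 0 (weight B h)) (\<lambda>h. max 0 (- weight B h))"
    "terminal (\<lambda>h. max 0 (weight B h)) (\<lambda>h. max 0 (- weight B h))"
proof -
  have z: "is_zbiorientation M B" and adm: "admissible M B"
    using ori by (auto simp: d_orientation_def)
  note ing = zbiorientationD[OF z]
  show flow: "flow (\<lambda>h. max 0 (weight B h)) (\<lambda>h. max 0 (- weight B h))"
    unfolding flow_def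
  proof (intro conjI ballI)
    show "balanced (\<lambda>h. max 0 (weight B h)) (\<lambda>h. max 0 (- weight B h))"
      by (rule orientation_balanced[OF ori])
    fix h assume h: "h \<in> root"
    have "E h \<in> outer_edges M" using h by (simp add: outer_edges_def)
    then have out: "\<And>k. k \<in> E h \<inter> outgoing M B \<Longrightarrow> weight B k = 0"
      and inn: "\<And>k. k \<in> E h \<inter> ingoing B \<Longrightarrow> weight B k = 1"
      using adm by (auto simp: admissible_def)
    note hB = suitable_root_ingoing[OF z suit h]
    have "weight B h = 1" using inn[of h] hB(1) by (simp add: edge_of_def)
    moreover have "\<alpha> h \<in> H" using h root_sub_H by auto
    then have "weight B (\<alpha> h) = 0" using out[of "\<alpha> h"] hB(2) by (simp add: edge_of_def outgoing_def)
    ultimately show "max 0 (weight B h) = 1" "max 0 (weight B (\<alpha> h)) = 0"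
      "max 0 (- weight B h) = 0" "max 0 (- weight B (\<alpha> h)) = 0" by simp_all
  next
    fix h assume h: "h \<in> Z - Out"
    then have "h \<in> outgoing M B"
      using adm outer_vertex_iff[of h] Z_sub_H by (auto simp: admissible_def inner_halfedges_eq)
    then show "max 0 (weight B h) = 0" by (simp add: ing)
  qed
  show "terminal (\<lambda>h. max 0 (weight B h)) (\<lambda>h. max 0 (- weight B h))"
  proof (rule terminalI[OF flow])
    show "max 0 (weight B h) = 0 \<or> max 0 (- weight B h) = 0" for h by linarith
  next
    fix S assume S: "S \<subseteq> H" "\<phi> ` S \<subseteq> S" "S \<inter> root = {}"
      and cross: "\<And>h. h \<in> H \<Longrightarrow> h \<notin> S \<Longrightarrow> \<alpha> h \<in> S \<Longrightarrow> 0 < max 0 (weight B (\<alpha> h))"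
    have "minimal M B" using suit by (simp add: suitable_def)
    then show "S = {}"
    proof (rule minimalD[OF _ S])
      fix h assume h: "h \<in> H" "h \<notin> S" "\<alpha> h \<in> S"
      then show "traversable M B h" using cross[OF h] traversable_iff[OF h(1)] by (simp add: ing)
    qed
  next
    fix U assume U: "U \<subseteq> H" "\<sigma> ` U \<subseteq> U" "U \<inter> Z = {}"
      and pred: "\<And>h. h \<in> U \<Longrightarrow> 0 < max 0 (weight B h) \<Longrightarrow> \<alpha> h \<in> U"
    note memU = vertex_invariant_mem[OF U(2)]
    obtain h0 where h0: "h0 \<in> root" using root_nonempty by blast
    have acc: "accessible_from M B (V h0)"
      using suit h0 by (simp add: suitable_def outer_vertices_def)
    \<comment> \<open>The last edge of a walk entering \<open>U\<close> would start in
      \<open>U\<close> by \<open>pred\<close>, so a walk from an outer vertex never enters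
      it.\<close>
    have unreach: "y \<notin> V ` U"
      if "(V h0, y) \<in> {(V h, V (\<alpha> h)) |h. h \<in> H \<and> traversable M B h}\<^sup>*" for y
      using that
    proof induction
      case base
      show ?case using memU[of h0] h0 root_sub_Z U(3) by blast
    next
      case (step y z)
      then obtain k where k: "k \<in> H" "traversable M B k" "y = V k" "z = V (\<alpha> k)" by blast
      show ?case
      proof
        assume "z \<in> V ` U"
        then have "\<alpha> k \<in> U" using memU k(4) by blast
        moreover have "0 < max 0 (weight B (\<alpha> k))"
          using k(1,2) traversable_iff[OF k(1)] by (simp add: ing)
        ultimately have "\<alpha> (\<alpha> k) \<in> U" by (rule pred)
        then show False using step.IH k(3) by simp
      qed
    qed
    show "U = {}"
    proof (rule ccontr)
      assume "U \<noteq> {}"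
      then obtain h where h: "h \<in> U" by blast
      then have "V h \<in> vertices M" using U(1) by (auto simp: vertices_def)
      then show False using unreach[of "V h"] acc h by (auto simp: accessible_from_def)
    qed
  qed
qed

lemma suitable_orientation_unique:
  assumes "d_orientation (card root) M B1" "suitable M B1"
    "d_orientation (card root) M B2" "suitable M B2"
  shows "B1 = B2"
proof -
  have z: "is_zbiorientation M B1" "is_zbiorientation M B2"
    using assms by (auto simp: d_orientation_def)
  have eq: "weight B1 h = weight B2 h" if h: "h \<in> H" for h
    using terminal_unique[OF suitable_terminal_flow[OF assms(1,2)] suitable_terminal_flow[OF assms(3,4)] h]
    by linarith
  have "weight B1 = weight B2"
    by (rule extensionalityI[of _ H]) (use z eq in \<open>auto simp: is_zbiorientation_def\<close>)
  moreover from this have "ingoing B1 = ingoing B2"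
    using zbiorientationD(1)[OF z(1)] zbiorientationD(1)[OF z(2)] by simp
  ultimately show ?thesis by simp
qed

lemma orientation_of_terminal_flow:
  assumes flow: "flow p n" and tml: "terminal p n"
  obtains B where "d_orientation (card root) M B" "suitable M B"
proof -
  note b = balancedD[OF flowD(1)[OF flow]]
  define w where "w = restrict (\<lambda>h. p h - n h) H"
  define B where "B = \<lparr>ingoing = {h \<in> H. w h > 0}, weight = w\<rparr>"
  have [simp]: "weight B = w" "ingoing B = {h \<in> H. w h > 0}" by (simp_all add: B_def)
  have w: "w h = p h - n h" if "h \<in> H" for h using that by (simp add: w_def)
  \<comment> \<open>By complementarity \<open>p\<close> and \<open>n\<close> are the positive and
    negative parts of their difference, so \<open>w\<close> retains both.\<close>
  have pw: "max 0 (w h) = p h" and nw: "max 0 (- w h) = n h" if "h \<in> H" for h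
    using terminal_complementary[OF flow tml that] b(1,2)[OF that] w[OF that] by auto
  have p_pos: "p h > 0 \<longleftrightarrow> w h > 0" if "h \<in> H" for h using pw[OF that] by linarith
  have z: "is_zbiorientation M B"
    by (auto simp: is_zbiorientation_def outgoing_def w_def)
  note out = zbiorientationD(2)[OF z]
  have rootw: "w h = 1" "w (\<alpha> h) = 0" if h: "h \<in> root" for h
  proof -
    have "h \<in> H" using h root_sub_H by blast
    then show "w h = 1" "w (\<alpha> h) = 0" using w[of h] w[of "\<alpha> h"] flowD(2-5)[OF flow h] by simp_all
  qed
  have adm: "admissible M B"
    unfolding admissible_def
  proof (intro conjI ballI impI)
    show "simple_cycle M (outer_contour M h)" if "h \<in> root" for h using that by (rule contour_simple)
  next
    fix e assume "e \<in> outer_edges M"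
    then obtain h where h: "h \<in> root" "e = E h" by (auto simp: outer_edges_def)
    have hH: "h \<in> H" using h root_sub_H by blast
    have eB: "e \<inter> ingoing B = {h}" "e \<inter> outgoing M B = {\<alpha> h}"
      using h(2) hH rootw[OF h(1)] unfolding out by (auto simp: edge_of_def)
    then show "is_way B 1 e" by (simp add: is_way_def)
    show "weight B k = 0" if "k \<in> e \<inter> outgoing M B" for k
      using that rootw[OF h(1)] unfolding eB by simp
    show "weight B k = 1" if "k \<in> e \<inter> ingoing B" for k
      using that rootw[OF h(1)] unfolding eB by simp
  next
    fix h assume h: "h \<in> inner_halfedges M" "V h \<in> outer_vertices M"
    then have "h \<in> Z" "h \<notin> Out" "h \<in> H" using outer_vertex_iff[of h] by (auto simp: inner_halfedges_eq)
    then show "h \<in> outgoing M B" using flowD(6)[OF flow] b(2)[of h] w[of h] by (simp add: out)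
  qed
  have ori: "d_orientation (card root) M B"
    unfolding d_orientation_def
  proof (intro conjI ballI z adm)
    fix h assume "h \<in> outgoing M B"
    then have h: "h \<in> H" "w h \<le> 0" by (auto simp: out)
    \<comment> \<open>A weight of -3 or less would leave more than \<open>d\<close> for the opposite
      half-edge: too much for an inner vertex, while at an outer vertex that half-edge has
      \<open>p\<close> equal to 0.\<close>
    have "w h \<ge> - 2"
    proof (rule ccontr)
      assume neg: "\<not> ?thesis"
      have "h \<notin> Out"
        using neg rootw by (auto simp: Out_def)
      then have "p h - n h + (p (\<alpha> h) - n (\<alpha> h)) = d - 2" using b(3)[OF h(1)] by simp
      then have big: "p (\<alpha> h) > d" using neg w[OF h(1)] b(2)[of "\<alpha> h"] h(1) by simp
      have aH: "\<alpha> h \<in> H" using h(1) by simp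
      show False
      proof (cases "\<alpha> h \<in> Z")
        case True
        then show ?thesis using flowD(6)[OF flow True] \<open>h \<notin> Out\<close> big by simp
      next
        case False
        have sub: "V (\<alpha> h) \<subseteq> H" using aH by (rule orbit_sub_H)
        have "p (\<alpha> h) \<le> (\<Sum>k\<in>V (\<alpha> h). p k)"
          by (rule member_le_sum) (use sub b(1) finite_subset_H[OF sub] in auto)
        then show ?thesis using b(4)[OF aH False] big by simp
      qed
    qed
    then show "weight B h \<in> {0, - 1, - 2}" using h(2) by auto
  next
    fix e assume e: "e \<in> inner_edges M"
    then obtain h where h: "h \<in> H" "e = E h" by (auto simp: inner_edges_def edges_def)
    then have "h \<notin> Out" using e inner_edge_iff by blast
    then show "edge_weight B e = d - 2"
      using h b(3)[OF h(1)] edge_weight_eq[OF h(1), of B] w[of h] w[of "\<alpha> h"] by simp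
  next
    fix v assume v: "v \<in> inner_vertices M"
    then obtain h where h: "h \<in> H" "v = V h" by (auto simp: inner_vertices_def vertices_def)
    then have "h \<notin> Z" using v outer_vertex_iff[of h] by (auto simp: inner_vertices_def)
    moreover have "(\<Sum>k\<in>V h. max 0 (w k)) = (\<Sum>k\<in>V h. p k)"
      by (rule sum.cong) (use pw orbit_sub_H(1)[OF h(1)] in auto)
    ultimately show "vertex_weight B v = d"
      using h(2) vertex_weight_eq[OF z h(1)] b(4)[OF h(1)] by simp
  next
    fix f assume f: "f \<in> inner_faces M"
    then obtain h where h: "h \<in> H" "f = F h" by (auto simp: inner_faces_def faces_def)
    then have "h \<notin> root" using f mem_root_iff[of h] by (auto simp: inner_faces_def)
    moreover have "(\<Sum>k\<in>F h. max 0 (- w k)) = (\<Sum>k\<in>F h. n k)"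
      by (rule sum.cong) (use nw orbit_sub_H(2)[OF h(1)] in auto)
    ultimately show "int (face_degree f) + face_weight M B f = d"
      using h(2) face_weight_eq[OF z h(1)] b(5)[OF h(1)] by (simp add: face_degree_def)
  qed
  have trav: "traversable M B h \<longleftrightarrow> p (\<alpha> h) > 0" if "h \<in> H" for h
    using traversable_iff[OF that, of B] p_pos[of "\<alpha> h"] that by simp
  have "minimal M B"
    unfolding minimal_iff
  proof (intro allI impI)
    fix S assume S: "S \<subseteq> H" "\<phi> ` S \<subseteq> S" "S \<inter> root = {}"
      and cross: "\<forall>h\<in>H. h \<notin> S \<longrightarrow> \<alpha> h \<in> S \<longrightarrow> traversable M B h"
    show "S = {}" by (rule terminal_minimal[OF tml S]) (use cross trav in blast)
  qed
  moreover have "accessible_from M B v" if "v \<in> outer_vertices M" for v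
  proof -
    let ?R = "{(V h, V (\<alpha> h)) |h. h \<in> H \<and> traversable M B h}"
    obtain r where r: "r \<in> root" "v = V r" using \<open>v \<in> outer_vertices M\<close> by (auto simp: outer_vertices_def)
    have outer: "(v, V k) \<in> ?R\<^sup>*" if "k \<in> root" for k
    proof -
      \<comment> \<open>The root half-edges are ingoing, so the contour is directed against \<phi>
        and reachability spreads backwards along the orbit.\<close>
      have "orbit \<phi> r \<subseteq> {k. (v, V k) \<in> ?R\<^sup>*}"
      proof (rule orbit_subset_backwards_closed[OF permutation(2)])
        fix y assume y: "y \<in> orbit \<phi> r" "\<phi> y \<in> {k. (v, V k) \<in> ?R\<^sup>*}"
        have y_root: "y \<in> root" using y(1) root_F[OF r(1)] by (simp add: F_orbit)
        then have yH: "y \<in> H" using root_sub_H by blast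
        have "traversable M B (\<alpha> y)" using trav[of "\<alpha> y"] yH flowD(2)[OF flow y_root] by simp
        then have "(V (\<alpha> y), V (\<alpha> (\<alpha> y))) \<in> ?R" using yH by (intro CollectI exI[of _ "\<alpha> y"]) simp
        then have "(V (\<phi> y), V y) \<in> ?R" by (simp add: V_\<phi>)
        then show "y \<in> {k. (v, V k) \<in> ?R\<^sup>*}" using y(2) by (auto intro: rtrancl_into_rtrancl)
      qed (use r(2) in simp)
      then show ?thesis using that root_F[OF r(1)] by (auto simp: F_orbit)
    qed
    \<comment> \<open>The half-edges at unreachable vertices are closed under predecessors and avoid
      the outer vertices, which are all reachable along the contour.\<close>
    have "{h \<in> H. (v, V h) \<notin> ?R\<^sup>*} = {}"
    proof (rule terminal_accessible[OF flow tml])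
      show "{h \<in> H. (v, V h) \<notin> ?R\<^sup>*} \<inter> Z = {}"
      proof (rule ccontr)
        assume "{h \<in> H. (v, V h) \<notin> ?R\<^sup>*} \<inter> Z \<noteq> {}"
        then obtain h where h: "(v, V h) \<notin> ?R\<^sup>*" "h \<in> Z" by blast
        then obtain k where "k \<in> root" "V h = V k" by (auto simp: Z_def)
        then show False using outer h(1) by simp
      qed
      fix h assume h: "h \<in> {h \<in> H. (v, V h) \<notin> ?R\<^sup>*}" "p h > 0"
      have "(v, V (\<alpha> h)) \<notin> ?R\<^sup>*"
      proof
        assume reach: "(v, V (\<alpha> h)) \<in> ?R\<^sup>*"
        have "traversable M B (\<alpha> h)" using trav[of "\<alpha> h"] h by simp
        then have "(V (\<alpha> h), V (\<alpha> (\<alpha> h))) \<in> ?R" using h by (intro CollectI exI[of _ "\<alpha> h"]) simp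
        then have "(v, V h) \<in> ?R\<^sup>*" using reach by (simp add: rtrancl_into_rtrancl)
        then show False using h by simp
      qed
      then show "\<alpha> h \<in> {h \<in> H. (v, V h) \<notin> ?R\<^sup>*}" using h by simp
    qed auto
    then have "(v, V h) \<in> ?R\<^sup>*" if "h \<in> H" for h using that by blast
    then show ?thesis by (auto simp: accessible_from_def vertices_def)
  qed
  ultimately have "suitable M B" using adm by (simp add: suitable_def)
  then show thesis using that ori by blast
qed

end

theorem theorem4p7:
  fixes d :: nat and M :: "'h plane_map"
  assumes "d > 0"
    and "is_plane_map M"
    and "outer_degree M = d"
    and "\<forall>f\<in>faces M. \<not> face_degree f < d"
  shows "((\<exists>B. d_orientation d M B) \<longleftrightarrow> girth M = enat d) \<and>
         (girth M = enat d \<longrightarrow> (\<exists>!B. d_orientation d M B \<and> suitable M B))"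
proof -
  interpret plane M by unfold_locales (rule assms(2))
  have d: "d = card (root_face M)" using assms(3) by (simp add: outer_degree_def face_degree_def)
  have girth: "girth M = enat d" if "d_orientation d M B" for B
  proof -
    obtain h where h: "h \<in> root_face M" using root_nonempty by blast
    have "simple_cycle M (outer_contour M h)"
      using that h by (auto simp: d_orientation_def admissible_def)
    then have "inj_on (vertex_of M) (root_face M) \<and> (\<forall>k\<in>root_face M. opp M k \<notin> root_face M)"
      using simple_contour_iff[OF h] by blast
    \<comment> \<open>In this direction simplicity of the contour comes from admissibility, in the
      other one from the girth.\<close>
    then interpret rooted_plane M by unfold_locales auto
    have "balanced (\<lambda>h. max 0 (weight B h)) (\<lambda>h. max 0 (- weight B h))"
      using that unfolding d by (rule orientation_balanced)
    then have "card (root_face M) \<le> length C" if "simple_cycle M C" for C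
      using that by (rule cycle_length_ge)
    then show ?thesis
      unfolding d by (rule girth_eqI) (use contour_simple[OF h] outer_contour_props(3)[OF h] in auto)
  qed
  have ex1: "\<exists>!B. d_orientation d M B \<and> suitable M B" if g: "girth M = enat d"
  proof -
    interpret rooted_plane M
      using root_contour_simple[OF g[unfolded d]] by unfold_locales
    obtain p n where "flow p n" "terminal p n"
      using terminal_flow_exists girth_ge[OF g[unfolded d]] by blast
    then obtain B where "d_orientation d M B" "suitable M B"
      unfolding d by (rule orientation_of_terminal_flow)
    then show ?thesis
      using suitable_orientation_unique unfolding d by blast
  qed
  show ?thesis using girth ex1 by blast
qed

end
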